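(* In the $K$-tier network model described in the context with noise power $W\ge0$, let $\mathcal U_k=\mathbb E[\log_2(1+\mathrm{SINR}_k)]$ be the average achievable rate of a typical user associated with tier $k$. For $\beta>0$ and $x>0$ let $\sigma_k(\beta)=\beta W/P_k$, $\tau_{j,k}(\beta)=\beta/(M_{j,k}B_{j,k})$, $\varphi_{j,k}(0;\beta)=\frac{\delta_j\tau_{j,k}\,{}_2F_1(1,1-\delta_j;2-\delta_j;-\tau_{j,k})}{1-\delta_j}$, $\varphi_{j,k}(n;\beta)=\frac{\delta_j\tau_{j,k}^n\,{}_2F_1(n+1,n-\delta_j;n+1-\delta_j;-\tau_{j,k})}{n-\delta_j}$ for $n\ge1$ (with $\tau_{j,k}=\tau_{j,k}(\beta)$), $g_{k,n}(x;\beta)=\sum_j\mathcal A_j\lambda_j\Omega_{j,k}^{\delta_j}\varphi_{j,k}(n;\beta)x^{\delta_{j,k}}$, and let $\mathbf Q_{M_k}(x;\beta)$ be the $M_k\times M_k$ lower triangular Toeplitz matrix with zero diagonal and $(p,q)$ entry $g_{k,p-q}(x;\beta)$ for $p>q$. Then $$\mathcal U_k=\frac{1}{\ln2}\frac{\lambda_k}{\mathcal T_k}\sum_{i=0}^{M_k-1}\sum_{m=0}^{M_k-1}\sum_{n=0}^{m}\int_0^{R_k^2}\!\!\int_0^\infty\frac{\pi^{i+1}\sigma_k(\beta)^{m-n}}{(m-n)!\,i!}\frac{x^{\frac{\alpha_k}{2}(m-n)}}{1+\beta}\exp\Big(-\sigma_k(\beta)x^{\alpha_k/2}-\pi g_{k,0}(x;\beta)-\pi\sum_{j=1}^K\lambda_j\Omega_{j,k}^{\delta_j}x^{\delta_{j,k}}\Big)\mathbf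 Q^i_{M_k}(x;\beta)(n+1,1)\,d\beta\,dx,$$ where $\mathbf Q^i(p,q)$ denotes the $(p,q)$ entry of the $i$-th power.
   Context: Network model: $\mathcal K=\{1,\dots,K\}$. In $\mathbb R^2$, tier-$k$ BSs form a homogeneous PPP of intensity $\lambda_k>0$ and users a homogeneous PPP of intensity $\lambda_u>0$, all independent. Tier-$k$ BSs have transmit power $P_k>0$, $M_k\in\mathbb N$ antennas, bias $B_k>0$, path-loss exponent $\alpha_k>2$. $\Omega_k=P_kM_kB_k$, $\delta_k=2/\alpha_k$, $\mathcal V_{j,k}=\mathcal V_j/\mathcal V_k$ for $\mathcal V\in\{P,M,B,\Omega,\delta\}$. Access threshold $\epsilon>0$, $R_k=(\Omega_k/\epsilon)^{1/\alpha_k}$. Association: with $D_k$ the distance from a typical user to its nearest tier-$k$ BS, $\hat\rho_k=\Omega_kD_k^{-\alpha_k}$ if $D_k\le R_k$, else $0$; the user is associated with tier $k$ iff $\hat\rho_k>\hat\rho_j$ for all $j\ne k$, with probability $\mathcal T_k=\pi\lambda_k\int_0^{R_k^2}\exp(-\pi\sum_j\lambda_j\Omega_{j,k}^{\delta_j}r^{\delta_{j,k}})dr$. Activation probability of tier $j$: $\mathcal A_j=1-\exp\big(-\pi\lambda_u\int_0^{R_j^2}\exp(-\pi\sum_l\lambda_l\Omega_{l,j}^{\delta_l}r^{\delta_{l,j}})dr\big)$; active tier-$j$ BSs are modeled as a homogeneous PPP of intensity $\mathcal A_j\lambda_j$. SINR model: conditional on association with tier $k$, the serving distance $X_k$ has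 density $\frac{2\pi\lambda_k}{\mathcal T_k}x\exp(-\pi\sum_j\lambda_j\Omega_{j,k}^{\delta_j}x^{2\delta_{j,k}})$ on $(0,R_k]$; given $X_k$, interferers of tier $j$ are the points of independent homogeneous PPPs of intensity $\mathcal A_j\lambda_j$ outside the disk around the user of radius $\Omega_{j,k}^{1/\alpha_j}X_k^{\alpha_k/\alpha_j}$; the signal gain $\|\mathbf h\|^2\sim\mathrm{Gamma}(M_k,1)$, an interferer of tier $j$ at distance $r$ contributes $P_jVr^{-\alpha_j}$ with $V\sim\mathrm{Exp}(1)$, all fading independent of each other and of the point processes; $I_o$ is the total interference and $\mathrm{SINR}_k=P_k\|\mathbf h\|^2X_k^{-\alpha_k}/(I_o+W)$. ${}_2F_1$ is the Gauss hypergeometric function. *)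

theory Defs
  imports "HOL-Probability.Probability" "Jordan_Normal_Form.Matrix"
begin

section \<open>Network parameters (tiers are indexed by 1..K)\<close>

definition Omega :: "(nat \<Rightarrow> real) \<Rightarrow> (nat \<Rightarrow> nat) \<Rightarrow> (nat \<Rightarrow> real) \<Rightarrow> nat \<Rightarrow> real" where
  "Omega P M B j = P j * real (M j) * B j"

definition delta :: "(nat \<Rightarrow> real) \<Rightarrow> nat \<Rightarrow> real" where
  "delta alpha j = 2 / alpha j"

definition Rad :: "(nat \<Rightarrow> real) \<Rightarrow> (nat \<Rightarrow> nat) \<Rightarrow> (nat \<Rightarrow> real) \<Rightarrow> (nat \<Rightarrow> real) \<Rightarrow> real \<Rightarrow> nat \<Rightarrow> real" where
  "Rad P M B alpha eps k = (Omega P M B k / eps) powr (1 / alpha k)"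

definition assoc_sum :: "nat \<Rightarrow> (nat \<Rightarrow> real) \<Rightarrow> (nat \<Rightarrow> real) \<Rightarrow> (nat \<Rightarrow> nat) \<Rightarrow> (nat \<Rightarrow> real)
    \<Rightarrow> (nat \<Rightarrow> real) \<Rightarrow> nat \<Rightarrow> real \<Rightarrow> real" where
  "assoc_sum K lam P M B alpha k r =
     (\<Sum>j = 1..K. lam j * (Omega P M B j / Omega P M B k) powr delta alpha j
                     * r powr (delta alpha j / delta alpha k))"

definition assocT :: "nat \<Rightarrow> (nat \<Rightarrow> real) \<Rightarrow> (nat \<Rightarrow> real) \<Rightarrow> (nat \<Rightarrow> nat) \<Rightarrow> (nat \<Rightarrow> real)
    \<Rightarrow> (nat \<Rightarrow> real) \<Rightarrow> real \<Rightarrow> nat \<Rightarrow> real" where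
  "assocT K lam P M B alpha eps k =
     pi * lam k * set_lebesgue_integral lborel {0..(Rad P M B alpha eps k)\<^sup>2}
        (\<lambda>r. exp (- pi * assoc_sum K lam P M B alpha k r))"

definition activ :: "nat \<Rightarrow> (nat \<Rightarrow> real) \<Rightarrow> (nat \<Rightarrow> real) \<Rightarrow> (nat \<Rightarrow> nat) \<Rightarrow> (nat \<Rightarrow> real)
    \<Rightarrow> (nat \<Rightarrow> real) \<Rightarrow> real \<Rightarrow> real \<Rightarrow> nat \<Rightarrow> real" where
  "activ K lam P M B alpha eps lam_u j =
     1 - exp (- pi * lam_u * set_lebesgue_integral lborel {0..(Rad P M B alpha eps j)\<^sup>2}
        (\<lambda>r. exp (- pi * assoc_sum K lam P M B alpha j r)))"

text \<open>Principal branch of 2F1(a,b;c;z) for real z < 1 and c > b > 0, given by Euler's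
  integral representation (the analytic continuation of the hypergeometric series).\<close>
definition hyp2F1 :: "real \<Rightarrow> real \<Rightarrow> real \<Rightarrow> real \<Rightarrow> real" where
  "hyp2F1 a b c z = Gamma c / (Gamma b * Gamma (c - b)) *
     set_lebesgue_integral lborel {0<..<1}
       (\<lambda>t. t powr (b - 1) * (1 - t) powr (c - b - 1) * (1 - z * t) powr (- a))"

definition tau :: "(nat \<Rightarrow> nat) \<Rightarrow> (nat \<Rightarrow> real) \<Rightarrow> nat \<Rightarrow> nat \<Rightarrow> real \<Rightarrow> real" where
  "tau M B j k \<beta> = \<beta> / ((real (M j) / real (M k)) * (B j / B k))"

definition phi :: "(nat \<Rightarrow> nat) \<Rightarrow> (nat \<Rightarrow> real) \<Rightarrow> (nat \<Rightarrow> real) \<Rightarrow> nat \<Rightarrow> nat \<Rightarrow> nat \<Rightarrow> real \<Rightarrow> real" where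
  "phi M B alpha j k n \<beta> =
     (let t = tau M B j k \<beta>; d = delta alpha j in
      if n = 0 then d * t * hyp2F1 1 (1 - d) (2 - d) (- t) / (1 - d)
      else d * t ^ n * hyp2F1 (real n + 1) (real n - d) (real n + 1 - d) (- t) / (real n - d))"

definition gfun :: "nat \<Rightarrow> (nat \<Rightarrow> real) \<Rightarrow> (nat \<Rightarrow> real) \<Rightarrow> (nat \<Rightarrow> nat) \<Rightarrow> (nat \<Rightarrow> real)
    \<Rightarrow> (nat \<Rightarrow> real) \<Rightarrow> real \<Rightarrow> real \<Rightarrow> nat \<Rightarrow> nat \<Rightarrow> real \<Rightarrow> real \<Rightarrow> real" where
  "gfun K lam P M B alpha eps lam_u k n x \<beta> =
     (\<Sum>j = 1..K. activ K lam P M B alpha eps lam_u j * lam j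
        * (Omega P M B j / Omega P M B k) powr delta alpha j
        * phi M B alpha j k n \<beta> * x powr (delta alpha j / delta alpha k))"

text \<open>Lower-triangular Toeplitz matrix Q_{M_k}(x;beta), 0-indexed:
  entry (p,q) is g_{k,p-q} for p > q and 0 otherwise.\<close>
definition Qmat :: "nat \<Rightarrow> (nat \<Rightarrow> real) \<Rightarrow> (nat \<Rightarrow> real) \<Rightarrow> (nat \<Rightarrow> nat) \<Rightarrow> (nat \<Rightarrow> real)
    \<Rightarrow> (nat \<Rightarrow> real) \<Rightarrow> real \<Rightarrow> real \<Rightarrow> nat \<Rightarrow> real \<Rightarrow> real \<Rightarrow> real mat" where
  "Qmat K lam P M B alpha eps lam_u k x \<beta> =
     mat (M k) (M k) (\<lambda>(p, q). if q < p then gfun K lam P M B alpha eps lam_u k (p - q) x \<beta> else 0)"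

text \<open>A point process given by an enumeration of its points; N(A) counts the points in A.
  It is a homogeneous PPP of intensity mu if the counts of bounded Borel sets are a.s. finite and
  Poisson(mu * |A|) distributed, and counts of pairwise disjoint bounded Borel sets are independent.\<close>
definition count_pts :: "(nat \<Rightarrow> 'a \<Rightarrow> real \<times> real) \<Rightarrow> (real \<times> real) set \<Rightarrow> 'a \<Rightarrow> nat" where
  "count_pts Phi A \<omega> = card {n. Phi n \<omega> \<in> A}"

definition is_PPP :: "'a measure \<Rightarrow> (nat \<Rightarrow> 'a \<Rightarrow> real \<times> real) \<Rightarrow> real \<Rightarrow> bool" where
  "is_PPP Mp Phi mu \<longleftrightarrow>
     (\<forall>n. Phi n \<in> borel_measurable Mp) \<and>
     (\<forall>A \<in> sets lborel. bounded A \<longrightarrow>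
        (AE \<omega> in Mp. finite {n. Phi n \<omega> \<in> A}) \<and>
        (\<forall>m. measure Mp {\<omega> \<in> space Mp. count_pts Phi A \<omega> = m}
               = (mu * measure lborel A) ^ m / fact m * exp (- mu * measure lborel A))) \<and>
     (\<forall>(As :: nat \<Rightarrow> (real \<times> real) set) m.
        (\<forall>i<m. As i \<in> sets lborel \<and> bounded (As i)) \<and> disjoint_family_on As {..<m} \<longrightarrow>
        prob_space.indep_vars Mp (\<lambda>_. count_space UNIV) (\<lambda>i. count_pts Phi (As i)) {..<m})"

definition gen_sigma :: "'a measure \<Rightarrow> ('a \<Rightarrow> 'b::topological_space) \<Rightarrow> 'a set set" where
  "gen_sigma Mp f = sigma_sets (space Mp) {f -` A \<inter> space Mp | A. A \<in> sets borel}"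

definition gen_sigma_seq :: "'a measure \<Rightarrow> (nat \<Rightarrow> 'a \<Rightarrow> 'b::topological_space) \<Rightarrow> 'a set set" where
  "gen_sigma_seq Mp F = sigma_sets (space Mp) (\<Union>n. {F n -` A \<inter> space Mp | A. A \<in> sets borel})"

text \<open>Groups of random quantities: serving distance, signal gain, tier-j interferer process,
  fading mark of the n-th point of tier j.\<close>
datatype rvgroup = GX | GH | GPhi nat | GV nat nat

end

theory Submission
  imports Defs "HOL-Complex_Analysis.Laurent_Convergence"
begin

text \<open>
  Given the serving distance \<open>x\<close>, put \<open>\<theta> = \<beta> x\<^bsup>\<alpha>\<^esup> / P\<^sub>k\<close> and \<open>J = I\<^sub>o + W\<close>. The Erlang tail gives
  \<open>\<P>(SINR\<^sub>k > \<beta>) = (\<Sum>m<M\<^sub>k. E[(\<theta> J)\<^sup>m / m! * exp (-\<theta> J)])\<close>, and these expectations are the Taylor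
  coefficients at \<open>z = 0\<close> of \<open>E[exp (-\<theta> (1 - z) J)]\<close>. The Laplace functional of the marked Poisson
  processes evaluates the latter as \<open>exp (-\<theta> W - \<pi> g\<^sub>0) * exp (\<theta> W z) * exp (\<pi> G(z))\<close> with
  \<open>G(z) = (\<Sum>n\<ge>1. g\<^sub>n z\<^sup>n)\<close>, because
  \<open>1 / (1 + a (1 - z)) = (\<Sum>n. a\<^sup>n z\<^sup>n / (1 + a)\<^bsup>n+1\<^esup>)\<close> and Euler's integral identifies the integrated coefficients with the
  hypergeometric \<open>\<phi>\<^sub>j\<^sub>,\<^sub>k(n)\<close>. The coefficient of \<open>z\<^sup>n\<close> in \<open>G\<^sup>i\<close> is the first-column
  entry of the \<open>i\<close>-th power of the Toeplitz matrix of \<open>G\<close>. Integrating the coverage probability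
  against \<open>d\<beta> / (1 + \<beta>)\<close> and the law of the serving distance yields the rate; all integrands are
  nonnegative, and the total is finite since the Laplace transform decays like
  \<open>exp (-c x\<^sup>2 \<beta>\<^sup>\<delta>)\<close>.
\<close>

section \<open>Independence and power series\<close>

text \<open>A point process is given only through its counts in bounded sets, while the interference
  sums over all its points; hence Campbell's formula and the Laplace functional are derived from the
  counts through step functions. The exclusion disk is not part of the law of the processes: points
  inside it contribute 0 to the sum, so the processes stay independent of the serving distance,
  which can then be frozen. The radial variable is \<open>u = (norm y / rho) powr (- alpha)\<close>,
  the attenuation relative to the edge of the disk. It carries every exterior region to the unit
  interval, and because the biased powers balance at the edge, the power received from there
  relative to the useful power does not depend on the serving distance; this is why
  \<open>tau\<close> contains no distance. The diagonal of the Toeplitz matrix is 0 because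
  \<open>g\<^sub>0\<close> is kept outside the series; the matrix is then nilpotent, which bounds
  the range of \<open>i\<close>. The noise may vanish, so positivity of the denominator has to come
  from the interference. Expectations are computed as extended nonnegative integrals because a
  diverging Bochner integral is 0 by convention.\<close>

lemma (in prob_space) nn_integral_indep_var:
  assumes ind: "indep_var S X T Y" and F[measurable]: "F \<in> borel_measurable (S \<Otimes>\<^sub>M T)"
  shows "(\<integral>\<^sup>+\<omega>. F (X \<omega>, Y \<omega>) \<partial>M) = (\<integral>\<^sup>+\<omega>. (\<integral>\<^sup>+\<omega>'. F (X \<omega>, Y \<omega>') \<partial>M) \<partial>M)"
proof -
  have X[measurable]: "X \<in> measurable M S" and Y[measurable]: "Y \<in> measurable M T"
    and eq: "distr M S X \<Otimes>\<^sub>M distr M T Y = distr M (S \<Otimes>\<^sub>M T) (\<lambda>\<omega>. (X \<omega>, Y \<omega>))"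
    using ind by (auto simp: indep_var_distribution_eq)
  \<comment> \<open>Independence says that the joint law is the product of the two laws, so the
    claim is Tonelli's theorem for that product, with both laws pulled back to the sample
    space.\<close>
  interpret Y: prob_space "distr M T Y"
    by (rule prob_space_distr) measurable
  have "(\<integral>\<^sup>+\<omega>. F (X \<omega>, Y \<omega>) \<partial>M) = (\<integral>\<^sup>+p. F p \<partial>(distr M S X \<Otimes>\<^sub>M distr M T Y))"
    unfolding eq by (subst nn_integral_distr) auto
  also have "\<dots> = (\<integral>\<^sup>+x. \<integral>\<^sup>+y. F (x, y) \<partial>distr M T Y \<partial>distr M S X)"
    by (rule Y.nn_integral_fst[symmetric]) (simp cong: measurable_cong_sets)
  also have "\<dots> = (\<integral>\<^sup>+x. \<integral>\<^sup>+\<omega>'. F (x, Y \<omega>') \<partial>M \<partial>distr M S X)"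
    by (intro nn_integral_cong) (auto simp: nn_integral_distr)
  also have "\<dots> = (\<integral>\<^sup>+\<omega>. (\<integral>\<^sup>+\<omega>'. F (X \<omega>, Y \<omega>') \<partial>M) \<partial>M)"
    by (subst nn_integral_distr) auto
  finally show ?thesis .
qed

text \<open>The difference of the two series represents the zero function near 0, while a nonzero
  power series has only isolated zeros. This allows Taylor coefficients to be read off from two
  closed forms of one function.\<close>

lemma has_fps_expansion_unique:
  fixes f :: "real \<Rightarrow> real"
  assumes "f has_fps_expansion F" "f has_fps_expansion G"
  shows "F = G"
proof (rule ccontr)
  assume "F \<noteq> G"
  define D where "D = F - G"
  have "D \<noteq> 0" using \<open>F \<noteq> G\<close> by (simp add: D_def)
  have D: "(\<lambda>_. 0) has_fps_expansion D"
    using has_fps_expansion_diff[OF assms] by (simp add: D_def)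
  define m where "m = subdegree D"
  have nz: "fps_nth D m \<noteq> 0"
    using \<open>D \<noteq> 0\<close> by (simp add: m_def)
  \<comment> \<open>Isolation of the zero requires a nonzero coefficient of positive index, so index
    0 is excluded by evaluating at the origin.\<close>
  have "fps_nth D 0 = 0"
    using D by (auto simp: has_fps_expansion_def eval_fps_at_0 dest!: eventually_nhds_x_imp_x)
  then have "m > 0"
    using nz by (cases m) auto
  obtain d where "d > 0" and d: "\<And>z. \<bar>z\<bar> < d \<Longrightarrow> eval_fps D z = 0"
    using D by (auto simp: has_fps_expansion_def eventually_nhds_metric dist_real_def)
  obtain r where r: "0 < r" "ereal r < fps_conv_radius D"
    using D ereal_dense2[of 0 "fps_conv_radius D"] by (auto simp: has_fps_expansion_def)
  have sums: "(\<lambda>n. fps_nth D n * (z - 0) ^ n) sums 0" if "norm z < min r d" for z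
  proof -
    have "ereal (norm z) < fps_conv_radius D"
      using that r by (metis ereal_less_eq(3) less_imp_le min_less_iff_conj order_le_less_trans)
    then have "(\<lambda>n. fps_nth D n * z ^ n) sums eval_fps D z"
      by (rule sums_eval_fps)
    with d[of z] that show ?thesis by simp
  qed
  show False
  proof (rule powser_0_nonzero)
    show "0 < min r d" using r \<open>d > 0\<close> by simp
    show "(\<lambda>n. fps_nth D n * (z - 0) ^ n) sums 0" if "norm (z - 0) < min r d" for z
      using sums[of z] that by simp
    fix s :: real
    assume "0 < s" "\<And>z::real. z \<in> cball 0 s - {0} \<Longrightarrow> (0::real) \<noteq> 0"
    from this(2)[of s] \<open>0 < s\<close> show False by simp
  qed (use nz \<open>m > 0\<close> in auto)
qed

text \<open>Nonnegative coefficients make convergence at the single point \<open>r\<close> dominate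
  every \<open>z\<close> of absolute value at most \<open>r\<close>, so the integrable majorant
  \<open>S\<close> alone justifies termwise integration. It is applied with Lebesgue measure, with
  counting measure and with the probability measure.\<close>

lemma has_fps_expansion_lebesgue_integral:
  fixes f :: "nat \<Rightarrow> 'a \<Rightarrow> real"
  assumes r: "0 < r"
    and meas[measurable]: "\<And>n. f n \<in> borel_measurable N"
    and nonneg: "\<And>n x. x \<in> space N \<Longrightarrow> 0 \<le> f n x"
    and sums: "\<And>x. x \<in> space N \<Longrightarrow> (\<lambda>n. f n x * r ^ n) sums S x"
    and int: "integrable N S"
  shows "(\<lambda>z. \<integral>x. (\<Sum>n. f n x * z ^ n) \<partial>N) has_fps_expansion Abs_fps (\<lambda>n. \<integral>x. f n x \<partial>N)"
proof (rule has_fps_expansionI)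
  have le_S: "f n x * r ^ n \<le> S x" if "x \<in> space N" for n x
    using sums[OF that] nonneg[OF that] r
      sum_le_suminf[of "\<lambda>n. f n x * r ^ n" "{n}"] by (auto simp: sums_iff)
  have int_r: "integrable N (\<lambda>x. f n x * r ^ n)" for n
  proof (rule Bochner_Integration.integrable_bound[OF int])
    show "AE x in N. norm (f n x * r ^ n) \<le> norm (S x)"
    proof (rule AE_I2)
      fix x assume x: "x \<in> space N"
      have "norm (f n x * r ^ n) = f n x * r ^ n"
        using nonneg[OF x] r by simp
      also have "\<dots> \<le> norm (S x)"
        using le_S[OF x, of n] by (simp only: real_norm_def)
      finally show "norm (f n x * r ^ n) \<le> norm (S x)" .
    qed
  qed measurable
  have int_f: "integrable N (f n)" for n
    using integrable_mult_left[OF int_r[of n], of "1 / r ^ n"] r by simp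
  \<comment> \<open>The integrated series at \<open>r\<close> has nonnegative terms and partial sums
    bounded by the integral of \<open>S\<close>; it is the comparison series for every other
    \<open>z\<close>.\<close>
  have sum_r: "summable (\<lambda>n. \<integral>x. f n x * r ^ n \<partial>N)"
  proof (rule bounded_imp_summable)
    show "0 \<le> (\<integral>x. f n x * r ^ n \<partial>N)" for n
      using nonneg r by (intro Bochner_Integration.integral_nonneg) auto
    fix n
    have "(\<Sum>k\<le>n. \<integral>x. f k x * r ^ k \<partial>N) = (\<integral>x. (\<Sum>k\<le>n. f k x * r ^ k) \<partial>N)"
      by (intro Bochner_Integration.integral_sum[symmetric] int_r)
    also have "\<dots> \<le> (\<integral>x. S x \<partial>N)"
    proof (rule integral_mono)
      show "(\<Sum>k\<le>n. f k x * r ^ k) \<le> S x" if "x \<in> space N" for x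
        using sums[OF that] nonneg[OF that] r sum_le_suminf[of "\<lambda>n. f n x * r ^ n" "{..n}"]
        by (auto simp: sums_iff)
    qed (auto intro: int_r int)
    finally show "(\<Sum>k\<le>n. \<integral>x. f k x * r ^ k \<partial>N) \<le> (\<integral>x. S x \<partial>N)" .
  qed
  have "eventually (\<lambda>z. z \<in> ball 0 r) (nhds (0::real))"
    using r by (intro eventually_nhds_in_open) auto
  then show "\<forall>\<^sub>F u in nhds 0. (\<lambda>n. fps_nth (Abs_fps (\<lambda>n. \<integral>x. f n x \<partial>N)) n * u ^ n) sums
      (\<integral>x. (\<Sum>n. f n x * u ^ n) \<partial>N)"
  proof eventually_elim
    fix z :: real assume "z \<in> ball 0 r"
    then have z: "\<bar>z\<bar> \<le> r" by simp
    have le: "norm (f n x * z ^ n) \<le> f n x * r ^ n" if "x \<in> space N" for n x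
      using nonneg[OF that] z by (auto simp: abs_mult power_abs intro!: mult_left_mono power_mono)
    have "(\<lambda>n. \<integral>x. f n x * z ^ n \<partial>N) sums (\<integral>x. (\<Sum>n. f n x * z ^ n) \<partial>N)"
    proof (rule sums_integral)
      show "integrable N (\<lambda>x. f n x * z ^ n)" for n
        using int_f by auto
      show "AE x in N. summable (\<lambda>n. norm (f n x * z ^ n))"
      proof (rule AE_I2)
        fix x assume x: "x \<in> space N"
        show "summable (\<lambda>n. norm (f n x * z ^ n))"
          by (rule summable_comparison_test'[OF sums_summable[OF sums[OF x]], of 0])
             (use le[OF x] in \<open>simp only: real_norm_def abs_abs\<close>)
      qed
      show "summable (\<lambda>n. \<integral>x. norm (f n x * z ^ n) \<partial>N)"
      proof (rule summable_comparison_test[OF _ sum_r], intro exI allI impI)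
        fix n
        show "norm (\<integral>x. norm (f n x * z ^ n) \<partial>N) \<le> (\<integral>x. f n x * r ^ n \<partial>N)"
        proof -
          have "(\<integral>x. norm (f n x * z ^ n) \<partial>N) \<le> (\<integral>x. f n x * r ^ n \<partial>N)"
            by (intro integral_mono integrable_norm integrable_mult_left int_f le)
          then show ?thesis
            by (simp add: Bochner_Integration.integral_nonneg)
        qed
      qed
    qed
    then show "(\<lambda>n. fps_nth (Abs_fps (\<lambda>n. \<integral>x. f n x \<partial>N)) n * z ^ n) sums (\<integral>x. (\<Sum>n. f n x * z ^ n) \<partial>N)"
      by simp
  qed
qed

section \<open>Campbell's formula\<close>

context prob_space
begin

text \<open>The sample space splits into the events \<open>N \<omega> = m\<close>, and nonnegativity
  of \<open>f\<close> lets the integral pass through this splitting. The generating function and the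
  mean are its two instances.\<close>

lemma poisson_nn_integral:
  fixes N :: "'a \<Rightarrow> nat" and f :: "nat \<Rightarrow> real"
  assumes N[measurable]: "N \<in> measurable M (count_space UNIV)"
    and pois: "\<And>m. prob {\<omega> \<in> space M. N \<omega> = m} = a ^ m / fact m * exp (- a)"
    and f: "\<And>m. 0 \<le> f m" and sums: "(\<lambda>m. f m * (a ^ m / fact m * exp (- a))) sums s"
  shows "(\<integral>\<^sup>+\<omega>. ennreal (f (N \<omega>)) \<partial>M) = ennreal s"
proof -
  have "(\<integral>\<^sup>+\<omega>. ennreal (f (N \<omega>)) \<partial>M)
      = (\<integral>\<^sup>+\<omega>. (\<Sum>m. ennreal (f m) * indicator {\<omega> \<in> space M. N \<omega> = m} \<omega>) \<partial>M)"
  proof (intro nn_integral_cong)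
    fix \<omega> assume "\<omega> \<in> space M"
    then have "(\<Sum>m. ennreal (f m) * indicator {\<omega> \<in> space M. N \<omega> = m} \<omega>)
        = (\<Sum>m\<in>{N \<omega>}. ennreal (f m) * indicator {\<omega> \<in> space M. N \<omega> = m} \<omega>)"
      by (intro suminf_finite) auto
    then show "ennreal (f (N \<omega>)) = (\<Sum>m. ennreal (f m) * indicator {\<omega> \<in> space M. N \<omega> = m} \<omega>)"
      using \<open>\<omega> \<in> space M\<close> by simp
  qed
  also have "\<dots> = (\<Sum>m. \<integral>\<^sup>+\<omega>. ennreal (f m) * indicator {\<omega> \<in> space M. N \<omega> = m} \<omega> \<partial>M)"
    by (intro nn_integral_suminf) measurable
  also have "\<dots> = (\<Sum>m. ennreal (f m * (a ^ m / fact m * exp (- a))))"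
  proof (intro suminf_cong)
    fix m
    have "(\<integral>\<^sup>+\<omega>. ennreal (f m) * indicator {\<omega> \<in> space M. N \<omega> = m} \<omega> \<partial>M)
        = ennreal (f m) * ennreal (prob {\<omega> \<in> space M. N \<omega> = m})"
      by (subst nn_integral_cmult_indicator) (auto simp: emeasure_eq_measure)
    then show "(\<integral>\<^sup>+\<omega>. ennreal (f m) * indicator {\<omega> \<in> space M. N \<omega> = m} \<omega> \<partial>M)
        = ennreal (f m * (a ^ m / fact m * exp (- a)))"
      unfolding pois[of m, symmetric] ennreal_mult[OF f[of m] measure_nonneg] .
  qed
  also have "\<dots> = ennreal s"
  \<comment> \<open>No sign of \<open>a\<close> is given here; the Poisson weights are nonnegative
    because they are probabilities.\<close>
  proof (rule suminf_ennreal_eq[OF _ sums])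
    show "0 \<le> f m * (a ^ m / fact m * exp (- a))" for m
      using f[of m] measure_nonneg[of M "{\<omega> \<in> space M. N \<omega> = m}"] unfolding pois[of m] by (rule mult_nonneg_nonneg)
  qed
  finally show ?thesis .
qed

lemma poisson_pgf:
  fixes N :: "'a \<Rightarrow> nat"
  assumes N: "N \<in> measurable M (count_space UNIV)"
    and pois: "\<And>m. prob {\<omega> \<in> space M. N \<omega> = m} = a ^ m / fact m * exp (- a)"
    and q: "0 \<le> q"
  shows "(\<integral>\<^sup>+\<omega>. ennreal (q ^ N \<omega>) \<partial>M) = ennreal (exp (- a * (1 - q)))"
proof (rule poisson_nn_integral[OF N pois])
  have "(\<lambda>m. exp (- a) * ((a * q) ^ m / fact m)) sums (exp (- a) * exp (a * q))"
    using exp_converges[of "a * q"] by (intro sums_mult) (simp add: divide_inverse mult.commute)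
  then show "(\<lambda>m. q ^ m * (a ^ m / fact m * exp (- a))) sums exp (- a * (1 - q))"
    by (simp add: exp_add[symmetric] algebra_simps power_mult_distrib)
qed (use q in auto)

lemma poisson_mean:
  fixes N :: "'a \<Rightarrow> nat"
  assumes N: "N \<in> measurable M (count_space UNIV)"
    and pois: "\<And>m. prob {\<omega> \<in> space M. N \<omega> = m} = a ^ m / fact m * exp (- a)"
  shows "(\<integral>\<^sup>+\<omega>. ennreal (real (N \<omega>)) \<partial>M) = ennreal a"
proof (rule poisson_nn_integral[OF N pois])
  \<comment> \<open>The weight \<open>m\<close> cancels one factor of the factorial, so the mean is
    the exponential series shifted by one index.\<close>
  have "(\<lambda>m. a * exp (- a) * (a ^ m / fact m)) sums (a * exp (- a) * exp a)"
    using exp_converges[of a] by (intro sums_mult) (simp add: divide_inverse mult.commute)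
  then have "(\<lambda>m. real (Suc m) * (a ^ Suc m / fact (Suc m) * exp (- a))) sums a"
    by (simp add: exp_minus field_simps del: of_nat_Suc)
  from sums_Suc[OF this] show "(\<lambda>m. real m * (a ^ m / fact m * exp (- a))) sums a"
    by simp
qed auto

lemma
  assumes PPP: "is_PPP M Phi mu"
  shows is_PPP_measurable: "Phi n \<in> borel_measurable M"
    and is_PPP_finite: "A \<in> sets borel \<Longrightarrow> bounded A \<Longrightarrow> AE \<omega> in M. finite {n. Phi n \<omega> \<in> A}"
    and is_PPP_poisson: "A \<in> sets borel \<Longrightarrow> bounded A \<Longrightarrow>
      prob {\<omega> \<in> space M. count_pts Phi A \<omega> = m} = (mu * measure lborel A) ^ m / fact m * exp (- (mu * measure lborel A))"
    and is_PPP_indep: "(\<And>i. i < (m'::nat) \<Longrightarrow> As i \<in> sets borel \<and> bounded (As i)) \<Longrightarrow> disjoint_family_on As {..<m'} \<Longrightarrow>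
      indep_vars (\<lambda>_. count_space UNIV) (\<lambda>i. count_pts Phi (As i)) {..<m'}"
proof -
  note P = PPP[unfolded is_PPP_def]
  show "Phi n \<in> borel_measurable M"
    using P[THEN conjunct1] by (rule spec)
  show "AE \<omega> in M. finite {n. Phi n \<omega> \<in> A}"
    and "prob {\<omega> \<in> space M. count_pts Phi A \<omega> = m} = (mu * measure lborel A) ^ m / fact m * exp (- (mu * measure lborel A))"
    if "A \<in> sets borel" "bounded A"
    using P[THEN conjunct2, THEN conjunct1, rule_format, of A] that by simp_all
  show "indep_vars (\<lambda>_. count_space UNIV) (\<lambda>i. count_pts Phi (As i)) {..<m'}"
    if "\<And>i. i < m' \<Longrightarrow> As i \<in> sets borel \<and> bounded (As i)" "disjoint_family_on As {..<m'}"
    using P[THEN conjunct2, THEN conjunct2, rule_format, of m' As] that by simp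
qed

text \<open>Measurability of a count is hidden in the independence clause of \<open>is_PPP\<close>:
  a family with one set already yields it, since \<open>indep_vars\<close> includes measurability of
  its members.\<close>

lemma measurable_count_pts:
  assumes PPP: "is_PPP M Phi mu" and A: "A \<in> sets borel" "bounded A"
  shows "count_pts Phi A \<in> measurable M (count_space UNIV)"
proof -
  have "indep_vars (\<lambda>_. count_space UNIV) (\<lambda>i. count_pts Phi ((\<lambda>_. A) i)) {..<Suc 0}"
    using A by (intro is_PPP_indep[OF PPP]) (auto simp: disjoint_family_on_def)
  then show ?thesis by (auto simp: indep_vars_def)
qed

text \<open>Almost sure finiteness is what makes \<open>count_pts\<close> agree with the series of
  indicators, because \<open>card\<close> is 0 on infinite sets; the rest is the Poisson
  mean.\<close>

lemma campbell_indicator: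
  assumes PPP: "is_PPP M Phi mu" and A[measurable]: "A \<in> sets borel" and bdd: "bounded A" and mu: "0 \<le> mu"
  shows "(\<Sum>n. \<integral>\<^sup>+\<omega>. indicator A (Phi n \<omega>) \<partial>M) = ennreal mu * emeasure lborel A"
proof -
  note is_PPP_measurable[OF PPP, measurable]
  have fin: "emeasure lborel A < \<infinity>"
    using bdd by (rule emeasure_bounded_finite)
  have "(\<Sum>n. \<integral>\<^sup>+\<omega>. indicator A (Phi n \<omega>) \<partial>M) = (\<integral>\<^sup>+\<omega>. (\<Sum>n. indicator A (Phi n \<omega>)) \<partial>M)"
    by (intro nn_integral_suminf[symmetric]) measurable
  also have "\<dots> = (\<integral>\<^sup>+\<omega>. ennreal (real (count_pts Phi A \<omega>)) \<partial>M)"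
  proof (rule nn_integral_cong_AE)
    show "AE \<omega> in M. (\<Sum>n. indicator A (Phi n \<omega>)) = ennreal (real (count_pts Phi A \<omega>))"
      using is_PPP_finite[OF PPP A bdd]
    proof eventually_elim
      fix \<omega> assume fin: "finite {n. Phi n \<omega> \<in> A}"
      have "(\<Sum>n. indicator A (Phi n \<omega>) :: ennreal) = (\<Sum>n\<in>{n. Phi n \<omega> \<in> A}. indicator A (Phi n \<omega>))"
        using fin by (intro suminf_finite) auto
      also have "\<dots> = (\<Sum>n\<in>{n. Phi n \<omega> \<in> A}. 1)"
        by (intro sum.cong) auto
      finally show "(\<Sum>n. indicator A (Phi n \<omega>)) = ennreal (real (count_pts Phi A \<omega>))"
        by (simp add: count_pts_def ennreal_of_nat_eq_real_of_nat)
    qed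
  qed
  also have "\<dots> = ennreal (mu * measure lborel A)"
    by (rule poisson_mean[OF measurable_count_pts[OF PPP A bdd] is_PPP_poisson[OF PPP A bdd]])
  also have "\<dots> = ennreal mu * emeasure lborel A"
    using fin mu by (simp add: ennreal_mult emeasure_eq_ennreal_measure)
  finally show ?thesis .
qed

text \<open>Both sides are additive and continuous from below in \<open>f\<close>, so agreement on
  bounded Borel sets propagates to all indicators, to simple functions and to their monotone
  limits.\<close>

theorem campbell:
  fixes f :: "real \<times> real \<Rightarrow> ennreal"
  assumes PPP: "is_PPP M Phi mu" and mu: "0 \<le> mu" and f: "f \<in> borel_measurable borel"
  shows "(\<Sum>n. \<integral>\<^sup>+\<omega>. f (Phi n \<omega>) \<partial>M) = ennreal mu * (\<integral>\<^sup>+x. f x \<partial>lborel)"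
proof -
  note is_PPP_measurable[OF PPP, measurable]
  have sum_eq: "(\<Sum>n. \<integral>\<^sup>+\<omega>. g (Phi n \<omega>) \<partial>M) = (\<integral>\<^sup>+n. \<integral>\<^sup>+\<omega>. g (Phi n \<omega>) \<partial>M \<partial>count_space UNIV)" for g
    by (simp add: nn_integral_count_space_nat)
  \<comment> \<open>Monotone convergence is used twice: for the expectation, and for the sum over
    points read as an integral against counting measure.\<close>
  have SUP_eq: "(\<Sum>n. \<integral>\<^sup>+\<omega>. (SUP m. U m (Phi n \<omega>)) \<partial>M) = (SUP m. \<Sum>n. \<integral>\<^sup>+\<omega>. U m (Phi n \<omega>) \<partial>M)"
    if [measurable]: "\<And>m. U m \<in> borel_measurable borel" and inc: "incseq U" for U :: "nat \<Rightarrow> real \<times> real \<Rightarrow> ennreal"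
  proof -
    have le: "U m x \<le> U m' x" if "m \<le> m'" for m m' x
      using incseqD[OF inc that] by (rule le_funD)
    have "(\<integral>\<^sup>+\<omega>. (SUP m. U m (Phi n \<omega>)) \<partial>M) = (SUP m. \<integral>\<^sup>+\<omega>. U m (Phi n \<omega>) \<partial>M)" for n
      by (intro nn_integral_monotone_convergence_SUP incseq_SucI le_funI le) auto
    moreover have "(\<integral>\<^sup>+n. (SUP m. \<integral>\<^sup>+\<omega>. U m (Phi n \<omega>) \<partial>M) \<partial>count_space UNIV) =
        (SUP m. \<integral>\<^sup>+n. \<integral>\<^sup>+\<omega>. U m (Phi n \<omega>) \<partial>M \<partial>count_space UNIV)"
      by (intro nn_integral_monotone_convergence_SUP incseq_SucI le_funI nn_integral_mono le) auto
    ultimately show ?thesis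
      by (simp add: nn_integral_count_space_nat)
  qed
  from f show ?thesis
  proof induction
    case (cong f g)
    then have "f = g" by auto
    with cong show ?case by simp
  next
    case (set A)
    note [measurable] = set
    \<comment> \<open>Only bounded sets have prescribed counts, so an arbitrary Borel set is
      exhausted by its intersections with balls.\<close>
    define B where "B m = A \<inter> ball 0 (real m)" for m :: nat
    have B[measurable]: "B m \<in> sets borel" for m unfolding B_def by measurable
    have inc: "incseq B" by (auto simp: B_def incseq_def)
    have UB: "(\<Union>m. B m) = A"
      by (auto simp: B_def) (meson reals_Archimedean2)
    have ind: "(SUP m. indicator (B m) x :: ennreal) = indicator A x" for x
    proof (cases "x \<in> A")
      case True
      then obtain m where "x \<in> B m" using UB by auto
      then show ?thesis
        using True by (intro antisym SUP_least SUP_upper2[of m]) (auto simp: indicator_def)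
    next
      case False
      then show ?thesis by (simp add: B_def)
    qed
    have "(\<Sum>n. \<integral>\<^sup>+\<omega>. indicator A (Phi n \<omega>) \<partial>M) = (\<Sum>n. \<integral>\<^sup>+\<omega>. (SUP m. indicator (B m) (Phi n \<omega>)) \<partial>M)"
      unfolding ind ..
    also have "\<dots> = (SUP m. \<Sum>n. \<integral>\<^sup>+\<omega>. indicator (B m) (Phi n \<omega>) \<partial>M)"
    proof (rule SUP_eq)
      show "incseq (\<lambda>m. indicator (B m) :: real \<times> real \<Rightarrow> ennreal)"
        using inc by (auto simp: incseq_def le_fun_def indicator_def)
    qed measurable
    also have "\<dots> = (SUP m. ennreal mu * emeasure lborel (B m))"
      by (intro SUP_cong refl campbell_indicator[OF PPP B _ mu]) (auto simp: B_def)
    also have "\<dots> = ennreal mu * (SUP m. emeasure lborel (B m))"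
      by (rule SUP_mult_left_ennreal[symmetric])
    also have "(SUP m. emeasure lborel (B m)) = emeasure lborel A"
      using SUP_emeasure_incseq[of B lborel] inc UB by (auto simp: image_subset_iff)
    finally show ?case by simp
  next
    case (mult u c)
    then have [measurable]: "u \<in> borel_measurable borel" by simp
    show ?case
      using mult by (simp add: nn_integral_cmult mult.left_commute)
  next
    case (add u v)
    note [measurable] = add(1,3)
    have "(\<Sum>n. \<integral>\<^sup>+\<omega>. u (Phi n \<omega>) + v (Phi n \<omega>) \<partial>M)
        = (\<Sum>n. (\<integral>\<^sup>+\<omega>. u (Phi n \<omega>) \<partial>M) + (\<integral>\<^sup>+\<omega>. v (Phi n \<omega>) \<partial>M))"
      by (intro suminf_cong nn_integral_add) measurable
    also have "\<dots> = (\<Sum>n. \<integral>\<^sup>+\<omega>. u (Phi n \<omega>) \<partial>M) + (\<Sum>n. \<integral>\<^sup>+\<omega>. v (Phi n \<omega>) \<partial>M)"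
      by (intro suminf_add[symmetric]) auto
    also have "\<dots> = ennreal mu * (\<integral>\<^sup>+x. u x + v x \<partial>lborel)"
      using add by (subst nn_integral_add) (auto simp: distrib_left)
    finally show ?case
      by (simp add: add.commute)
  next
    case (seq U)
    note [measurable] = seq(1)
    have "(\<Sum>n. \<integral>\<^sup>+\<omega>. (SUP i. U i) (Phi n \<omega>) \<partial>M) = (\<Sum>n. \<integral>\<^sup>+\<omega>. (SUP m. U m (Phi n \<omega>)) \<partial>M)"
      by (simp only: SUP_apply image_image)
    also have "\<dots> = (SUP m. \<Sum>n. \<integral>\<^sup>+\<omega>. U m (Phi n \<omega>) \<partial>M)"
      using seq by (intro SUP_eq) auto
    also have "\<dots> = (SUP m. ennreal mu * (\<integral>\<^sup>+x. U m x \<partial>lborel))"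
      using seq by simp
    also have "\<dots> = ennreal mu * (SUP m. \<integral>\<^sup>+x. U m x \<partial>lborel)"
      by (rule SUP_mult_left_ennreal[symmetric])
    also have "(SUP m. \<integral>\<^sup>+x. U m x \<partial>lborel) = (\<integral>\<^sup>+x. (SUP m. U m x) \<partial>lborel)"
      using seq(3) by (intro nn_integral_monotone_convergence_SUP[symmetric]) auto
    also have "\<dots> = (\<integral>\<^sup>+x. (SUP i. U i) x \<partial>lborel)"
      by (simp only: SUP_apply image_image)
    finally show ?case .
  qed
qed

end

section \<open>The Laplace functional of a Poisson point process\<close>

text \<open>This Lipschitz bound turns an error in the exponent, measured in mean, into an error of
  the Laplace functional.\<close>

lemma abs_exp_minus_diff_le:
  fixes a b :: real
  assumes "0 \<le> a" "a \<le> b"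
  shows "\<bar>exp (- a) - exp (- b)\<bar> \<le> b - a"
proof -
  have "exp (- a) - exp (- b) = exp (- a) * (1 - exp (- (b - a)))"
    by (simp add: algebra_simps exp_add[symmetric])
  also have "\<dots> \<le> 1 * (b - a)"
  proof (rule mult_mono)
    show "1 - exp (- (b - a)) \<le> b - a"
      using exp_ge_add_one_self[of "- (b - a)"] by linarith
  qed (use assms in auto)
  finally show ?thesis using assms by simp
qed

context prob_space
begin

text \<open>A finite mean, supplied by Campbell's formula in extended nonnegative form, forces
  almost sure convergence; only then does the real-valued \<open>suminf\<close> denote the actual
  sum.\<close>

lemma
  fixes h :: "real \<times> real \<Rightarrow> real"
  assumes PPP: "is_PPP M Phi mu" and mu: "0 \<le> mu"
    and h: "integrable lborel h" "\<And>x. 0 \<le> h x"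
  shows AE_summable_PPP: "AE \<omega> in M. summable (\<lambda>n. h (Phi n \<omega>))"
    and integrable_suminf_PPP: "integrable M (\<lambda>\<omega>. \<Sum>n. h (Phi n \<omega>))"
    and expectation_suminf_PPP: "expectation (\<lambda>\<omega>. \<Sum>n. h (Phi n \<omega>)) = mu * (\<integral>x. h x \<partial>lborel)"
proof -
  note is_PPP_measurable[OF PPP, measurable]
  have [measurable]: "h \<in> borel_measurable borel"
    using h(1) by auto
  have eq: "(\<integral>\<^sup>+\<omega>. (\<Sum>n. ennreal (h (Phi n \<omega>))) \<partial>M) = ennreal (mu * (\<integral>x. h x \<partial>lborel))"
    using campbell[OF PPP mu, of "\<lambda>x. ennreal (h x)"] h mu
    by (simp add: nn_integral_suminf nn_integral_eq_integral ennreal_mult)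
  have "AE \<omega> in M. (\<Sum>n. ennreal (h (Phi n \<omega>))) \<noteq> \<infinity>"
    by (rule nn_integral_PInf_AE) (auto simp: eq)
  then show summ: "AE \<omega> in M. summable (\<lambda>n. h (Phi n \<omega>))"
    by eventually_elim (auto intro: summable_suminf_not_top h)
  have nonneg: "AE \<omega> in M. 0 \<le> (\<Sum>n. h (Phi n \<omega>))"
    using summ by eventually_elim (auto intro: suminf_nonneg h)
  have "(\<integral>\<^sup>+\<omega>. ennreal (\<Sum>n. h (Phi n \<omega>)) \<partial>M) = ennreal (mu * (\<integral>x. h x \<partial>lborel))"
    unfolding eq[symmetric]
    using summ by (intro nn_integral_cong_AE, eventually_elim) (simp add: suminf_ennreal2 h)
  then have "has_bochner_integral M (\<lambda>\<omega>. \<Sum>n. h (Phi n \<omega>)) (mu * (\<integral>x. h x \<partial>lborel))"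
    using nonneg mu h by (intro has_bochner_integral_nn_integral) auto
  then show "integrable M (\<lambda>\<omega>. \<Sum>n. h (Phi n \<omega>))"
    "expectation (\<lambda>\<omega>. \<Sum>n. h (Phi n \<omega>)) = mu * (\<integral>x. h x \<partial>lborel)"
    by (auto simp: has_bochner_integral_iff)
qed

text \<open>For disjoint sets the exponent is a combination of independent Poisson counts, so the
  expectation is a product of Poisson generating functions taken at
  \<open>exp (- c i)\<close>.\<close>

lemma laplace_functional_step:
  fixes As :: "nat \<Rightarrow> (real \<times> real) set" and c :: "nat \<Rightarrow> real"
  assumes PPP: "is_PPP M Phi mu"
    and A: "\<And>i. i < N \<Longrightarrow> As i \<in> sets borel" "\<And>i. i < N \<Longrightarrow> bounded (As i)"
    and disj: "disjoint_family_on As {..<N}" and c: "\<And>i. 0 \<le> c i"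
  defines "h \<equiv> (\<lambda>y. \<Sum>i<N. c i * indicator (As i) y)"
  shows "expectation (\<lambda>\<omega>. exp (- (\<Sum>n. h (Phi n \<omega>)))) = exp (- mu * (\<integral>y. 1 - exp (- h y) \<partial>lborel))"
proof -
  note is_PPP_measurable[OF PPP, measurable]
  have fin: "AE \<omega> in M. \<forall>i\<in>{..<N}. finite {n. Phi n \<omega> \<in> As i}"
    using A by (intro AE_finite_allI) (auto intro!: is_PPP_finite[OF PPP])
  have "AE \<omega> in M. exp (- (\<Sum>n. h (Phi n \<omega>))) = (\<Prod>i<N. exp (- c i) ^ count_pts Phi (As i) \<omega>)"
    using fin
  proof eventually_elim
    fix \<omega> assume fin: "\<forall>i\<in>{..<N}. finite {n. Phi n \<omega> \<in> As i}"
    have "(\<lambda>n. c i * indicator (As i) (Phi n \<omega>)) sums (c i * count_pts Phi (As i) \<omega>)" if "i < N" for i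
    proof (rule sums_mult)
      have "(\<lambda>n. indicator (As i) (Phi n \<omega>) :: real) sums (\<Sum>n\<in>{n. Phi n \<omega> \<in> As i}. indicator (As i) (Phi n \<omega>))"
        using fin that by (intro sums_finite) auto
      also have "(\<Sum>n\<in>{n. Phi n \<omega> \<in> As i}. indicator (As i) (Phi n \<omega>) :: real) = (\<Sum>n\<in>{n. Phi n \<omega> \<in> As i}. 1)"
        by (intro sum.cong) auto
      finally show "(\<lambda>n. indicator (As i) (Phi n \<omega>) :: real) sums count_pts Phi (As i) \<omega>"
        by (simp add: count_pts_def)
    qed
    then have "(\<lambda>n. h (Phi n \<omega>)) sums (\<Sum>i<N. c i * count_pts Phi (As i) \<omega>)"
      unfolding h_def by (intro sums_sum) auto
    then show "exp (- (\<Sum>n. h (Phi n \<omega>))) = (\<Prod>i<N. exp (- c i) ^ count_pts Phi (As i) \<omega>)"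
      by (simp add: sums_iff exp_of_nat_mult[symmetric] exp_sum[symmetric] sum_negf[symmetric] mult.commute)
  qed
  moreover have cnt: "count_pts Phi (As i) \<in> measurable M (count_space UNIV)" if "i < N" for i
    using measurable_count_pts[OF PPP] A that by auto
  moreover have [measurable]: "h \<in> borel_measurable borel"
    unfolding h_def using A by (intro borel_measurable_sum) auto
  ultimately have "expectation (\<lambda>\<omega>. exp (- (\<Sum>n. h (Phi n \<omega>)))) = expectation (\<lambda>\<omega>. \<Prod>i<N. exp (- c i) ^ count_pts Phi (As i) \<omega>)"
    by (intro integral_cong_AE borel_measurable_prod) auto
  also have "\<dots> = (\<Prod>i<N. expectation (\<lambda>\<omega>. exp (- c i) ^ count_pts Phi (As i) \<omega>))"
  proof (rule indep_vars_lebesgue_integral)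
    have "indep_vars (\<lambda>_. count_space UNIV) (\<lambda>i. count_pts Phi (As i)) {..<N}"
      using A disj by (intro is_PPP_indep[OF PPP]) auto
    then show "indep_vars (\<lambda>_. borel) (\<lambda>i \<omega>. exp (- c i) ^ count_pts Phi (As i) \<omega>) {..<N}"
      by (rule indep_vars_compose2) auto
    show "integrable M (\<lambda>\<omega>. exp (- c i) ^ count_pts Phi (As i) \<omega>)" if "i \<in> {..<N}" for i
      using cnt[of i] that c[of i] by (intro integrable_const_bound[where B=1]) (auto intro!: power_le_one)
  qed simp
  also have "\<dots> = (\<Prod>i<N. exp (- (mu * measure lborel (As i)) * (1 - exp (- c i))))"
  proof (intro prod.cong refl)
    fix i assume i: "i \<in> {..<N}"
    have "(\<integral>\<^sup>+\<omega>. ennreal (exp (- c i) ^ count_pts Phi (As i) \<omega>) \<partial>M) = ennreal (exp (- (mu * measure lborel (As i)) * (1 - exp (- c i))))"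
      using i A by (intro poisson_pgf cnt is_PPP_poisson[OF PPP]) auto
    with cnt[of i] i show "expectation (\<lambda>\<omega>. exp (- c i) ^ count_pts Phi (As i) \<omega>) = exp (- (mu * measure lborel (As i)) * (1 - exp (- c i)))"
      by (subst integral_eq_nn_integral) auto
  qed
  also have "\<dots> = exp (- mu * (\<Sum>i<N. (1 - exp (- c i)) * measure lborel (As i)))"
    by (simp add: exp_sum[symmetric] sum_distrib_left sum_negf[symmetric] algebra_simps)
  also have "(\<Sum>i<N. (1 - exp (- c i)) * measure lborel (As i)) = (\<integral>y. (\<Sum>i<N. (1 - exp (- c i)) * indicator (As i) y) \<partial>lborel)"
    using A by (subst Bochner_Integration.integral_sum)
      (auto intro!: integrable_mult_right integrable_real_indicator emeasure_bounded_finite)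
  also have "(\<lambda>y. \<Sum>i<N. (1 - exp (- c i)) * indicator (As i) y) = (\<lambda>y. 1 - exp (- h y))"
  proof
    \<comment> \<open>Disjointness leaves at most one active index at \<open>y\<close>, so the
      nonlinear map \<open>1 - exp (- _)\<close> passes through the sum.\<close>
    fix y
    show "(\<Sum>i<N. (1 - exp (- c i)) * indicator (As i) y) = 1 - exp (- h y)"
    proof (cases "\<exists>i<N. y \<in> As i")
      case True
      then obtain j where j: "j < N" "y \<in> As j" by auto
      have ind: "indicator (As i) y = (if i = j then 1 else 0 :: real)" if "i < N" for i
        using disj j that unfolding disjoint_family_on_def by (auto simp: indicator_def)
      have "(\<Sum>i<N. f i * indicator (As i) y) = f j" for f :: "nat \<Rightarrow> real"
        using j(1) by (subst sum.cong[OF refl, of _ _ "\<lambda>i. if i = j then f i else 0"]) (auto simp: ind)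
      then show ?thesis by (simp add: h_def)
    next
      case False
      then have "(\<Sum>i<N. f i * indicator (As i) y) = 0" for f :: "nat \<Rightarrow> real"
        by (intro sum.neutral) auto
      then show ?thesis by (simp only: h_def) simp
    qed
  qed
  finally show ?thesis .
qed

text \<open>The functional is approximated in \<open>L\<^sup>1\<close> by step functions: by Campbell's formula the error is
  controlled by the Lebesgue integral of the difference of the integrands.\<close>
theorem laplace_functional:
  fixes h :: "real \<times> real \<Rightarrow> real"
  assumes PPP: "is_PPP M Phi mu" and mu: "0 \<le> mu"
    and int: "integrable lborel h" and h: "\<And>x. 0 \<le> h x"
  shows "expectation (\<lambda>\<omega>. exp (- (\<Sum>n. h (Phi n \<omega>)))) = exp (- mu * (\<integral>y. 1 - exp (- h y) \<partial>lborel))"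
proof -
  note is_PPP_measurable[OF PPP, measurable]
  have hm[measurable]: "h \<in> borel_measurable borel"
    using int by auto
  \<comment> \<open>\<open>g m\<close> will be \<open>h\<close> rounded down to a multiple of
    \<open>1 / Suc m\<close> and cut off outside the ball of radius \<open>m\<close>;
    \<open>As m i\<close> is the part of the ball where the rounded value is
    \<open>i / Suc m\<close>. The \<open>Suc m * Suc m\<close> levels reach every value of
    \<open>h\<close> below \<open>Suc m\<close>.\<close>
  define As where "As m i = {y. norm y < real m \<and> \<lfloor>real (Suc m) * h y\<rfloor> = int i}" for m i :: nat
  define N where "N m = Suc m * Suc m" for m :: nat
  define g where "g m y = (\<Sum>i<N m. (real i / real (Suc m)) * indicator (As m i) y)" for m y
  have As[measurable]: "As m i \<in> sets borel" for m i
    unfolding As_def by measurable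
  have bdd: "bounded (As m i)" for m i
    by (rule bounded_subset[of "ball 0 (real m)"]) (auto simp: As_def)
  have disj: "disjoint_family_on (As m) {..<N m}" for m
    by (auto simp: disjoint_family_on_def As_def)
  have [measurable]: "g m \<in> borel_measurable borel" for m
    unfolding g_def by measurable
  have g_eq: "g m y = (if norm y < real m \<and> \<lfloor>real (Suc m) * h y\<rfloor> < int (N m) then real_of_int \<lfloor>real (Suc m) * h y\<rfloor> / real (Suc m) else 0)" for m y
  proof -
    define j where "j = nat \<lfloor>real (Suc m) * h y\<rfloor>"
    have j: "int j = \<lfloor>real (Suc m) * h y\<rfloor>"
      using h[of y] by (simp add: j_def)
    have "g m y = (\<Sum>i<N m. if i = j then (if norm y < real m then real i / real (Suc m) else 0) else 0)"
      unfolding g_def by (intro sum.cong refl) (auto simp: As_def j[symmetric] indicator_def simp del: of_nat_Suc)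
    also have "\<dots> = (if norm y < real m \<and> j < N m then real j / real (Suc m) else 0)"
      by simp
    finally show ?thesis
      unfolding j[symmetric] by (simp del: of_nat_Suc)
  qed
  have g0: "0 \<le> g m y" for m y
    unfolding g_def by (intro sum_nonneg) auto
  have gh: "g m y \<le> h y" for m y
    using h[of y] of_int_floor_le[of "real (Suc m) * h y"] by (auto simp: g_eq field_simps simp del: of_nat_Suc)
  have int_g: "integrable lborel (g m)" for m
    using g0 gh by (intro Bochner_Integration.integrable_bound[OF int]) (auto intro!: AE_I2 simp: h)
  have lim_g: "(\<lambda>m. g m y) \<longlonglongrightarrow> h y" for y
  proof (rule Lim_transform_bound[where g="\<lambda>m. 1 / real (Suc m)", THEN LIM_zero_cancel])
    obtain m0 :: nat where m0: "norm y < m0" "h y < m0"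
      using reals_Archimedean2[of "max (norm y) (h y)"] by auto
    show "\<forall>\<^sub>F m in sequentially. norm (g m y - h y) \<le> norm (1 / real (Suc m))"
      using eventually_ge_at_top[of m0]
    proof eventually_elim
      fix m assume "m0 \<le> m"
      then have m: "norm y < m" "h y < m" using m0 by auto
      have "real (Suc m) * h y < real (Suc m) * real (Suc m)"
        using m h[of y] by (intro mult_strict_left_mono) auto
      then have "\<lfloor>real (Suc m) * h y\<rfloor> < int (N m)"
        unfolding N_def by (simp add: floor_less_iff del: of_nat_Suc mult_Suc mult_Suc_right)
      then have "g m y = real_of_int \<lfloor>real (Suc m) * h y\<rfloor> / real (Suc m)"
        using m by (simp add: g_eq)
      moreover have "\<dots> \<le> h y" "h y \<le> \<dots> + 1 / real (Suc m)"
        using of_int_floor_le[of "real (Suc m) * h y"] real_of_int_floor_add_one_ge[of "real (Suc m) * h y"]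
        by (auto simp: field_simps simp del: of_nat_Suc)
      ultimately show "norm (g m y - h y) \<le> norm (1 / real (Suc m))"
        by (simp del: of_nat_Suc)
    qed
    show "(\<lambda>m. 1 / real (Suc m)) \<longlonglongrightarrow> 0"
      using LIMSEQ_Suc[OF lim_1_over_n] by simp
  qed
  have step: "expectation (\<lambda>\<omega>. exp (- (\<Sum>n. g m (Phi n \<omega>)))) = exp (- mu * (\<integral>y. 1 - exp (- g m y) \<partial>lborel))" for m
    unfolding g_def using bdd disj by (intro laplace_functional_step[OF PPP]) auto
  have "(\<lambda>m. \<integral>y. 1 - exp (- g m y) \<partial>lborel) \<longlonglongrightarrow> (\<integral>y. 1 - exp (- h y) \<partial>lborel)"
  proof (rule integral_dominated_convergence[where w=h])
    show "AE y in lborel. (\<lambda>m. 1 - exp (- g m y)) \<longlonglongrightarrow> 1 - exp (- h y)"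
      by (intro AE_I2 tendsto_intros lim_g)
    show "AE y in lborel. norm (1 - exp (- g m y)) \<le> h y" for m
    proof (rule AE_I2)
      fix y
      have "norm (1 - exp (- g m y)) \<le> g m y"
        using abs_exp_minus_diff_le[of 0 "g m y"] g0[of m y] by simp
      with gh[of m y] show "norm (1 - exp (- g m y)) \<le> h y" by linarith
    qed
  qed (use int in auto)
  then have lim_r: "(\<lambda>m. exp (- mu * (\<integral>y. 1 - exp (- g m y) \<partial>lborel))) \<longlonglongrightarrow> exp (- mu * (\<integral>y. 1 - exp (- h y) \<partial>lborel))"
    by (intro tendsto_intros)
  have lim_int: "(\<lambda>m. \<integral>y. g m y \<partial>lborel) \<longlonglongrightarrow> (\<integral>y. h y \<partial>lborel)"
    using g0 gh by (intro integral_dominated_convergence[where w=h]) (auto intro!: AE_I2 lim_g int)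
  \<comment> \<open>Both exponents are sums over the same points, so the exponentials differ by at
    most the difference of the sums. Campbell's formula evaluates its mean as \<open>mu\<close>
    times the difference of the Lebesgue integrals.\<close>
  have "(\<lambda>m. expectation (\<lambda>\<omega>. exp (- (\<Sum>n. g m (Phi n \<omega>))))) \<longlonglongrightarrow> expectation (\<lambda>\<omega>. exp (- (\<Sum>n. h (Phi n \<omega>))))"
  proof (rule Lim_transform_bound[where g="\<lambda>m. mu * ((\<integral>y. h y \<partial>lborel) - (\<integral>y. g m y \<partial>lborel))", THEN LIM_zero_cancel])
    show "(\<lambda>m. mu * ((\<integral>y. h y \<partial>lborel) - (\<integral>y. g m y \<partial>lborel))) \<longlonglongrightarrow> 0"
      using tendsto_mult[OF tendsto_const[of mu] tendsto_diff[OF tendsto_const[of "\<integral>y. h y \<partial>lborel"] lim_int]] by simp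
    show "\<forall>\<^sub>F m in sequentially. norm (expectation (\<lambda>\<omega>. exp (- (\<Sum>n. g m (Phi n \<omega>)))) - expectation (\<lambda>\<omega>. exp (- (\<Sum>n. h (Phi n \<omega>)))))
        \<le> norm (mu * ((\<integral>y. h y \<partial>lborel) - (\<integral>y. g m y \<partial>lborel)))"
    proof (rule always_eventually, rule allI)
      fix m
      note sm = AE_summable_PPP[OF PPP mu int h] AE_summable_PPP[OF PPP mu int_g[of m] g0]
      note ig = integrable_suminf_PPP[OF PPP mu int h] integrable_suminf_PPP[OF PPP mu int_g[of m] g0]
      have le: "AE \<omega> in M. 0 \<le> (\<Sum>n. g m (Phi n \<omega>)) \<and> (\<Sum>n. g m (Phi n \<omega>)) \<le> (\<Sum>n. h (Phi n \<omega>))"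
        using sm by eventually_elim (auto intro!: suminf_nonneg suminf_le g0 gh)
      have i1: "integrable M (\<lambda>\<omega>. exp (- (\<Sum>n. g m (Phi n \<omega>))))"
        using le by (intro integrable_const_bound[where B=1]) (auto elim!: eventually_mono)
      have "AE \<omega> in M. norm (exp (- (\<Sum>n. h (Phi n \<omega>)))) \<le> 1"
        using le by eventually_elim auto
      then have i2: "integrable M (\<lambda>\<omega>. exp (- (\<Sum>n. h (Phi n \<omega>))))"
        by (intro integrable_const_bound[where B=1]) auto
      have "AE \<omega> in M. \<bar>exp (- (\<Sum>n. g m (Phi n \<omega>))) - exp (- (\<Sum>n. h (Phi n \<omega>)))\<bar> \<le> (\<Sum>n. h (Phi n \<omega>)) - (\<Sum>n. g m (Phi n \<omega>))"
        using le by eventually_elim (rule abs_exp_minus_diff_le; simp)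
      note le_diff = this
      have "norm (expectation (\<lambda>\<omega>. exp (- (\<Sum>n. g m (Phi n \<omega>)))) - expectation (\<lambda>\<omega>. exp (- (\<Sum>n. h (Phi n \<omega>)))))
         = norm (expectation (\<lambda>\<omega>. exp (- (\<Sum>n. g m (Phi n \<omega>))) - exp (- (\<Sum>n. h (Phi n \<omega>)))))"
        using i1 i2 by simp
      also have "\<dots> \<le> expectation (\<lambda>\<omega>. \<bar>exp (- (\<Sum>n. g m (Phi n \<omega>))) - exp (- (\<Sum>n. h (Phi n \<omega>)))\<bar>)"
        using integral_norm_bound by (metis (no_types, lifting) Bochner_Integration.integral_cong real_norm_def)
      also have "\<dots> \<le> expectation (\<lambda>\<omega>. (\<Sum>n. h (Phi n \<omega>)) - (\<Sum>n. g m (Phi n \<omega>)))"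
        using i1 i2 ig by (intro integral_mono_AE le_diff) auto
      also have "\<dots> = mu * ((\<integral>y. h y \<partial>lborel) - (\<integral>y. g m y \<partial>lborel))"
        using ig expectation_suminf_PPP[OF PPP mu int h] expectation_suminf_PPP[OF PPP mu int_g[of m] g0]
        by (simp add: right_diff_distrib)
      finally show "norm (expectation (\<lambda>\<omega>. exp (- (\<Sum>n. g m (Phi n \<omega>)))) - expectation (\<lambda>\<omega>. exp (- (\<Sum>n. h (Phi n \<omega>)))))
        \<le> norm (mu * ((\<integral>y. h y \<partial>lborel) - (\<integral>y. g m y \<partial>lborel)))"
        by simp
    qed
  qed
  with lim_r show ?thesis
    unfolding step by (rule LIMSEQ_unique[symmetric])
qed

end

section \<open>Planar radial integrals and marked processes\<close>

text \<open>Both laws are compared on right half-lines. The minus sign makes \<open>{x<..}\<close>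
  correspond to a bounded annulus, whose area is finite although the total mass is infinite;
  finiteness there is what lets half-lines determine a measure. The two variables are related by
  \<open>1 / u = (norm y / rho) powr alpha\<close>.\<close>

lemma annulus_distr_eq:
  fixes rho alpha d :: real
  assumes rho: "0 < rho" and alpha: "0 < alpha" and d: "d = 2 / alpha"
  shows "distr (density lborel (\<lambda>y::real \<times> real. indicator {y. rho < norm y} y)) borel (\<lambda>y. - ((norm y / rho) powr alpha))
       = distr (density lborel (\<lambda>u. ennreal (pi * rho\<^sup>2 * d * u powr (- d - 1)) * indicator {0<..<1} u)) borel (\<lambda>u. - (1 / u))"
    (is "?N1 = ?N2")
proof -
  have d0: "0 < d" using d alpha by simp
  \<comment> \<open>The common mass of a half-line: the area between the radii \<open>rho\<close>
    and \<open>rho * (- x) powr (1 / alpha)\<close>. Squaring the outer radius produces the exponent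
    \<open>d = 2 / alpha\<close>.\<close>
  define E where "E x = (if x < -1 then pi * rho\<^sup>2 * ((- x) powr d - 1) else 0)" for x :: real
  have 1: "emeasure ?N1 {x<..} = ennreal (E x)" for x
  proof -
    have "emeasure ?N1 {x<..} = emeasure lborel {y::real \<times> real. rho < norm y \<and> (norm y / rho) powr alpha < - x}"
    proof -
      have [measurable]: "(\<lambda>y::real \<times> real. - ((norm y / rho) powr alpha)) -` {x<..} \<in> sets borel"
        by (intro measurable_sets_borel[where M=borel]) measurable
      have "emeasure ?N1 {x<..} = (\<integral>\<^sup>+y. indicator {y. rho < norm y \<and> (norm y / rho) powr alpha < - x} y \<partial>(lborel :: (real \<times> real) measure))"
        by (subst emeasure_distr, simp, simp, subst emeasure_density, simp, simp, rule nn_integral_cong)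
           (auto split: split_indicator)
      also have "\<dots> = emeasure lborel {y::real \<times> real. rho < norm y \<and> (norm y / rho) powr alpha < - x}"
        by (rule nn_integral_indicator) measurable
      finally show ?thesis .
    qed
    also have "\<dots> = ennreal (E x)"
    proof (cases "x < -1")
      case True
      define R where "R = rho * (- x) powr (1 / alpha)"
      have "1 powr (1 / alpha) < (- x) powr (1 / alpha)"
        using True alpha by (intro powr_less_mono2) auto
      then have Rs: "rho < R"
        unfolding R_def using rho mult_strict_left_mono[of 1 "(- x) powr (1 / alpha)" rho] by simp
      then have R: "rho \<le> R" by simp
      have iff: "(norm y / rho) powr alpha < - x \<longleftrightarrow> norm y < R" for y :: "real \<times> real"
      proof -
        have "(norm y / rho) powr alpha < ((- x) powr (1 / alpha)) powr alpha \<longleftrightarrow> norm y / rho < (- x) powr (1 / alpha)"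
          using powr_less_cancel2[of alpha] powr_less_mono2[of alpha] alpha rho
          by (meson divide_nonneg_pos linorder_not_less norm_ge_zero powr_ge_zero powr_mono2 less_imp_le order_less_le_trans order_le_less_trans)
        then show ?thesis
          using True alpha rho by (simp add: powr_powr R_def field_simps)
      qed
      have "{y::real \<times> real. rho < norm y \<and> (norm y / rho) powr alpha < - x} = ball 0 R - cball 0 rho"
        by (auto simp: iff)
      also have "emeasure lborel \<dots> = emeasure lborel (ball (0::real \<times> real) R) - emeasure lborel (cball (0::real \<times> real) rho)"
      proof (rule emeasure_Diff)
        show "emeasure lborel (cball (0::real \<times> real) rho) \<noteq> \<infinity>"
          using rho by (simp add: emeasure_cball)
        show "cball (0::real \<times> real) rho \<subseteq> ball 0 R"
          using Rs by auto
      qed auto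
      also have "\<dots> = ennreal (pi * R\<^sup>2) - ennreal (pi * rho\<^sup>2)"
        using R rho by (simp add: emeasure_ball emeasure_cball unit_ball_vol_2 power2_eq_square)
      also have "\<dots> = ennreal (pi * R\<^sup>2 - pi * rho\<^sup>2)"
        using rho by (intro ennreal_minus) auto
      also have "R\<^sup>2 = rho\<^sup>2 * (- x) powr d"
        using True alpha unfolding R_def power_mult_distrib d
        by (simp add: powr_power)
      finally show ?thesis
        using True by (simp add: E_def algebra_simps)
    next
      case False
      have "{y::real \<times> real. rho < norm y \<and> (norm y / rho) powr alpha < - x} = {}"
      proof -
        have "1 \<le> (norm y / rho) powr alpha" if "rho < norm y" for y :: "real \<times> real"
          using that rho alpha by (intro ge_one_powr_ge_zero) auto
        then show ?thesis using False by fastforce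
      qed
      then show ?thesis using False by (simp only: E_def) simp
    qed
    finally show ?thesis .
  qed
  have 2: "emeasure ?N2 {x<..} = ennreal (E x)" for x
  proof -
    have "emeasure ?N2 {x<..} = (\<integral>\<^sup>+u. ennreal (pi * rho\<^sup>2 * d * u powr (- d - 1)) * indicator {u. 0 < u \<and> u < 1 \<and> x < - (1 / u)} u \<partial>lborel)"
    proof -
      have [measurable]: "(\<lambda>u::real. - (1 / u)) -` {x<..} \<in> sets borel"
        by (intro measurable_sets_borel[where M=borel]) measurable
      show ?thesis
        by (subst emeasure_distr, simp, simp, subst emeasure_density)
           (auto intro!: nn_integral_cong split: split_indicator)
    qed
    also have "\<dots> = ennreal (E x)"
    proof (cases "x < -1")
      case True
      \<comment> \<open>The condition \<open>x < - (1 / u)\<close> means \<open>u0 < u\<close>;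
        passing to the closed interval \<open>{u0..1}\<close> changes only null sets and brings in
        the fundamental theorem of calculus.\<close>
      define u0 where "u0 = 1 / (- x)"
      have u0: "0 < u0" "u0 < 1" using True by (auto simp: u0_def field_simps)
      have "(\<integral>\<^sup>+u. ennreal (pi * rho\<^sup>2 * d * u powr (- d - 1)) * indicator {u. 0 < u \<and> u < 1 \<and> x < - (1 / u)} u \<partial>lborel)
        = (\<integral>\<^sup>+u. ennreal (pi * rho\<^sup>2 * d * u powr (- d - 1)) * indicator {u0..1} u \<partial>lborel)"
        using AE_lborel_singleton[of u0] AE_lborel_singleton[of 1]
      proof (intro nn_integral_cong_AE, eventually_elim)
        fix u :: real assume u: "u \<noteq> u0" "u \<noteq> 1"
        have "x < - (1 / u) \<longleftrightarrow> u0 < u" if "0 < u"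
          using that True by (auto simp: u0_def field_simps)
        with u have "0 < u \<and> u < 1 \<and> x < - (1 / u) \<longleftrightarrow> u \<in> {u0..1}"
          using u0 by (cases "0 < u") auto
        then show "ennreal (pi * rho\<^sup>2 * d * u powr (- d - 1)) * indicator {u. 0 < u \<and> u < 1 \<and> x < - (1 / u)} u
           = ennreal (pi * rho\<^sup>2 * d * u powr (- d - 1)) * indicator {u0..1} u"
          by (auto split: split_indicator)
      qed
      also have "\<dots> = ennreal ((- (pi * rho\<^sup>2 * 1 powr (- d))) - (- (pi * rho\<^sup>2 * u0 powr (- d))))"
      proof (rule nn_integral_FTC_Icc[where F="\<lambda>u. - (pi * rho\<^sup>2 * u powr (- d))"])
        fix u :: real assume u: "u \<in> {u0..1}"
        show "((\<lambda>u. - (pi * rho\<^sup>2 * u powr (- d))) has_real_derivative pi * rho\<^sup>2 * d * u powr (- d - 1)) (at u)"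
          using u u0 by (auto intro!: derivative_eq_intros simp: field_simps)
        show "0 \<le> pi * rho\<^sup>2 * d * u powr (- d - 1)"
          using d0 by simp
      qed (use u0 in auto)
      also have "u0 powr (- d) = (- x) powr d"
        using powr_divide[of 1 "- x" d] True by (simp add: u0_def powr_minus_divide del: powr_divide minus_divide_right)
      finally show ?thesis
        using True by (simp add: E_def algebra_simps)
    next
      case False
      then have "{u. 0 < u \<and> u < 1 \<and> x < - (1 / u)} = {}"
      proof -
        have "1 < 1 / u" if "0 < u" "u < 1" for u :: real
          using that by (simp add: field_simps)
        then show ?thesis using False by fastforce
      qed
      then show ?thesis using False by (simp add: E_def)
    qed
    finally show ?thesis .
  qed
  show ?thesis
    by (rule measure_eqI_lessThan) (simp_all add: 1 2)
qed

text \<open>Radial integration is obtained by pushing the planar measure forward to the line;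
  \<open>F\<close> may be any nonnegative measurable function of the attenuation
  \<open>u\<close>.\<close>

lemma nn_integral_annulus:
  fixes rho alpha d :: real and F :: "real \<Rightarrow> ennreal"
  assumes rho: "0 < rho" and alpha: "0 < alpha" and d: "d = 2 / alpha"
    and F[measurable]: "F \<in> borel_measurable borel"
  shows "(\<integral>\<^sup>+y. (if rho < norm y then F ((norm y / rho) powr (- alpha)) else 0) \<partial>(lborel :: (real \<times> real) measure))
       = (\<integral>\<^sup>+u. F u * (ennreal (pi * rho\<^sup>2 * d * u powr (- d - 1)) * indicator {0<..<1} u) \<partial>lborel)"
proof -
  have "(\<integral>\<^sup>+y. (if rho < norm y then F ((norm y / rho) powr (- alpha)) else 0) \<partial>(lborel :: (real \<times> real) measure))
     = (\<integral>\<^sup>+v. F (- (1 / v)) \<partial>distr (density lborel (\<lambda>y::real \<times> real. indicator {y. rho < norm y} y)) borel (\<lambda>y. - ((norm y / rho) powr alpha)))"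
    by (subst nn_integral_distr, simp, simp, subst nn_integral_density)
       (auto intro!: nn_integral_cong simp: powr_minus_divide split: split_indicator)
  also have "\<dots> = (\<integral>\<^sup>+u. F u * (ennreal (pi * rho\<^sup>2 * d * u powr (- d - 1)) * indicator {0<..<1} u) \<partial>lborel)"
    unfolding annulus_distr_eq[OF rho alpha d]
    by (subst nn_integral_distr, simp, simp, subst nn_integral_density)
       (auto intro!: nn_integral_cong simp: mult.commute split: split_indicator)
  finally show ?thesis .
qed

section \<open>Exponential fading as independent marks\<close>

context prob_space
begin

text \<open>Multiplying the density by \<open>exp (- c * v)\<close> gives the density of rate
  \<open>1 + c\<close>, up to the factor \<open>1 / (1 + c)\<close>.\<close>

lemma exponential_laplace:
  assumes V: "distributed M lborel V (\<lambda>v. ennreal (exponential_density 1 v))" and c: "0 \<le> c"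
  shows "(\<integral>\<^sup>+\<omega>. ennreal (exp (- c * V \<omega>)) \<partial>M) = ennreal (1 / (1 + c))"
proof -
  have "(\<integral>\<^sup>+\<omega>. ennreal (exp (- c * V \<omega>)) \<partial>M) = (\<integral>\<^sup>+v. ennreal (exponential_density 1 v) * ennreal (exp (- c * v)) \<partial>lborel)"
    by (rule distributed_nn_integral[OF V, symmetric]) measurable
  also have "\<dots> = (\<integral>\<^sup>+v. ennreal (1 / (1 + c)) * ennreal (exponential_density (1 + c) v) \<partial>lborel)"
  proof (intro nn_integral_cong)
    fix v
    have "exp (- v) * exp (- c * v) = exp (- v * (1 + c))"
      by (simp add: exp_add[symmetric] algebra_simps)
    then have "exponential_density 1 v * exp (- c * v) = 1 / (1 + c) * exponential_density (1 + c) v"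
      using c by (simp add: exponential_density_def)
    then show "ennreal (exponential_density 1 v) * ennreal (exp (- c * v)) = ennreal (1 / (1 + c)) * ennreal (exponential_density (1 + c) v)"
      using c by (subst (1 2) ennreal_mult[symmetric]) (auto simp: exponential_density_nonneg)
  qed
  also have "\<dots> = ennreal (1 / (1 + c)) * (\<integral>\<^sup>+v. ennreal (exponential_density (1 + c) v) \<partial>lborel)"
    by (rule nn_integral_cmult) simp
  also have "(\<integral>\<^sup>+v. ennreal (exponential_density (1 + c) v) \<partial>lborel) = 1"
    using prob_space.emeasure_space_1[OF prob_space_exponential_density[of "1 + c"]] c by (simp add: emeasure_density)
  finally show ?thesis by simp
qed

lemma exponential_mean:
  assumes V: "distributed M lborel V (\<lambda>v. ennreal (exponential_density 1 v))"
  shows "(\<integral>\<^sup>+\<omega>. ennreal (V \<omega>) \<partial>M) = 1"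
proof -
  have "(\<integral>\<^sup>+\<omega>. ennreal (V \<omega>) \<partial>M) = (\<integral>\<^sup>+v. ennreal (exponential_density 1 v) * ennreal v \<partial>lborel)"
    by (rule distributed_nn_integral[OF V, symmetric]) measurable
  also have "\<dots> = (\<integral>\<^sup>+v. ennreal (erlang_density 0 1 v * v ^ 1) \<partial>lborel)"
    by (intro nn_integral_cong) (auto simp: ennreal_mult' exponential_density_def erlang_density_def)
  also have "\<dots> = 1"
    by (subst nn_integral_erlang_ith_moment) auto
  finally show ?thesis .
qed

lemma erlang_AE_pos:
  assumes V: "distributed M lborel V (\<lambda>v. ennreal (erlang_density k 1 v))"
  shows "AE \<omega> in M. 0 < V \<omega>"
proof -
  have "\<P>(\<omega> in M. 0 < V \<omega>) = 1"
    using erlang_distributed_gt[OF V, of 0] by (simp add: erlang_CDF_at0)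
  then show ?thesis
    using distributed_measurable[OF V] by (subst (asm) prob_Collect_eq_1) auto
qed

text \<open>With the points frozen, each mark integrates to
  \<open>1 / (1 + s * f (Phi n \<omega>))\<close>, that is, to
  \<open>exp (- ln (1 + s * f (Phi n \<omega>)))\<close>. The marked transform is therefore the
  unmarked Laplace functional of \<open>ln (1 + s * f y)\<close>. Marks appear as pairs with second
  entry 0 because \<open>indep_var\<close> relates variables with one common value type, here
  sequences in the plane.\<close>

lemma marked_PPP:
  fixes f :: "real \<times> real \<Rightarrow> real"
  assumes PPP: "is_PPP M Phi mu" and mu: "0 \<le> mu"
    and V: "\<And>n. distributed M lborel (V n) (\<lambda>v. ennreal (exponential_density 1 v))"
    and indV: "indep_vars (\<lambda>_. borel) V UNIV"
    and ind: "indep_var (PiM UNIV (\<lambda>_. borel)) (\<lambda>\<omega> n. Phi n \<omega>) (PiM UNIV (\<lambda>_. borel)) (\<lambda>\<omega> n. (V n \<omega>, 0))"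
    and int: "integrable lborel f" and f: "\<And>x. 0 \<le> f x"
  shows marked_PPP_summable: "AE \<omega> in M. summable (\<lambda>n. f (Phi n \<omega>) * V n \<omega>)"
    and marked_PPP_laplace: "0 \<le> s \<Longrightarrow> expectation (\<lambda>\<omega>. exp (- s * (\<Sum>n. f (Phi n \<omega>) * V n \<omega>)))
           = exp (- mu * (\<integral>y. s * f y / (1 + s * f y) \<partial>lborel))"
proof -
  note is_PPP_measurable[OF PPP, measurable]
  have Vm[measurable]: "V n \<in> borel_measurable M" for n
    using distributed_measurable[OF V[of n]] by simp
  have fm[measurable]: "f \<in> borel_measurable borel"
    using int by auto
  have [measurable]: "fst \<in> borel_measurable (borel :: (real \<times> real) measure)"
    by (intro borel_measurable_continuous_onI continuous_intros)
  have V0: "AE \<omega> in M. \<forall>n. 0 < V n \<omega>"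
    using erlang_AE_pos[of "V n" 0 for n] V by (subst AE_all_countable) (auto simp: exponential_density_def erlang_density_def)
  have "(\<integral>\<^sup>+\<omega>. (\<Sum>n. ennreal (f (Phi n \<omega>)) * ennreal (V n \<omega>)) \<partial>M) = (\<Sum>n. \<integral>\<^sup>+\<omega>. ennreal (f (Phi n \<omega>)) * ennreal (V n \<omega>) \<partial>M)"
    by (intro nn_integral_suminf) measurable
  also have "\<dots> = (\<Sum>n. \<integral>\<^sup>+\<omega>. ennreal (f (Phi n \<omega>)) \<partial>M)"
  proof (intro suminf_cong)
    fix n
    have "(\<integral>\<^sup>+\<omega>. ennreal (f (Phi n \<omega>)) * ennreal (V n \<omega>) \<partial>M)
       = (\<integral>\<^sup>+\<omega>. \<integral>\<^sup>+\<omega>'. ennreal (f (Phi n \<omega>)) * ennreal (V n \<omega>') \<partial>M \<partial>M)"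
      using nn_integral_indep_var[OF ind, of "\<lambda>(p, v). ennreal (f (p n)) * ennreal (fst (v n))"] by simp
    then show "(\<integral>\<^sup>+\<omega>. ennreal (f (Phi n \<omega>)) * ennreal (V n \<omega>) \<partial>M) = (\<integral>\<^sup>+\<omega>. ennreal (f (Phi n \<omega>)) \<partial>M)"
      by (simp add: nn_integral_cmult exponential_mean[OF V])
  qed
  also have "\<dots> = ennreal mu * (\<integral>\<^sup>+y. ennreal (f y) \<partial>lborel)"
    using campbell[OF PPP mu, of "\<lambda>y. ennreal (f y)"] by simp
  also have "\<dots> < \<infinity>"
    using int f by (simp add: nn_integral_eq_integral ennreal_mult_less_top)
  finally have "AE \<omega> in M. (\<Sum>n. ennreal (f (Phi n \<omega>)) * ennreal (V n \<omega>)) \<noteq> \<infinity>"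
    by (intro nn_integral_PInf_AE) auto
  with V0 show summ: "AE \<omega> in M. summable (\<lambda>n. f (Phi n \<omega>) * V n \<omega>)"
  proof eventually_elim
    fix \<omega> assume "\<forall>n. 0 < V n \<omega>" "(\<Sum>n. ennreal (f (Phi n \<omega>)) * ennreal (V n \<omega>)) \<noteq> \<infinity>"
    then show "summable (\<lambda>n. f (Phi n \<omega>) * V n \<omega>)"
      using f by (intro summable_suminf_not_top) (auto simp: ennreal_mult less_imp_le)
  qed
  assume s: "0 \<le> s"
  \<comment> \<open>Independence of the marks is applied to finitely many factors; dominated
    convergence then passes to the whole process on both sides.\<close>
  have fin: "expectation (\<lambda>\<omega>. exp (- s * (\<Sum>n<N. f (Phi n \<omega>) * V n \<omega>))) = expectation (\<lambda>\<omega>. exp (- (\<Sum>n<N. ln (1 + s * f (Phi n \<omega>)))))" for N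
  proof -
    have "(\<integral>\<^sup>+\<omega>. ennreal (exp (- s * (\<Sum>n<N. f (Phi n \<omega>) * V n \<omega>))) \<partial>M)
      = (\<integral>\<^sup>+\<omega>. \<integral>\<^sup>+\<omega>'. ennreal (exp (- s * (\<Sum>n<N. f (Phi n \<omega>) * V n \<omega>'))) \<partial>M \<partial>M)"
      using nn_integral_indep_var[OF ind, of "\<lambda>(p, v). ennreal (exp (- s * (\<Sum>n<N. f (p n) * fst (v n))))"] by simp
    also have "\<dots> = (\<integral>\<^sup>+\<omega>. ennreal (exp (- (\<Sum>n<N. ln (1 + s * f (Phi n \<omega>))))) \<partial>M)"
    proof (intro nn_integral_cong)
      fix \<omega>
      have "(\<integral>\<^sup>+\<omega>'. ennreal (exp (- s * (\<Sum>n<N. f (Phi n \<omega>) * V n \<omega>'))) \<partial>M)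
        = (\<integral>\<^sup>+\<omega>'. (\<Prod>n<N. ennreal (exp (- (s * f (Phi n \<omega>)) * V n \<omega>'))) \<partial>M)"
        by (intro nn_integral_cong) (simp add: prod_ennreal exp_sum[symmetric] sum_distrib_left mult.assoc sum_negf)
      also have "\<dots> = (\<Prod>n<N. \<integral>\<^sup>+\<omega>'. ennreal (exp (- (s * f (Phi n \<omega>)) * V n \<omega>')) \<partial>M)"
      proof (rule indep_vars_nn_integral)
        show "indep_vars (\<lambda>_. borel) (\<lambda>n \<omega>'. ennreal (exp (- (s * f (Phi n \<omega>)) * V n \<omega>'))) {..<N}"
          by (rule indep_vars_compose2[OF indep_vars_subset[OF indV]]) auto
      qed auto
      also have "\<dots> = (\<Prod>n<N. ennreal (1 / (1 + s * f (Phi n \<omega>))))"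
        using s f by (intro prod.cong exponential_laplace V refl) auto
      also have "\<dots> = (\<Prod>n<N. ennreal (exp (- ln (1 + s * f (Phi n \<omega>)))))"
      proof (intro prod.cong refl)
        fix n
        have "0 < 1 + s * f (Phi n \<omega>)" using s f[of "Phi n \<omega>"] by (simp add: add_pos_nonneg)
        then show "ennreal (1 / (1 + s * f (Phi n \<omega>))) = ennreal (exp (- ln (1 + s * f (Phi n \<omega>))))"
          by (simp add: exp_minus inverse_eq_divide)
      qed
      also have "\<dots> = ennreal (exp (- (\<Sum>n<N. ln (1 + s * f (Phi n \<omega>)))))"
        by (simp add: prod_ennreal exp_sum[symmetric] sum_negf)
      finally show "(\<integral>\<^sup>+\<omega>'. ennreal (exp (- s * (\<Sum>n<N. f (Phi n \<omega>) * V n \<omega>'))) \<partial>M) = ennreal (exp (- (\<Sum>n<N. ln (1 + s * f (Phi n \<omega>)))))" .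
    qed
    finally show ?thesis
      by (simp add: integral_eq_nn_integral)
  qed
  define h where "h y = ln (1 + s * f y)" for y
  have h0: "0 \<le> h y" for y
    using s f[of y] by (simp add: h_def)
  have [measurable]: "h \<in> borel_measurable borel" unfolding h_def by measurable
  have inth: "integrable lborel h"
  proof (rule Bochner_Integration.integrable_bound)
    show "integrable lborel (\<lambda>y. s * f y)" using int by simp
    show "AE y in lborel. norm (h y) \<le> norm (s * f y)"
    proof (rule AE_I2)
      fix y show "norm (h y) \<le> norm (s * f y)"
        using s f[of y] h0[of y] ln_add_one_self_le_self[of "s * f y"] by (simp add: h_def)
    qed
  qed simp
  have l1: "(\<lambda>N. expectation (\<lambda>\<omega>. exp (- s * (\<Sum>n<N. f (Phi n \<omega>) * V n \<omega>)))) \<longlonglongrightarrow> expectation (\<lambda>\<omega>. exp (- s * (\<Sum>n. f (Phi n \<omega>) * V n \<omega>)))"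
  proof (rule integral_dominated_convergence[where w="\<lambda>_. 1"])
    show "AE \<omega> in M. (\<lambda>N. exp (- s * (\<Sum>n<N. f (Phi n \<omega>) * V n \<omega>))) \<longlonglongrightarrow> exp (- s * (\<Sum>n. f (Phi n \<omega>) * V n \<omega>))"
      using summ by eventually_elim (intro tendsto_intros summable_LIMSEQ)
    show "AE \<omega> in M. norm (exp (- s * (\<Sum>n<N. f (Phi n \<omega>) * V n \<omega>))) \<le> 1" for N
      using V0 by eventually_elim (auto intro!: mult_nonneg_nonneg sum_nonneg f s simp: less_imp_le)
  qed auto
  have l2: "(\<lambda>N. expectation (\<lambda>\<omega>. exp (- (\<Sum>n<N. h (Phi n \<omega>))))) \<longlonglongrightarrow> expectation (\<lambda>\<omega>. exp (- (\<Sum>n. h (Phi n \<omega>))))"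
  proof (rule integral_dominated_convergence[where w="\<lambda>_. 1"])
    show "AE \<omega> in M. (\<lambda>N. exp (- (\<Sum>n<N. h (Phi n \<omega>)))) \<longlonglongrightarrow> exp (- (\<Sum>n. h (Phi n \<omega>)))"
      using AE_summable_PPP[OF PPP mu inth h0] by eventually_elim (intro tendsto_intros summable_LIMSEQ)
    show "AE \<omega> in M. norm (exp (- (\<Sum>n<N. h (Phi n \<omega>)))) \<le> 1" for N
      by (auto intro!: sum_nonneg h0)
  qed auto
  have "expectation (\<lambda>\<omega>. exp (- s * (\<Sum>n. f (Phi n \<omega>) * V n \<omega>))) = expectation (\<lambda>\<omega>. exp (- (\<Sum>n. h (Phi n \<omega>))))"
    using l1 l2 unfolding fin h_def by (rule LIMSEQ_unique)
  also have "\<dots> = exp (- mu * (\<integral>y. 1 - exp (- h y) \<partial>lborel))"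
    by (rule laplace_functional[OF PPP mu inth h0])
  also have "(\<lambda>y. 1 - exp (- h y)) = (\<lambda>y. s * f y / (1 + s * f y))"
  proof
    fix y
    have "0 < 1 + s * f y" using s f[of y] by (simp add: add_pos_nonneg)
    then show "1 - exp (- h y) = s * f y / (1 + s * f y)"
      by (simp add: h_def exp_minus field_simps)
  qed
  finally show "expectation (\<lambda>\<omega>. exp (- s * (\<Sum>n. f (Phi n \<omega>) * V n \<omega>))) = exp (- mu * (\<integral>y. s * f y / (1 + s * f y) \<partial>lborel))" .
qed

end

section \<open>Hypergeometric coefficients, Toeplitz matrices and the Erlang tail\<close>

definition phi_weight :: "real \<Rightarrow> real \<Rightarrow> real" where
  "phi_weight d u = indicator {0<..<1} u * (d * u powr (- d - 1))"

text \<open>For positive \<open>n\<close> this is the coefficient of z^n in 1 / (1 + a (1 - z)). At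
  \<open>n = 0\<close> it is the complement 1 - 1 / (1 + a) instead: for positive \<open>d\<close>
  the weight \<open>phi_weight d\<close> has infinite mass near 0, and only a factor vanishing there
  can be integrated.\<close>

definition phi_kernel :: "nat \<Rightarrow> real \<Rightarrow> real" where
  "phi_kernel n a = (if n = 0 then a / (1 + a) else a ^ n / (1 + a) ^ Suc n)"

definition psi :: "real \<Rightarrow> nat \<Rightarrow> real \<Rightarrow> real" where
  "psi d n t = (\<integral>u. phi_weight d u * phi_kernel n (t * u) \<partial>lborel)"

lemma phi_weight_measurable[measurable]: "phi_weight d \<in> borel_measurable borel"
  unfolding phi_weight_def by measurable

lemma phi_kernel_measurable[measurable]: "phi_kernel n \<in> borel_measurable borel"
  unfolding phi_kernel_def by (cases "n = 0") simp_all

lemma psi_measurable[measurable]: "psi d n \<in> borel_measurable borel"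
  unfolding psi_def by measurable

lemma phi_weight_nonneg: "0 \<le> d \<Longrightarrow> 0 \<le> phi_weight d u"
  by (simp add: phi_weight_def)

lemma phi_kernel_nonneg: "0 \<le> a \<Longrightarrow> 0 \<le> phi_kernel n a"
  by (simp add: phi_kernel_def)

lemma psi_nonneg: "0 \<le> d \<Longrightarrow> 0 \<le> t \<Longrightarrow> 0 \<le> psi d n t"
  unfolding psi_def
proof (intro Bochner_Integration.integral_nonneg)
  fix u :: real assume "0 \<le> d" "0 \<le> t"
  then show "0 \<le> phi_weight d u * phi_kernel n (t * u)"
    by (cases "0 < u") (auto intro!: mult_nonneg_nonneg phi_weight_nonneg phi_kernel_nonneg simp: phi_weight_def)
qed

text \<open>For \<open>c = b + 1\<close> the factor \<open>(1 - t) powr (c - b - 1)\<close> is 1 on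
  the open interval and the Gamma quotient collapses to \<open>b\<close>.\<close>

lemma hyp2F1_Suc:
  assumes b: "0 < b" and c: "c = b + 1"
  shows "hyp2F1 a b c z = b * (\<integral>u. indicator {0<..<1} u * (u powr (b - 1) * (1 - z * u) powr (- a)) \<partial>lborel)"
proof -
  have "b \<notin> \<int>\<^sub>\<le>\<^sub>0" using b by (auto elim!: nonpos_Ints_cases)
  then have "Gamma c = b * Gamma b" unfolding c by (intro Gamma_plus1) (use b in auto)
  moreover have "Gamma b \<noteq> 0" using Gamma_real_pos[OF b] by simp
  ultimately have "Gamma c / (Gamma b * Gamma (c - b)) = b" by (simp add: c)
  moreover have "set_lebesgue_integral lborel {0<..<1} (\<lambda>t. t powr (b - 1) * (1 - t) powr (c - b - 1) * (1 - z * t) powr (- a))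
     = (\<integral>u. indicator {0<..<1} u * (u powr (b - 1) * (1 - z * u) powr (- a)) \<partial>lborel)"
    unfolding set_lebesgue_integral_def
    by (intro Bochner_Integration.integral_cong refl) (auto simp: c split: split_indicator)
  ultimately show ?thesis
    by (simp add: hyp2F1_def)
qed

text \<open>The factor \<open>b\<close> left over from Euler's formula is \<open>1 - d\<close> or
  \<open>real n - d\<close>, which is the denominator in \<open>phi\<close>; the remaining powers of
  \<open>t\<close> and \<open>u\<close> combine into the kernel at \<open>t * u\<close>.\<close>

lemma phi_eq_psi:
  assumes d: "0 < delta alpha j" "delta alpha j < 1" and t: "0 \<le> tau M B j k \<beta>"
  shows "phi M B alpha j k n \<beta> = psi (delta alpha j) n (tau M B j k \<beta>)"
proof -
  define d where "d = delta alpha j"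
  define t where "t = tau M B j k \<beta>"
  have d01: "0 < d" "d < 1" and t0: "0 \<le> t" using assms by (simp_all add: d_def t_def)
  have "phi M B alpha j k n \<beta> = psi d n t"
  proof (cases "n = 0")
    case True
    have "phi M B alpha j k n \<beta> = d * t * (\<integral>u. indicator {0<..<1} u * (u powr (- d) * (1 + t * u) powr (- 1)) \<partial>lborel)"
      using True d01 by (simp add: phi_def Let_def d_def[symmetric] t_def[symmetric] hyp2F1_Suc[of "1 - d"])
    also have "\<dots> = psi d n t"
      unfolding psi_def
    proof (subst integral_mult_right_zero[symmetric], intro Bochner_Integration.integral_cong refl)
      fix u
      show "d * t * (indicator {0<..<1} u * (u powr (- d) * (1 + t * u) powr (- 1))) = phi_weight d u * phi_kernel n (t * u)"
      proof (cases "0 < u")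
        case u: True
        have "0 < 1 + t * u" using u t0 by (simp add: add_pos_nonneg)
        moreover have "u powr (- d) = u powr (- d - 1) * u"
          using u powr_add[of u "- d - 1" 1] by simp
        ultimately show ?thesis
          using True by (simp add: phi_weight_def phi_kernel_def powr_minus_divide)
      qed (simp add: phi_weight_def)
    qed
    finally show ?thesis .
  next
    case False
    have n: "0 < real n - d" using False d01 by (cases n) auto
    have "phi M B alpha j k n \<beta> = d * t ^ n * (\<integral>u. indicator {0<..<1} u * (u powr (real n - d - 1) * (1 + t * u) powr (- (real n + 1))) \<partial>lborel)"
      using False n hyp2F1_Suc[of "real n - d" "real n + 1 - d" "real n + 1" "- t"]
      by (simp add: phi_def Let_def d_def[symmetric] t_def[symmetric])
    also have "\<dots> = psi d n t"
      unfolding psi_def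
    proof (subst integral_mult_right_zero[symmetric], intro Bochner_Integration.integral_cong refl)
      fix u
      show "d * t ^ n * (indicator {0<..<1} u * (u powr (real n - d - 1) * (1 + t * u) powr (- (real n + 1)))) = phi_weight d u * phi_kernel n (t * u)"
      proof (cases "0 < u")
        case u: True
        have p: "0 < 1 + t * u" using u t0 by (simp add: add_pos_nonneg)
        have "u powr (real n - d - 1) = u powr (- d - 1) * u ^ n"
          using u powr_add[of u "- d - 1" "real n"] by (simp add: powr_realpow algebra_simps)
        moreover have "(1 + t * u) powr (- (real n + 1)) = 1 / (1 + t * u) ^ Suc n"
          using powr_realpow[OF p, of "Suc n"] powr_minus_divide[of "1 + t * u" "real n + 1"]
          by (simp add: add.commute del: power_Suc)
        ultimately show ?thesis
          using False by (simp add: phi_weight_def phi_kernel_def power_mult_distrib del: power_Suc)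
      qed (simp add: phi_weight_def)
    qed
    finally show ?thesis .
  qed
  then show ?thesis by (simp add: d_def t_def)
qed

text \<open>Near 0 the integrand behaves like \<open>u powr (- d)\<close>, integrable because
  \<open>d < 1\<close>; this is where a path-loss exponent above 2 enters.\<close>

lemma integrable_phi_weight_id:
  assumes d: "0 < d" "d < 1"
  shows "integrable lborel (\<lambda>u. phi_weight d u * u)"
proof -
  have "(\<lambda>u. u powr (- d)) absolutely_integrable_on {0..1}"
    using d by (intro nonnegative_absolutely_integrable_1 integrable_on_powr_from_0) auto
  then have "integrable lborel (\<lambda>u. indicator {0..1} u *\<^sub>R u powr (- d))"
    unfolding set_integrable_def by (subst (asm) integrable_completion) auto
  then have int: "integrable lborel (\<lambda>u. d * (indicator {0..1} u * u powr (- d)))"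
    by simp
  show ?thesis
  proof (rule Bochner_Integration.integrable_bound[OF int])
    have "norm (phi_weight d u * u) \<le> norm (d * (indicator {0..1} u * u powr (- d)))" for u
      using d powr_add[of u "- d - 1" 1] by (auto simp: phi_weight_def split: split_indicator)
    then show "AE u in lborel. norm (phi_weight d u * u) \<le> norm (d * (indicator {0..1} u * u powr (- d)))"
      by simp
  qed simp
qed

lemma phi_kernel_0_le: "0 \<le> a \<Longrightarrow> phi_kernel 0 a \<le> a"
  by (simp add: phi_kernel_def divide_le_eq mult_nonneg_nonneg distrib_left)

lemma integrable_psi_0:
  assumes d: "0 < d" "d < 1" and t: "0 \<le> t"
  shows "integrable lborel (\<lambda>u. phi_weight d u * phi_kernel 0 (t * u))"
proof (rule Bochner_Integration.integrable_bound)
  show "integrable lborel (\<lambda>u. t * (phi_weight d u * u))"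
    using integrable_phi_weight_id[OF d] by simp
  show "AE u in lborel. norm (phi_weight d u * phi_kernel 0 (t * u)) \<le> norm (t * (phi_weight d u * u))"
  proof (rule AE_I2)
    fix u :: real
    show "norm (phi_weight d u * phi_kernel 0 (t * u)) \<le> norm (t * (phi_weight d u * u))"
    proof (cases "0 < u")
      case True
      then have "0 \<le> t * u" using t by simp
      then show ?thesis
        using mult_left_mono[OF phi_kernel_0_le[of "t * u"] phi_weight_nonneg[of d u]] d
          phi_weight_nonneg[of d u] phi_kernel_nonneg[of "t * u" 0]
          t True
        by (simp add: abs_mult algebra_simps)
    qed (simp add: phi_weight_def)
  qed
qed measurable

text \<open>For \<open>u\<close> below \<open>1 / t\<close> the kernel is at least
  \<open>t * u / 2\<close> and \<open>u powr (- d)\<close> is at least \<open>t powr d\<close>, so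
  the region under the integrand contains a rectangle of width \<open>1 / t\<close>. This growth in
  \<open>t\<close> is the source of the decay of the coverage probability.\<close>

lemma psi_0_lower_bound:
  assumes d: "0 < d" "d < 1" and t: "1 \<le> t"
  shows "d * t powr d / 2 \<le> psi d 0 t"
proof -
  have "d * t powr d / 2 = (\<integral>u. (d * t * t powr d / 2) * indicator {0<..<1 / t} u \<partial>lborel)"
    using t by simp
  also have "\<dots> \<le> psi d 0 t"
    unfolding psi_def
  proof (rule integral_mono)
    show "integrable lborel (\<lambda>u. phi_weight d u * phi_kernel 0 (t * u))"
      using t by (intro integrable_psi_0 d) auto
    show "integrable lborel (\<lambda>u. (d * t * t powr d / 2) * indicator {0<..<1 / t} u)"
      using t by simp
    fix u :: real
    show "(d * t * t powr d / 2) * indicator {0<..<1 / t} u \<le> phi_weight d u * phi_kernel 0 (t * u)"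
    proof (cases "u \<in> {0<..<1 / t}")
      case True
      then have u: "0 < u" "u < 1 / t" by auto
      have tu: "t * u < 1" using u t by (simp add: field_simps)
      have u1: "u < 1" using u t by (auto elim!: order_less_le_trans)
      have "t powr d \<le> u powr (- d)"
      proof -
        have "t powr d = (1 / t) powr (- d)" using t by (simp add: powr_minus_divide powr_divide)
        also have "\<dots> \<le> u powr (- d)" using u t d by (intro powr_mono2') auto
        finally show ?thesis .
      qed
      then have "d * t * t powr d / 2 \<le> d * t * u powr (- d) / (1 + t * u)"
        using d t u tu by (intro frac_le mult_left_mono) (auto intro: add_pos_nonneg)
      also have "u powr (- d) = u powr (- d - 1) * u"
        using u powr_add[of u "- d - 1" 1] by simp
      finally show ?thesis
        using True u u1 by (simp add: phi_weight_def phi_kernel_def mult_ac)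
    next
      case False
      then show ?thesis
        using d t by (cases "0 < u") (auto intro!: mult_nonneg_nonneg phi_weight_nonneg phi_kernel_nonneg simp: phi_weight_def)
    qed
  qed
  finally show ?thesis .
qed

text \<open>The geometric expansion of the kernel has ratio \<open>a * z / (1 + a)\<close>, below 1
  in absolute value for all nonnegative \<open>a\<close> at once, so one radius, here 1/2, serves
  every \<open>u\<close>. Subtracting the value at \<open>z = 0\<close> removes the constant term
  that could not be integrated.\<close>

lemma psi_has_fps_expansion:
  assumes d: "0 < d" "d < 1" and t: "0 \<le> t"
  shows "(\<lambda>z. psi d 0 t - psi d 0 (t * (1 - z))) has_fps_expansion Abs_fps (\<lambda>n. if n = 0 then 0 else psi d n t)"
proof -
  define f where "f n u = (if n = 0 then 0 else phi_weight d u * phi_kernel n (t * u))" for n u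
  define S where "S z u = phi_weight d u * phi_kernel 0 (t * u) - phi_weight d u * phi_kernel 0 (t * (1 - z) * u)" for z u
  have sums: "(\<lambda>n. f n u * z ^ n) sums S z u" if z: "\<bar>z\<bar> \<le> 1 / 2" for z u
  proof (cases "0 < u")
    case True
    define a where "a = t * u"
    have a: "0 \<le> a" using True t by (simp add: a_def)
    have "\<bar>a * z\<bar> \<le> a * 1"
      using z a unfolding abs_mult by (intro mult_mono) auto
    then have az: "\<bar>a * z / (1 + a)\<bar> < 1" using a by simp
    then have "(\<lambda>n. (1 / (1 + a)) * (a * z / (1 + a)) ^ n) sums ((1 / (1 + a)) * (1 / (1 - a * z / (1 + a))))"
      by (intro sums_mult geometric_sums) simp
    moreover have "a * z < 1 + a" using \<open>\<bar>a * z\<bar> \<le> a * 1\<close> by linarith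
    ultimately have "(\<lambda>n. (1 / (1 + a)) * (a * z / (1 + a)) ^ n) sums (1 / (1 + a - a * z))"
      using a by (simp add: field_simps)
    from sums_diff[OF this sums_single[of 0 "\<lambda>_. 1 / (1 + a)"]]
    have "(\<lambda>n. if n = 0 then 0 else phi_kernel n a * z ^ n) sums (1 / (1 + a - a * z) - 1 / (1 + a))"
      by (rule back_subst[where P="\<lambda>f. f sums _"])
         (auto simp: fun_eq_iff phi_kernel_def power_mult_distrib power_divide)
    then have "(\<lambda>n. phi_weight d u * (if n = 0 then 0 else phi_kernel n a * z ^ n)) sums (phi_weight d u * (1 / (1 + a - a * z) - 1 / (1 + a)))"
      by (rule sums_mult)
    moreover have "1 / (1 + a - a * z) - 1 / (1 + a) = phi_kernel 0 a - phi_kernel 0 (a * (1 - z))"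
      using a \<open>a * z < 1 + a\<close> by (simp add: phi_kernel_def field_simps)
    moreover have "t * (1 - z) * u = a * (1 - z)" by (simp add: a_def)
    ultimately show ?thesis
      unfolding S_def f_def a_def[symmetric]
      by (simp add: right_diff_distrib if_distrib[of "\<lambda>x. phi_weight d u * x"] if_distrib[of "\<lambda>x. x * _"] mult.assoc cong: if_cong)
  next
    case False
    then show ?thesis by (simp add: f_def S_def phi_weight_def sums_0)
  qed
  have intS: "integrable lborel (S z)" if "\<bar>z\<bar> \<le> 1 / 2" for z
    unfolding S_def using that t by (intro Bochner_Integration.integrable_diff integrable_psi_0 d) auto
  have "(\<lambda>z. \<integral>u. (\<Sum>n. f n u * z ^ n) \<partial>lborel) has_fps_expansion Abs_fps (\<lambda>n. \<integral>u. f n u \<partial>lborel)"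
  proof (rule has_fps_expansion_lebesgue_integral[where r="1 / 2"])
    show "0 \<le> f n u" for n u
      using d t phi_weight_nonneg[of d u] phi_kernel_nonneg[of "t * u" n]
      by (cases "0 < u") (auto simp: f_def, simp add: phi_weight_def)
    show "f n \<in> borel_measurable lborel" for n unfolding f_def by simp
    show "(\<lambda>n. f n u * (1 / 2) ^ n) sums S (1 / 2) u" for u by (rule sums) simp
    show "integrable lborel (S (1 / 2))" by (rule intS) simp
  qed simp
  moreover have "(\<lambda>n. \<integral>u. f n u \<partial>lborel) = (\<lambda>n. if n = 0 then 0 else psi d n t)"
    by (auto simp: f_def psi_def fun_eq_iff)
  moreover have "eventually (\<lambda>z. (\<integral>u. (\<Sum>n. f n u * z ^ n) \<partial>lborel) = psi d 0 t - psi d 0 (t * (1 - z))) (nhds 0)"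
  proof -
    have "eventually (\<lambda>z. z \<in> ball 0 (1 / 2)) (nhds (0::real))"
      by (intro eventually_nhds_in_open) auto
    then show ?thesis
    proof eventually_elim
      fix z :: real assume "z \<in> ball 0 (1 / 2)"
      then have z: "\<bar>z\<bar> \<le> 1 / 2" by simp
      have "(\<integral>u. (\<Sum>n. f n u * z ^ n) \<partial>lborel) = (\<integral>u. S z u \<partial>lborel)"
        using sums[OF z] by (simp add: sums_iff)
      also have "\<dots> = psi d 0 t - psi d 0 (t * (1 - z))"
        unfolding S_def psi_def using z t
        by (intro Bochner_Integration.integral_diff integrable_psi_0 d) auto
      finally show "(\<integral>u. (\<Sum>n. f n u * z ^ n) \<partial>lborel) = psi d 0 t - psi d 0 (t * (1 - z))" .
    qed
  qed
  ultimately show ?thesis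
    by (simp add: has_fps_expansion_cong)
qed

section \<open>Powers and exponentials of series with nonnegative coefficients\<close>

lemma fps_power_nth_nonneg:
  fixes G :: "real fps"
  assumes "\<And>n. 0 \<le> fps_nth G n"
  shows "0 \<le> fps_nth (G ^ i) n"
  by (induction i arbitrary: n) (auto simp: fps_mult_nth intro!: sum_nonneg mult_nonneg_nonneg assms)

lemma fps_power_nth_eq_0:
  fixes G :: "real fps"
  assumes "fps_nth G 0 = 0" "n < i"
  shows "fps_nth (G ^ i) n = 0"
  using assms startsby_zero_power_prefix by blast

text \<open>The exponential series in \<open>i\<close> and the power series in \<open>n\<close> are
  interchanged by reading the sum over \<open>i\<close> as an integral against counting measure;
  nonnegative coefficients make this legitimate. As \<open>G\<close> has zero constant term,
  \<open>G ^ i\<close> starts at index \<open>i\<close>, which leaves a finite sum in each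
  coefficient.\<close>

lemma has_fps_expansion_exp_compose:
  fixes g :: "real \<Rightarrow> real" and c :: real
  assumes g: "g has_fps_expansion G" and G0: "fps_nth G 0 = 0" and Gn: "\<And>n. 0 \<le> fps_nth G n" and c: "0 \<le> c"
  shows "(\<lambda>z. exp (c * g z)) has_fps_expansion Abs_fps (\<lambda>n. \<Sum>i\<le>n. c ^ i / fact i * fps_nth (G ^ i) n)"
proof -
  obtain r where r: "0 < r" "ereal r < fps_conv_radius G"
    using g ereal_dense2[of 0 "fps_conv_radius G"] by (auto simp: has_fps_expansion_def)
  define f where "f n i = c ^ i / fact i * fps_nth (G ^ i) n" for n i
  define S where "S z i = c ^ i / fact i * eval_fps G z ^ i" for z i
  have sums: "(\<lambda>n. f n i * z ^ n) sums S z i" if z: "\<bar>z\<bar> \<le> r" for z i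
  proof -
    have zG: "ereal (norm z) < fps_conv_radius G"
      using z r(2) by (metis ereal_less_eq(3) order_le_less_trans real_norm_def)
    then have "ereal (norm z) < fps_conv_radius (G ^ i)"
      using fps_conv_radius_power[of G i] by (rule order_less_le_trans)
    from sums_mult[OF sums_eval_fps[OF this], of "c ^ i / fact i"] eval_fps_power[OF zG, of i]
    show ?thesis by (simp add: f_def S_def mult.assoc)
  qed
  have sumsS: "(\<lambda>i. S z i) sums exp (c * eval_fps G z)" for z
    using exp_converges[of "c * eval_fps G z"] by (simp add: S_def power_mult_distrib divide_inverse mult_ac)
  have int: "integrable (count_space UNIV) (S z)" for z
    using summable_norm_exp[of "c * eval_fps G z"]
    by (simp add: integrable_count_space_nat_iff S_def power_mult_distrib divide_inverse mult_ac abs_mult)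
  have "(\<lambda>z. \<integral>i. (\<Sum>n. f n i * z ^ n) \<partial>count_space UNIV) has_fps_expansion Abs_fps (\<lambda>n. \<integral>i. f n i \<partial>count_space UNIV)"
  proof (rule has_fps_expansion_lebesgue_integral[OF r(1)])
    show "0 \<le> f n i" for n i
      using c fps_power_nth_nonneg[of G i n, OF Gn] by (simp add: f_def)
    show "(\<lambda>n. f n i * r ^ n) sums S r i" for i using r by (intro sums) auto
    show "integrable (count_space UNIV) (S r)" by (rule int)
  qed simp
  moreover have "(\<lambda>n. \<integral>i. f n i \<partial>count_space UNIV) = (\<lambda>n. \<Sum>i\<le>n. f n i)"
  proof
    fix n
    have "f n i = 0" if "i \<notin> {..n}" for i
      using that by (simp add: f_def fps_power_nth_eq_0[OF G0])
    then have "f n sums (\<Sum>i\<le>n. f n i)"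
      by (intro sums_finite) auto
    moreover have "integrable (count_space UNIV) (f n)"
      using \<open>\<And>i. i \<notin> {..n} \<Longrightarrow> f n i = 0\<close>
      unfolding integrable_count_space_nat_iff by (intro summable_finite[of "{..n}"]) auto
    ultimately show "(\<integral>i. f n i \<partial>count_space UNIV) = (\<Sum>i\<le>n. f n i)"
      by (simp add: integral_count_space_nat sums_iff)
  qed
  moreover have "eventually (\<lambda>z. (\<integral>i. (\<Sum>n. f n i * z ^ n) \<partial>count_space UNIV) = exp (c * g z)) (nhds 0)"
  proof -
    have "eventually (\<lambda>z. z \<in> ball 0 r) (nhds (0::real))"
      using r by (intro eventually_nhds_in_open) auto
    moreover have "eventually (\<lambda>z. eval_fps G z = g z) (nhds 0)"
      using g by (simp add: has_fps_expansion_def)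
    ultimately show ?thesis
    proof eventually_elim
      fix z :: real assume "z \<in> ball 0 r" and gz: "eval_fps G z = g z"
      then have z: "\<bar>z\<bar> \<le> r" by simp
      have "(\<integral>i. (\<Sum>n. f n i * z ^ n) \<partial>count_space UNIV) = (\<integral>i. S z i \<partial>count_space UNIV)"
        using sums[OF z] by (simp add: sums_iff)
      also have "\<dots> = exp (c * g z)"
        using sumsS[of z] int[of z] gz by (simp add: integral_count_space_nat sums_iff)
      finally show "(\<integral>i. (\<Sum>n. f n i * z ^ n) \<partial>count_space UNIV) = exp (c * g z)" .
    qed
  qed
  ultimately show ?thesis
    unfolding f_def by (simp add: has_fps_expansion_cong)
qed

section \<open>Lower triangular Toeplitz matrices as truncated power series\<close>

definition toeplitz :: "nat \<Rightarrow> real fps \<Rightarrow> real mat" where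
  "toeplitz N F = mat N N (\<lambda>(p, q). if q \<le> p then fps_nth F (p - q) else 0)"

text \<open>Only the indices between \<open>q\<close> and \<open>p\<close> survive, and the reversal
  \<open>p - l\<close> turns the sum into the Cauchy product. Truncation is harmless because the
  entry involves only coefficients up to \<open>p - q\<close>.\<close>

lemma toeplitz_mult: "toeplitz N F * toeplitz N G = toeplitz N (F * G)"
proof (rule eq_matI)
  fix p q assume "p < dim_row (toeplitz N (F * G))" "q < dim_col (toeplitz N (F * G))"
  then have pq: "p < N" "q < N" by (auto simp: toeplitz_def)
  have "(toeplitz N F * toeplitz N G) $$ (p, q) =
      (\<Sum>l<N. (if l \<le> p then fps_nth F (p - l) else 0) * (if q \<le> l then fps_nth G (l - q) else 0))"
    using pq by (simp add: toeplitz_def scalar_prod_def atLeast0LessThan)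
  also have "\<dots> = (\<Sum>l\<in>{q..p}. fps_nth F (p - l) * fps_nth G (l - q))"
    using pq by (intro sum.mono_neutral_cong_right) auto
  also have "\<dots> = (if q \<le> p then fps_nth (F * G) (p - q) else 0)"
  proof (cases "q \<le> p")
    case True
    have "(\<Sum>l\<in>{q..p}. fps_nth F (p - l) * fps_nth G (l - q)) = (\<Sum>i\<in>{0..p - q}. fps_nth F i * fps_nth G (p - q - i))"
      using True by (intro sum.reindex_bij_witness[of _ "\<lambda>i. p - i" "\<lambda>l. p - l"]) auto
    then show ?thesis using True by (simp add: fps_mult_nth)
  qed simp
  finally show "(toeplitz N F * toeplitz N G) $$ (p, q) = toeplitz N (F * G) $$ (p, q)"
    using pq by (simp add: toeplitz_def)
qed (auto simp: toeplitz_def)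

lemma toeplitz_power: "toeplitz N F ^\<^sub>m i = toeplitz N (F ^ i)"
proof (induction i)
  case 0
  show ?case by (rule eq_matI) (auto simp: toeplitz_def)
next
  case (Suc i)
  then show ?case by (simp add: toeplitz_mult mult.commute)
qed

lemma borel_measurable_fps_power_nth:
  fixes F :: "'a \<Rightarrow> real fps"
  assumes [measurable]: "\<And>n. (\<lambda>x. fps_nth (F x) n) \<in> borel_measurable N"
  shows "(\<lambda>x. fps_nth (F x ^ i) n) \<in> borel_measurable N"
proof (induction i arbitrary: n)
  case (Suc i)
  note [measurable] = Suc
  show ?case by (simp add: fps_mult_nth)
qed simp

section \<open>Erlang tails and the Taylor coefficients of a Laplace transform\<close>

context prob_space
begin

text \<open>Splitting off \<open>exp (- \<theta> * J \<omega>)\<close> leaves the exponential series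
  in \<open>\<theta> * J \<omega> * z\<close>. At radius 1/2 its sum is
  \<open>exp (- (\<theta> / 2) * J \<omega>)\<close>, at most 1, which is the majorant. Absolute
  values are inserted because termwise integration asks for pointwise signs, while \<open>J\<close>
  is only almost surely nonnegative.\<close>

lemma laplace_has_fps_expansion:
  fixes J :: "'a \<Rightarrow> real"
  assumes J[measurable]: "J \<in> borel_measurable M" and nonneg: "AE \<omega> in M. 0 \<le> J \<omega>" and th: "0 \<le> \<theta>"
  shows "(\<lambda>z. expectation (\<lambda>\<omega>. exp (- (\<theta> * (1 - z)) * J \<omega>))) has_fps_expansion
     Abs_fps (\<lambda>m. expectation (\<lambda>\<omega>. (\<theta> * J \<omega>) ^ m / fact m * exp (- \<theta> * J \<omega>)))"
proof -
  define f where "f m \<omega> = (\<theta> * \<bar>J \<omega>\<bar>) ^ m / fact m * exp (- \<theta> * \<bar>J \<omega>\<bar>)" for m \<omega>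
  have f_sums: "(\<lambda>m. f m \<omega> * z ^ m) sums exp (- (\<theta> * (1 - z)) * \<bar>J \<omega>\<bar>)" for z \<omega>
    using sums_mult[OF exp_converges[of "\<theta> * \<bar>J \<omega>\<bar> * z"], of "exp (- \<theta> * \<bar>J \<omega>\<bar>)"]
    by (simp add: f_def power_mult_distrib divide_inverse mult_ac exp_add[symmetric] algebra_simps)
  have "(\<lambda>z. expectation (\<lambda>\<omega>. \<Sum>m. f m \<omega> * z ^ m)) has_fps_expansion Abs_fps (\<lambda>m. expectation (f m))"
  proof (rule has_fps_expansion_lebesgue_integral[where r="1 / 2"])
    show "(0::real) < 1 / 2" by simp
    show "f m \<in> borel_measurable M" for m unfolding f_def by measurable
    show "(\<lambda>m. f m \<omega> * (1 / 2) ^ m) sums exp (- (\<theta> * (1 - 1 / 2)) * \<bar>J \<omega>\<bar>)" for \<omega>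
      by (rule f_sums)
    show "integrable M (\<lambda>\<omega>. exp (- (\<theta> * (1 - 1 / 2)) * \<bar>J \<omega>\<bar>))"
      using th by (intro integrable_const_bound[where B=1]) auto
    show "0 \<le> f m \<omega>" for m \<omega> using th by (simp add: f_def)
  qed
  moreover have "expectation (\<lambda>\<omega>. \<Sum>m. f m \<omega> * z ^ m) = expectation (\<lambda>\<omega>. exp (- (\<theta> * (1 - z)) * J \<omega>))" for z
  proof -
    have "(\<lambda>\<omega>. \<Sum>m. f m \<omega> * z ^ m) = (\<lambda>\<omega>. exp (- (\<theta> * (1 - z)) * \<bar>J \<omega>\<bar>))"
      using f_sums by (simp add: sums_iff)
    moreover have "AE \<omega> in M. exp (- (\<theta> * (1 - z)) * \<bar>J \<omega>\<bar>) = exp (- (\<theta> * (1 - z)) * J \<omega>)"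
      using nonneg by eventually_elim simp
    ultimately show ?thesis by (simp only:) (intro integral_cong_AE, measurable)
  qed
  moreover have "expectation (f m) = expectation (\<lambda>\<omega>. (\<theta> * J \<omega>) ^ m / fact m * exp (- \<theta> * J \<omega>))" for m
  proof -
    have "AE \<omega> in M. f m \<omega> = (\<theta> * J \<omega>) ^ m / fact m * exp (- \<theta> * J \<omega>)"
      using nonneg unfolding f_def by eventually_elim simp
    then show ?thesis unfolding f_def by (intro integral_cong_AE) measurable
  qed
  ultimately show ?thesis by simp
qed

text \<open>Given \<open>J\<close>, the Erlang tail at \<open>\<theta> * J \<omega>\<close> is the
  probability that a Poisson variable of that mean is at most \<open>k\<close>, hence the finite
  sum. The second bound spends half of the exponent on the power, by
  \<open>(y / 2) ^ m / fact m \<le> exp (y / 2)\<close>.\<close>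

lemma
  assumes H: "distributed M lborel H (\<lambda>x. ennreal (erlang_density k 1 x))"
    and ind: "indep_var borel J borel H" and nonneg: "AE \<omega> in M. 0 \<le> J \<omega>" and th: "0 \<le> \<theta>"
  shows erlang_tail_laplace: "prob {\<omega> \<in> space M. \<theta> * J \<omega> < H \<omega>} = (\<Sum>m\<le>k. expectation (\<lambda>\<omega>. (\<theta> * J \<omega>) ^ m / fact m * exp (- \<theta> * J \<omega>)))"
    and laplace_moment_le: "expectation (\<lambda>\<omega>. (\<theta> * J \<omega>) ^ m / fact m * exp (- \<theta> * J \<omega>)) \<le> 2 ^ m * expectation (\<lambda>\<omega>. exp (- (\<theta> / 2) * J \<omega>))"
proof -
  have [measurable]: "J \<in> borel_measurable M" "H \<in> borel_measurable M"
    using ind by (rule indep_var_rv1, rule indep_var_rv2)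
  have em: "emeasure M {\<omega> \<in> space M. Q \<omega>} = (\<integral>\<^sup>+\<omega>. (if Q \<omega> then 1 else 0) \<partial>M)" if "{\<omega> \<in> space M. Q \<omega>} \<in> sets M" for Q
    unfolding nn_integral_indicator[OF that, symmetric] by (rule nn_integral_cong) simp
  have le: "y ^ m / fact m * exp (- y) \<le> 2 ^ m * exp (- (y / 2))" if "0 \<le> y" for y :: real and m
  proof -
    have "(y / 2) ^ m / fact m \<le> exp (y / 2)"
    proof -
      have "(\<Sum>n\<in>{m}. (y / 2) ^ n /\<^sub>R fact n) \<le> exp (y / 2)"
        unfolding exp_def using that by (intro sum_le_suminf summable_exp_generic) auto
      moreover have "(y / 2) ^ m /\<^sub>R fact m = (y / 2) ^ m / fact m"
        unfolding real_scaleR_def by (rule trans[OF mult.commute divide_inverse[symmetric]])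
      ultimately show ?thesis by simp
    qed
    then have "2 ^ m * ((y / 2) ^ m / fact m) * exp (- y) \<le> 2 ^ m * exp (y / 2) * exp (- y)"
      by (intro mult_right_mono mult_left_mono) auto
    also have "2 ^ m * ((y / 2) ^ m / fact m) = y ^ m / fact m"
      by (simp add: power_divide)
    also have "2 ^ m * exp (y / 2) * exp (- y) = 2 ^ m * exp (- (y / 2))"
      by (simp add: mult.assoc exp_add[symmetric])
    finally show ?thesis .
  qed
  have "AE \<omega> in M. norm (exp (- (\<theta> / 2) * J \<omega>)) \<le> 1"
    using nonneg by eventually_elim (use th in simp)
  then have int2: "integrable M (\<lambda>\<omega>. exp (- (\<theta> / 2) * J \<omega>))"
    by (intro integrable_const_bound[where B=1]) auto
  have AE_le: "AE \<omega> in M. (\<theta> * J \<omega>) ^ m / fact m * exp (- \<theta> * J \<omega>) \<le> 2 ^ m * exp (- (\<theta> / 2) * J \<omega>)" for m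
    using nonneg
  proof eventually_elim
    fix \<omega> assume "0 \<le> J \<omega>"
    then show "(\<theta> * J \<omega>) ^ m / fact m * exp (- \<theta> * J \<omega>) \<le> 2 ^ m * exp (- (\<theta> / 2) * J \<omega>)"
      using le[of "\<theta> * J \<omega>" m] th by simp
  qed
  have int: "integrable M (\<lambda>\<omega>. (\<theta> * J \<omega>) ^ m / fact m * exp (- \<theta> * J \<omega>))" for m
  proof (rule Bochner_Integration.integrable_bound)
    show "integrable M (\<lambda>\<omega>. 2 ^ m * exp (- (\<theta> / 2) * J \<omega>))" using int2 by simp
    show "AE \<omega> in M. norm ((\<theta> * J \<omega>) ^ m / fact m * exp (- \<theta> * J \<omega>)) \<le> norm (2 ^ m * exp (- (\<theta> / 2) * J \<omega>))"
      using AE_le[of m] nonneg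
    proof eventually_elim
      fix \<omega> assume "0 \<le> J \<omega>"
      then have "norm ((\<theta> * J \<omega>) ^ m / fact m * exp (- \<theta> * J \<omega>)) = (\<theta> * J \<omega>) ^ m / fact m * exp (- \<theta> * J \<omega>)"
        using th by simp
      moreover assume "(\<theta> * J \<omega>) ^ m / fact m * exp (- \<theta> * J \<omega>) \<le> 2 ^ m * exp (- (\<theta> / 2) * J \<omega>)"
      moreover have "\<dots> \<le> norm (2 ^ m * exp (- (\<theta> / 2) * J \<omega>))"
        by (simp only: real_norm_def abs_ge_self)
      ultimately show "norm ((\<theta> * J \<omega>) ^ m / fact m * exp (- \<theta> * J \<omega>)) \<le> norm (2 ^ m * exp (- (\<theta> / 2) * J \<omega>))"
        by linarith
    qed
  qed measurable
  show "expectation (\<lambda>\<omega>. (\<theta> * J \<omega>) ^ m / fact m * exp (- \<theta> * J \<omega>)) \<le> 2 ^ m * expectation (\<lambda>\<omega>. exp (- (\<theta> / 2) * J \<omega>))"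
    using integral_mono_AE[OF int[of m] _ AE_le[of m]] int2 by simp
  have "ennreal (prob {\<omega> \<in> space M. \<theta> * J \<omega> < H \<omega>}) = (\<integral>\<^sup>+\<omega>. (if \<theta> * J \<omega> < H \<omega> then 1 else 0) \<partial>M)"
    by (subst emeasure_eq_measure[symmetric], rule em) measurable
  also have "\<dots> = (\<integral>\<^sup>+\<omega>. \<integral>\<^sup>+\<omega>'. (if \<theta> * J \<omega> < H \<omega>' then 1 else 0) \<partial>M \<partial>M)"
    using nn_integral_indep_var[OF ind, of "\<lambda>p. if \<theta> * fst p < snd p then 1 else 0"] by simp
  also have "\<dots> = (\<integral>\<^sup>+\<omega>. ennreal (\<Sum>m\<le>k. (\<theta> * J \<omega>) ^ m / fact m * exp (- \<theta> * J \<omega>)) \<partial>M)"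
  proof (intro nn_integral_cong_AE)
    show "AE \<omega> in M. (\<integral>\<^sup>+\<omega>'. (if \<theta> * J \<omega> < H \<omega>' then 1 else 0) \<partial>M) = ennreal (\<Sum>m\<le>k. (\<theta> * J \<omega>) ^ m / fact m * exp (- \<theta> * J \<omega>))"
      using nonneg
    proof eventually_elim
      fix \<omega> assume "0 \<le> J \<omega>"
      then have a: "0 \<le> \<theta> * J \<omega>" using th by simp
      have "(\<integral>\<^sup>+\<omega>'. (if \<theta> * J \<omega> < H \<omega>' then 1 else 0) \<partial>M) = emeasure M {\<omega>' \<in> space M. \<theta> * J \<omega> < H \<omega>'}"
        by (rule em[symmetric]) measurable
      also have "\<dots> = ennreal (1 - erlang_CDF k 1 (\<theta> * J \<omega>))"
        using erlang_distributed_gt[OF H _ a] by (simp add: emeasure_eq_measure)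
      also have "1 - erlang_CDF k 1 (\<theta> * J \<omega>) = (\<Sum>m\<le>k. (\<theta> * J \<omega>) ^ m / fact m * exp (- \<theta> * J \<omega>))"
        using a by (simp add: erlang_CDF_def)
      finally show "(\<integral>\<^sup>+\<omega>'. (if \<theta> * J \<omega> < H \<omega>' then 1 else 0) \<partial>M) = ennreal (\<Sum>m\<le>k. (\<theta> * J \<omega>) ^ m / fact m * exp (- \<theta> * J \<omega>))" .
    qed
  qed
  also have "\<dots> = ennreal (expectation (\<lambda>\<omega>. \<Sum>m\<le>k. (\<theta> * J \<omega>) ^ m / fact m * exp (- \<theta> * J \<omega>)))"
  proof (rule nn_integral_eq_integral)
    show "AE \<omega> in M. 0 \<le> (\<Sum>m\<le>k. (\<theta> * J \<omega>) ^ m / fact m * exp (- \<theta> * J \<omega>))"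
      using nonneg by eventually_elim (use th in \<open>auto intro!: sum_nonneg\<close>)
  qed (use int in auto)
  also have "expectation (\<lambda>\<omega>. \<Sum>m\<le>k. (\<theta> * J \<omega>) ^ m / fact m * exp (- \<theta> * J \<omega>)) = (\<Sum>m\<le>k. expectation (\<lambda>\<omega>. (\<theta> * J \<omega>) ^ m / fact m * exp (- \<theta> * J \<omega>)))"
    using int by (intro Bochner_Integration.integral_sum)
  finally have "ennreal (prob {\<omega> \<in> space M. \<theta> * J \<omega> < H \<omega>}) =
      ennreal (\<Sum>m\<le>k. expectation (\<lambda>\<omega>. (\<theta> * J \<omega>) ^ m / fact m * exp (- \<theta> * J \<omega>)))" .
  moreover have "0 \<le> (\<Sum>m\<le>k. expectation (\<lambda>\<omega>. (\<theta> * J \<omega>) ^ m / fact m * exp (- \<theta> * J \<omega>)))"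
  proof (intro sum_nonneg integral_nonneg_AE)
    fix m show "AE \<omega> in M. 0 \<le> (\<theta> * J \<omega>) ^ m / fact m * exp (- \<theta> * J \<omega>)"
      using nonneg by eventually_elim (use th in simp)
  qed
  ultimately show "prob {\<omega> \<in> space M. \<theta> * J \<omega> < H \<omega>} = (\<Sum>m\<le>k. expectation (\<lambda>\<omega>. (\<theta> * J \<omega>) ^ m / fact m * exp (- \<theta> * J \<omega>)))"
    by simp
qed

end

section \<open>Interference of one tier\<close>

lemma has_bochner_integral_annulus:
  fixes rho alpha d :: real and F :: "real \<Rightarrow> real"
  assumes rho: "0 < rho" and alpha: "0 < alpha" and d: "d = 2 / alpha"
    and F[measurable]: "F \<in> borel_measurable borel" and F0: "\<And>u. 0 \<le> u \<Longrightarrow> 0 \<le> F u"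
    and int: "integrable lborel (\<lambda>u. phi_weight d u * F u)"
  shows "has_bochner_integral lborel (\<lambda>y::real \<times> real. if rho < norm y then F ((norm y / rho) powr (- alpha)) else 0)
     (pi * rho\<^sup>2 * (\<integral>u. phi_weight d u * F u \<partial>lborel))"
proof (rule has_bochner_integral_nn_integral)
  have d0: "0 < d" using d alpha by simp
  have w: "0 \<le> phi_weight d u * F u" for u
    using d0 F0[of u] by (cases "0 \<le> u") (auto simp: phi_weight_def)
  have "0 \<le> (\<integral>u. phi_weight d u * F u \<partial>lborel)"
    by (rule Bochner_Integration.integral_nonneg) (rule w)
  then show "0 \<le> pi * rho\<^sup>2 * (\<integral>u. phi_weight d u * F u \<partial>lborel)"
    by simp
  have "(\<integral>\<^sup>+y. ennreal (if rho < norm y then F ((norm y / rho) powr (- alpha)) else 0) \<partial>(lborel :: (real \<times> real) measure))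
     = (\<integral>\<^sup>+y. (if rho < norm y then ennreal (F ((norm y / rho) powr (- alpha))) else 0) \<partial>(lborel :: (real \<times> real) measure))"
    by (intro nn_integral_cong) auto
  also have "\<dots> = (\<integral>\<^sup>+u. ennreal (F u) * (ennreal (pi * rho\<^sup>2 * d * u powr (- d - 1)) * indicator {0<..<1} u) \<partial>lborel)"
    by (rule nn_integral_annulus[OF rho alpha d]) measurable
  also have "\<dots> = (\<integral>\<^sup>+u. ennreal (pi * rho\<^sup>2 * (phi_weight d u * F u)) \<partial>lborel)"
  proof (intro nn_integral_cong)
    fix u :: real
    show "ennreal (F u) * (ennreal (pi * rho\<^sup>2 * d * u powr (- d - 1)) * indicator {0<..<1} u) = ennreal (pi * rho\<^sup>2 * (phi_weight d u * F u))"
      using d0 F0[of u] by (auto simp: phi_weight_def ennreal_mult'[symmetric] ennreal_mult''[symmetric] mult_ac split: split_indicator)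
  qed
  also have "\<dots> = ennreal (pi * rho\<^sup>2 * (\<integral>u. phi_weight d u * F u \<partial>lborel))"
    using w int by (subst nn_integral_eq_integral) auto
  finally show "(\<integral>\<^sup>+y. ennreal (if rho < norm y then F ((norm y / rho) powr (- alpha)) else 0) \<partial>(lborel :: (real \<times> real) measure))
     = ennreal (pi * rho\<^sup>2 * (\<integral>u. phi_weight d u * F u \<partial>lborel))" .
qed (auto simp: F0)

text \<open>Where the inner integral diverges, its Lebesgue value is 0; finiteness of the double
  integral confines this to a null set of \<open>x\<close>, so nothing is lost in passing from
  extended to Lebesgue integrals.\<close>

lemma nn_integral_set_set_lebesgue:
  fixes F :: "real \<Rightarrow> real \<Rightarrow> real"
  assumes A[measurable]: "A \<in> sets borel" and B[measurable]: "B \<in> sets borel"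
    and F[measurable]: "(\<lambda>(x, y). F x y) \<in> borel_measurable (borel \<Otimes>\<^sub>M borel)"
    and nonneg: "\<And>x y. x \<in> A \<Longrightarrow> y \<in> B \<Longrightarrow> 0 \<le> F x y"
    and fin: "(\<integral>\<^sup>+x\<in>A. (\<integral>\<^sup>+y\<in>B. ennreal (F x y) \<partial>lborel) \<partial>lborel) < \<infinity>"
  shows "ennreal (set_lebesgue_integral lborel A (\<lambda>x. set_lebesgue_integral lborel B (F x)))
      = (\<integral>\<^sup>+x\<in>A. (\<integral>\<^sup>+y\<in>B. ennreal (F x y) \<partial>lborel) \<partial>lborel)"
proof -
  have inner: "set_lebesgue_integral lborel B (F x) = enn2real (\<integral>\<^sup>+y\<in>B. ennreal (F x y) \<partial>lborel)" if "x \<in> A" for x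
    unfolding set_lebesgue_integral_def
    by (subst integral_eq_nn_integral)
       (auto simp: nonneg[OF that] intro!: arg_cong[where f=enn2real] nn_integral_cong split: split_indicator)
  have "set_lebesgue_integral lborel A (\<lambda>x. set_lebesgue_integral lborel B (F x))
      = (\<integral>x. indicator A x * enn2real (\<integral>\<^sup>+y\<in>B. ennreal (F x y) \<partial>lborel) \<partial>lborel)"
  proof -
    have "set_lebesgue_integral lborel A (\<lambda>x. set_lebesgue_integral lborel B (F x))
        = set_lebesgue_integral lborel A (\<lambda>x. enn2real (\<integral>\<^sup>+y\<in>B. ennreal (F x y) \<partial>lborel))"
      by (rule set_lebesgue_integral_cong) (auto simp: inner)
    then show ?thesis by (simp add: set_lebesgue_integral_def)
  qed
  also have "\<dots> = enn2real (\<integral>\<^sup>+x. ennreal (indicator A x * enn2real (\<integral>\<^sup>+y\<in>B. ennreal (F x y) \<partial>lborel)) \<partial>lborel)"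
    by (rule integral_eq_nn_integral) auto
  also have "(\<integral>\<^sup>+x. ennreal (indicator A x * enn2real (\<integral>\<^sup>+y\<in>B. ennreal (F x y) \<partial>lborel)) \<partial>lborel)
      = (\<integral>\<^sup>+x\<in>A. (\<integral>\<^sup>+y\<in>B. ennreal (F x y) \<partial>lborel) \<partial>lborel)"
  proof (rule nn_integral_cong_AE)
    have "AE x in lborel. (\<integral>\<^sup>+y\<in>B. ennreal (F x y) \<partial>lborel) * indicator A x \<noteq> \<infinity>"
      using fin by (intro nn_integral_PInf_AE) auto
    then show "AE x in lborel. ennreal (indicator A x * enn2real (\<integral>\<^sup>+y\<in>B. ennreal (F x y) \<partial>lborel))
      = (\<integral>\<^sup>+y\<in>B. ennreal (F x y) \<partial>lborel) * indicator A x"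
      by eventually_elim (auto split: split_indicator_asm split_indicator simp: less_top)
  qed
  finally show ?thesis
    using fin by (simp add: less_top)
qed

context prob_space
begin

text \<open>In terms of the attenuation \<open>u\<close>, a point contributes its mark times
  \<open>c * u\<close>, where \<open>c\<close> is the mean power received from the edge of the disk.
  The radial change of variables turns the exponent of the marked functional into
  \<open>psi d 0\<close>, with the area \<open>pi * rho\<^sup>2\<close> as the only further
  geometric factor.\<close>

lemma tier_interference:
  assumes PPP: "is_PPP M Phi mu" and mu: "0 \<le> mu"
    and V: "\<And>n. distributed M lborel (V n) (\<lambda>v. ennreal (exponential_density 1 v))"
    and indV: "indep_vars (\<lambda>_. borel) V UNIV"
    and ind: "indep_var (PiM UNIV (\<lambda>_. borel)) (\<lambda>\<omega> n. Phi n \<omega>) (PiM UNIV (\<lambda>_. borel)) (\<lambda>\<omega> n. (V n \<omega>, 0))"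
    and rho: "0 < rho" and p: "0 < p" and alpha: "2 < alpha" and d: "d = 2 / alpha"
  shows tier_nonneg: "AE \<omega> in M. 0 \<le> (\<Sum>n. if rho < norm (Phi n \<omega>) then p * V n \<omega> * norm (Phi n \<omega>) powr (- alpha) else 0)"
    and tier_laplace: "0 \<le> s \<Longrightarrow> expectation (\<lambda>\<omega>. exp (- s * (\<Sum>n. if rho < norm (Phi n \<omega>) then p * V n \<omega> * norm (Phi n \<omega>) powr (- alpha) else 0)))
       = exp (- mu * (pi * rho\<^sup>2 * psi d 0 (s * p * rho powr (- alpha))))"
proof -
  have d01: "0 < d" "d < 1" using d alpha by auto
  define c where "c = p * rho powr (- alpha)"
  have c: "0 < c" using p rho by (simp add: c_def)
  define f where "f y = (if rho < norm y then c * (norm y / rho) powr (- alpha) else 0)" for y :: "real \<times> real"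
  have f_eq: "f y = (if rho < norm y then p * norm y powr (- alpha) else 0)" for y
    using rho by (simp add: f_def c_def powr_divide)
  have f0: "0 \<le> f y" for y using c by (simp add: f_def)
  have term_eq: "(if rho < norm (Phi n \<omega>) then p * V n \<omega> * norm (Phi n \<omega>) powr (- alpha) else 0) = f (Phi n \<omega>) * V n \<omega>" for n \<omega>
    by (simp add: f_eq)
  have intw: "integrable lborel (\<lambda>u. phi_weight d u * (c * u))"
    using integrable_phi_weight_id[OF d01] by (simp add: mult.left_commute)
  have intf: "integrable lborel f"
    unfolding f_def using has_bochner_integral_annulus[OF rho _ d _ _ intw] alpha c by (auto simp: has_bochner_integral_iff)
  have V0: "AE \<omega> in M. \<forall>n. 0 < V n \<omega>"
    using erlang_AE_pos[of "V n" 0 for n] V by (subst AE_all_countable) (auto simp: exponential_density_def erlang_density_def)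
  show "AE \<omega> in M. 0 \<le> (\<Sum>n. if rho < norm (Phi n \<omega>) then p * V n \<omega> * norm (Phi n \<omega>) powr (- alpha) else 0)"
    unfolding term_eq using marked_PPP_summable[OF PPP mu V indV ind intf f0] V0
    by eventually_elim (auto intro!: suminf_nonneg mult_nonneg_nonneg f0 simp: less_imp_le)
  assume s: "0 \<le> s"
  define t where "t = s * p * rho powr (- alpha)"
  have t: "0 \<le> t" "t = s * c" using s p by (auto simp: t_def c_def)
  have "has_bochner_integral lborel (\<lambda>y::real \<times> real. if rho < norm y then phi_kernel 0 (t * (norm y / rho) powr (- alpha)) else 0)
     (pi * rho\<^sup>2 * (\<integral>u. phi_weight d u * phi_kernel 0 (t * u) \<partial>lborel))"
    using t alpha d01 by (intro has_bochner_integral_annulus[OF rho _ d]) (auto intro!: phi_kernel_nonneg integrable_psi_0)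
  moreover have "(\<lambda>y::real \<times> real. if rho < norm y then phi_kernel 0 (t * (norm y / rho) powr (- alpha)) else 0) = (\<lambda>y. s * f y / (1 + s * f y))"
    by (auto simp: fun_eq_iff f_def phi_kernel_def t mult.assoc)
  ultimately have "(\<integral>y. s * f y / (1 + s * f y) \<partial>lborel) = pi * rho\<^sup>2 * psi d 0 t"
    by (simp add: has_bochner_integral_iff psi_def)
  then show "expectation (\<lambda>\<omega>. exp (- s * (\<Sum>n. if rho < norm (Phi n \<omega>) then p * V n \<omega> * norm (Phi n \<omega>) powr (- alpha) else 0)))
       = exp (- mu * (pi * rho\<^sup>2 * psi d 0 (s * p * rho powr (- alpha))))"
    unfolding term_eq using marked_PPP_laplace[OF PPP mu V indV ind intf f0 s] by (simp add: t_def)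
qed

text \<open>Layer-cake formula for \<open>ln (1 + x)\<close>, whose derivative is \<open>1 / (1 + \<beta>)\<close>.\<close>
lemma nn_integral_ln_one_plus:
  fixes H J :: "'a \<Rightarrow> real"
  assumes [measurable]: "H \<in> borel_measurable M" "J \<in> borel_measurable M"
    and H: "AE \<omega> in M. 0 < H \<omega>" and J: "AE \<omega> in M. 0 < J \<omega>" and a: "0 < a"
  shows "(\<integral>\<^sup>+\<omega>. ennreal (ln (1 + a * H \<omega> / J \<omega>)) \<partial>M)
       = (\<integral>\<^sup>+\<beta>\<in>{0<..}. ennreal (prob {\<omega> \<in> space M. \<beta> / a * J \<omega> < H \<omega>} / (1 + \<beta>)) \<partial>lborel)"
proof -
  interpret pair_sigma_finite M lborel ..
  have "(\<integral>\<^sup>+\<omega>. ennreal (ln (1 + a * H \<omega> / J \<omega>)) \<partial>M)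
      = (\<integral>\<^sup>+\<omega>. (\<integral>\<^sup>+\<beta>. (if 0 < \<beta> \<and> \<beta> / a * J \<omega> < H \<omega> then ennreal (1 / (1 + \<beta>)) else 0) \<partial>lborel) \<partial>M)"
  proof (rule nn_integral_cong_AE)
    show "AE \<omega> in M. ennreal (ln (1 + a * H \<omega> / J \<omega>)) = (\<integral>\<^sup>+\<beta>. (if 0 < \<beta> \<and> \<beta> / a * J \<omega> < H \<omega> then ennreal (1 / (1 + \<beta>)) else 0) \<partial>lborel)"
      using H J
    proof eventually_elim
      fix \<omega> assume HJ: "0 < H \<omega>" "0 < J \<omega>"
      define s where "s = a * H \<omega> / J \<omega>"
      have s: "0 < s" using HJ a by (simp add: s_def)
      have iff: "\<beta> / a * J \<omega> < H \<omega> \<longleftrightarrow> \<beta> < s" for \<beta>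
        using HJ a by (auto simp: s_def field_simps)
      have "(\<integral>\<^sup>+\<beta>. (if 0 < \<beta> \<and> \<beta> / a * J \<omega> < H \<omega> then ennreal (1 / (1 + \<beta>)) else 0) \<partial>lborel)
          = (\<integral>\<^sup>+\<beta>. ennreal (1 / (1 + \<beta>)) * indicator {0..s} \<beta> \<partial>lborel)"
        unfolding iff using AE_lborel_singleton[of "0::real"] AE_lborel_singleton[of s]
        by (intro nn_integral_cong_AE, eventually_elim) (auto split: split_indicator)
      also have "\<dots> = ennreal (ln (1 + s) - ln (1 + 0))"
        using s by (intro nn_integral_FTC_Icc[where F="\<lambda>\<beta>. ln (1 + \<beta>)"]) (auto intro!: derivative_eq_intros)
      finally show "ennreal (ln (1 + a * H \<omega> / J \<omega>)) = (\<integral>\<^sup>+\<beta>. (if 0 < \<beta> \<and> \<beta> / a * J \<omega> < H \<omega> then ennreal (1 / (1 + \<beta>)) else 0) \<partial>lborel)"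
        by (simp add: s_def)
    qed
  qed
  also have "\<dots> = (\<integral>\<^sup>+\<beta>. (\<integral>\<^sup>+\<omega>. (if 0 < \<beta> \<and> \<beta> / a * J \<omega> < H \<omega> then ennreal (1 / (1 + \<beta>)) else 0) \<partial>M) \<partial>lborel)"
    by (rule Fubini'[symmetric]) measurable
  also have "\<dots> = (\<integral>\<^sup>+\<beta>\<in>{0<..}. ennreal (prob {\<omega> \<in> space M. \<beta> / a * J \<omega> < H \<omega>} / (1 + \<beta>)) \<partial>lborel)"
  proof (intro nn_integral_cong)
    fix \<beta> :: real
    show "(\<integral>\<^sup>+\<omega>. (if 0 < \<beta> \<and> \<beta> / a * J \<omega> < H \<omega> then ennreal (1 / (1 + \<beta>)) else 0) \<partial>M)
        = ennreal (prob {\<omega> \<in> space M. \<beta> / a * J \<omega> < H \<omega>} / (1 + \<beta>)) * indicator {0<..} \<beta>"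
    proof (cases "0 < \<beta>")
      case True
      have "(\<integral>\<^sup>+\<omega>. (if 0 < \<beta> \<and> \<beta> / a * J \<omega> < H \<omega> then ennreal (1 / (1 + \<beta>)) else 0) \<partial>M)
          = (\<integral>\<^sup>+\<omega>. ennreal (1 / (1 + \<beta>)) * indicator {\<omega> \<in> space M. \<beta> / a * J \<omega> < H \<omega>} \<omega> \<partial>M)"
        using True by (intro nn_integral_cong) (auto split: split_indicator)
      also have "\<dots> = ennreal (1 / (1 + \<beta>)) * emeasure M {\<omega> \<in> space M. \<beta> / a * J \<omega> < H \<omega>}"
        by (rule nn_integral_cmult_indicator) measurable
      finally show ?thesis
        using True by (simp add: emeasure_eq_measure ennreal_mult[symmetric])
    qed simp
  qed
  finally show ?thesis .
qed

end

section \<open>The network model\<close>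

text \<open>\<open>Phi j\<close> lives on the whole plane: the exclusion of near interferers is
  imposed in \<open>Itier\<close>, which drops points within \<open>rho j x\<close>. Outside a fixed
  disk a Poisson process is again Poisson, and the process is independent of \<open>Xs\<close>, so
  this realizes the conditional law given the serving distance.\<close>

locale network = prob_space Pr for Pr :: "'a measure" +
  fixes K k :: nat
    and lam P B alpha :: "nat \<Rightarrow> real" and M :: "nat \<Rightarrow> nat"
    and lam_u eps W :: real
    and Xs H :: "'a \<Rightarrow> real"
    and Phi :: "nat \<Rightarrow> nat \<Rightarrow> 'a \<Rightarrow> real \<times> real"
    and V :: "nat \<Rightarrow> nat \<Rightarrow> 'a \<Rightarrow> real"
  assumes k: "k \<in> {1..K}"
    and params: "\<forall>j\<in>{1..K}. lam j > 0 \<and> P j > 0 \<and> M j \<ge> 1 \<and> B j > 0 \<and> alpha j > 2"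
    and lam_u: "lam_u > 0" and eps: "eps > 0" and W: "W \<ge> 0"
    and X_meas[measurable]: "Xs \<in> borel_measurable Pr"
    and X_dist: "distributed Pr lborel Xs (\<lambda>x. ennreal
          (if 0 < x \<and> x \<le> Rad P M B alpha eps k
           then 2 * pi * lam k / assocT K lam P M B alpha eps k * x
                * exp (- pi * (\<Sum>j = 1..K. lam j * (Omega P M B j / Omega P M B k) powr delta alpha j
                                   * x powr (2 * (delta alpha j / delta alpha k))))
           else 0))"
    and H_meas[measurable]: "H \<in> borel_measurable Pr"
    and H_dist: "distributed Pr lborel H (\<lambda>x. ennreal (erlang_density (M k - 1) 1 x))"
    and Phi_PPP: "\<forall>j\<in>{1..K}. is_PPP Pr (Phi j) (activ K lam P M B alpha eps lam_u j * lam j)"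
    and V_meas: "\<forall>j\<in>{1..K}. \<forall>n. V j n \<in> borel_measurable Pr"
    and V_dist: "\<forall>j\<in>{1..K}. \<forall>n. distributed Pr lborel (V j n) (\<lambda>v. ennreal (exponential_density 1 v))"
    and indep: "indep_sets
        (\<lambda>g. case g of GX \<Rightarrow> gen_sigma Pr Xs | GH \<Rightarrow> gen_sigma Pr H
                     | GPhi j \<Rightarrow> gen_sigma_seq Pr (Phi j) | GV j n \<Rightarrow> gen_sigma Pr (V j n))
        ({GX, GH} \<union> GPhi ` {1..K} \<union> {GV j n | j n. j \<in> {1..K}})"
begin

abbreviation "Om j \<equiv> Omega P M B j / Omega P M B k"
abbreviation "dl j \<equiv> delta alpha j"
abbreviation "mu j \<equiv> activ K lam P M B alpha eps lam_u j * lam j"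
abbreviation "R \<equiv> Rad P M B alpha eps k"
abbreviation "seqM \<equiv> PiM (UNIV :: nat set) (\<lambda>_. borel :: (real \<times> real) measure)"

definition groups :: "rvgroup set" where
  "groups = {GX, GH} \<union> GPhi ` {1..K} \<union> {GV j n | j n. j \<in> {1..K}}"

text \<open>All groups are coded in one type, since \<open>indep_vars\<close> requires a common value type.\<close>
definition Z :: "rvgroup \<Rightarrow> 'a \<Rightarrow> nat \<Rightarrow> real \<times> real" where
  "Z g \<omega> = (case g of GX \<Rightarrow> (\<lambda>_. (Xs \<omega>, 0)) | GH \<Rightarrow> (\<lambda>_. (H \<omega>, 0))
       | GPhi j \<Rightarrow> (\<lambda>n. Phi j n \<omega>) | GV j n \<Rightarrow> (\<lambda>_. (V j n \<omega>, 0)))"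

definition rho :: "nat \<Rightarrow> real \<Rightarrow> real" where
  "rho j x = Om j powr (1 / alpha j) * x powr (alpha k / alpha j)"

definition Itier :: "nat \<Rightarrow> real \<Rightarrow> (nat \<Rightarrow> real \<times> real) \<Rightarrow> (nat \<Rightarrow> real) \<Rightarrow> real" where
  "Itier j x y v = (\<Sum>n. if norm (y n) > rho j x then P j * v n * norm (y n) powr (- alpha j) else 0)"

text \<open>Interference plus noise with the serving distance as a parameter. For fixed
  \<open>x\<close> it depends on the processes and marks alone, hence is independent of
  \<open>Xs\<close>; the denominator in the theorem is
  \<open>J (Xs \<omega>) \<omega>\<close>.\<close>

definition J :: "real \<Rightarrow> 'a \<Rightarrow> real" where
  "J x \<omega> = (\<Sum>j = 1..K. Itier j x (\<lambda>n. Phi j n \<omega>) (\<lambda>n. V j n \<omega>)) + W"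

lemma param:
  assumes "j \<in> {1..K}"
  shows "0 < lam j" "0 < P j" "1 \<le> M j" "0 < B j" "2 < alpha j" "0 < Omega P M B j" "0 < Om j"
    "0 < dl j" "dl j < 1"
proof -
  have p: "0 < lam i" "0 < P i" "1 \<le> M i" "0 < B i" "2 < alpha i" if "i \<in> {1..K}" for i
    using params that by auto
  show "0 < lam j" "0 < P j" "1 \<le> M j" "0 < B j" "2 < alpha j"
    using p[OF assms] by auto
  have Omega_pos: "0 < Omega P M B i" if "i \<in> {1..K}" for i
    using p[OF that] by (simp add: Omega_def)
  show "0 < Omega P M B j" "0 < Om j"
    using Omega_pos[OF assms] Omega_pos[OF k] by simp_all
  show "0 < dl j" "dl j < 1"
    using p(5)[OF assms] by (simp_all add: delta_def)
qed

lemma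
  assumes j: "j \<in> {1..K}"
  shows V_measurable: "V j n \<in> borel_measurable Pr"
    and Phi_measurable: "Phi j n \<in> borel_measurable Pr"
  using V_meas[rule_format, OF j] is_PPP_measurable[OF Phi_PPP[rule_format, OF j]] by auto

lemma fst_snd_measurable[measurable]:
  "fst \<in> borel_measurable (borel :: (real \<times> real) measure)"
  "snd \<in> borel_measurable (borel :: (real \<times> real) measure)"
  "(\<lambda>x::real. (x, 0::real)) \<in> borel_measurable borel"
  by (intro borel_measurable_continuous_onI continuous_intros)+

lemma measurable_seqM:
  assumes "\<And>n. (\<lambda>\<omega>. f \<omega> n) \<in> borel_measurable N"
  shows "f \<in> measurable N seqM"
  using measurable_PiM_single'[of UNIV "\<lambda>n \<omega>. f \<omega> n" N "\<lambda>_. borel"] assms by (auto simp: eta_contract_eq)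

lemma measurable_gen_sigma: "f \<in> measurable (sigma (space Pr) {f -` A \<inter> space Pr | A. A \<in> sets borel}) borel"
  by (rule measurableI) (auto simp: space_measure_of_conv intro!: in_measure_of)

text \<open>Each coded variable is measurable for the sigma-algebra generated by the quantity it
  encodes, so it generates a smaller one, and independence passes to smaller families.\<close>

lemma indep_vars_Z: "indep_vars (\<lambda>_. seqM) Z groups"
  unfolding indep_vars_def2
proof (intro conjI ballI)
  fix g assume "g \<in> groups"
  then show "Z g \<in> measurable Pr seqM"
    using measurable_compose[OF V_measurable fst_snd_measurable(3)]
    by (intro measurable_seqM) (auto simp: groups_def Z_def Phi_measurable)
next
  show "indep_sets (\<lambda>g. {Z g -` A \<inter> space Pr | A. A \<in> sets seqM}) groups"
    unfolding groups_def
  proof (rule indep_sets_mono_sets[OF indep], rule subsetI)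
    fix g E assume g: "g \<in> {GX, GH} \<union> GPhi ` {1..K} \<union> {GV j n | j n. j \<in> {1..K}}"
      and "E \<in> {Z g -` A \<inter> space Pr | A. A \<in> sets seqM}"
    then obtain A where A: "A \<in> sets seqM" and E: "E = Z g -` A \<inter> space Pr" by auto
    have 1: "Z g -` A \<inter> space Pr \<in> gen_sigma Pr f" if "Z g = (\<lambda>\<omega> _. (f \<omega>, 0))" for f
    proof -
      let ?N = "sigma (space Pr) {f -` A \<inter> space Pr | A. A \<in> sets borel}"
      note [measurable] = measurable_gen_sigma[of f]
      have "Z g \<in> measurable ?N seqM"
        unfolding that by (rule measurable_seqM) measurable
      from measurable_sets[OF this A] show ?thesis
        unfolding gen_sigma_def by (subst (asm) sets_measure_of) (auto simp: space_measure_of_conv)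
    qed
    have 2: "Z g -` A \<inter> space Pr \<in> gen_sigma_seq Pr f" if "Z g = (\<lambda>\<omega> n. f n \<omega>)" for f
    proof -
      let ?N = "sigma (space Pr) (\<Union>n. {f n -` A \<inter> space Pr | A. A \<in> sets borel})"
      have "f n \<in> measurable ?N borel" for n
        by (rule measurableI) (auto simp: space_measure_of_conv intro!: in_measure_of)
      then have "Z g \<in> measurable ?N seqM"
        unfolding that by (intro measurable_seqM)
      from measurable_sets[OF this A] show ?thesis
        unfolding gen_sigma_seq_def by (subst (asm) sets_measure_of) (auto simp: space_measure_of_conv)
    qed
    show "E \<in> (case g of GX \<Rightarrow> gen_sigma Pr Xs | GH \<Rightarrow> gen_sigma Pr H
                     | GPhi j \<Rightarrow> gen_sigma_seq Pr (Phi j) | GV j n \<Rightarrow> gen_sigma Pr (V j n))"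
      unfolding E using 1 2 by (cases g) (auto simp: Z_def fun_eq_iff)
  qed
qed

lemma measurable_component_seqM:
  assumes "g \<in> A"
  shows "(\<lambda>r. r g n) \<in> borel_measurable (PiM A (\<lambda>_. seqM))"
  using measurable_compose[OF measurable_component_singleton[OF assms] measurable_component_singleton[of n UNIV "\<lambda>_. borel"]]
  by simp

lemma measurable_component_fst:
  assumes "g \<in> A"
  shows "(\<lambda>r. fst (r g n)) \<in> borel_measurable (PiM A (\<lambda>_. seqM))"
  using measurable_compose[OF measurable_component_seqM[OF assms, of n] fst_snd_measurable(1)] .

lemma rho_measurable[measurable]: "rho j \<in> borel_measurable borel"
  unfolding rho_def by measurable

lemma Itier_measurable:
  assumes [measurable]: "x \<in> borel_measurable N" "\<And>n. (\<lambda>\<omega>. y \<omega> n) \<in> borel_measurable N" "\<And>n. (\<lambda>\<omega>. v \<omega> n) \<in> borel_measurable N"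
  shows "(\<lambda>\<omega>. Itier j (x \<omega>) (y \<omega>) (v \<omega>)) \<in> borel_measurable N"
  unfolding Itier_def by measurable

lemma indep_Phi_V:
  assumes j: "j \<in> {1..K}"
  shows "indep_var seqM (\<lambda>\<omega> n. Phi j n \<omega>) seqM (\<lambda>\<omega> n. (V j n \<omega>, 0))"
proof -
  have "indep_var (PiM {GPhi j} (\<lambda>_. seqM)) (\<lambda>\<omega>. restrict (\<lambda>g. Z g \<omega>) {GPhi j})
      (PiM (range (GV j)) (\<lambda>_. seqM)) (\<lambda>\<omega>. restrict (\<lambda>g. Z g \<omega>) (range (GV j)))"
    using j by (intro indep_var_restrict[OF indep_vars_Z]) (auto simp: groups_def)
  then have "indep_var seqM ((\<lambda>r. r (GPhi j)) \<circ> (\<lambda>\<omega>. restrict (\<lambda>g. Z g \<omega>) {GPhi j}))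
      seqM ((\<lambda>r n. (fst (r (GV j n) 0), 0)) \<circ> (\<lambda>\<omega>. restrict (\<lambda>g. Z g \<omega>) (range (GV j))))"
  proof (rule indep_var_compose)
    show "(\<lambda>r. r (GPhi j)) \<in> measurable (PiM {GPhi j} (\<lambda>_. seqM)) seqM"
      by (rule measurable_component_singleton) simp
    show "(\<lambda>r n. (fst (r (GV j n) 0), 0)) \<in> measurable (PiM (range (GV j)) (\<lambda>_. seqM)) seqM"
      by (intro measurable_seqM measurable_compose[OF measurable_component_fst fst_snd_measurable(3)]) simp
  qed
  then show ?thesis by (simp add: comp_def Z_def)
qed

lemma indep_V:
  assumes j: "j \<in> {1..K}"
  shows "indep_vars (\<lambda>_. borel) (V j) UNIV"
proof -
  have "indep_vars (\<lambda>n. PiM {GV j n} (\<lambda>_. seqM)) (\<lambda>n \<omega>. restrict (\<lambda>g. Z g \<omega>) {GV j n}) UNIV"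
    using j by (intro indep_vars_restrict[OF indep_vars_Z]) (auto simp: groups_def disjoint_family_on_def)
  then have "indep_vars (\<lambda>_. borel) (\<lambda>n \<omega>. fst (restrict (\<lambda>g. Z g \<omega>) {GV j n} (GV j n) 0)) UNIV"
    by (rule indep_vars_compose2) (intro measurable_component_fst, simp)
  then show ?thesis by (simp add: Z_def eta_contract_eq)
qed

section \<open>Positive intensities and the transform of the total interference\<close>

lemma assoc_sum_measurable[measurable]: "assoc_sum K lam P M B alpha j \<in> borel_measurable borel"
  unfolding assoc_sum_def by measurable

lemma assoc_sum_nonneg: "0 \<le> assoc_sum K lam P M B alpha j r"
  unfolding assoc_sum_def by (intro sum_nonneg) (auto simp: param less_imp_le)

text \<open>The association exponent increases with \<open>r\<close>, so on the interval the
  integrand is at least its value \<open>c\<close> at the right end, and the integral at least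
  \<open>c * Rj\<close>. Strict positivity of the intensity of tier \<open>k\<close> drives all
  later decay estimates.\<close>

lemma mu_pos:
  assumes j: "j \<in> {1..K}"
  shows "0 < mu j"
proof -
  define Rj where "Rj = (Rad P M B alpha eps j)\<^sup>2"
  define c where "c = exp (- pi * assoc_sum K lam P M B alpha j Rj)"
  have Rj: "0 < Rj" using param[OF j] eps by (simp add: Rj_def Rad_def)
  have le: "c \<le> exp (- pi * assoc_sum K lam P M B alpha j r)" if "r \<in> {0..Rj}" for r
  proof -
    have "assoc_sum K lam P M B alpha j r \<le> assoc_sum K lam P M B alpha j Rj"
      unfolding assoc_sum_def using that param j
      by (intro sum_mono mult_left_mono powr_mono2) (auto simp: less_imp_le)
    then show ?thesis by (simp add: c_def)
  qed
  have "c * Rj = (\<integral>r. c * indicator {0..Rj} r \<partial>lborel)"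
    using Rj by simp
  also have "\<dots> \<le> (\<integral>r. indicator {0..Rj} r * exp (- pi * assoc_sum K lam P M B alpha j r) \<partial>lborel)"
  proof (rule integral_mono)
    have i: "integrable lborel (indicator {0..Rj} :: real \<Rightarrow> real)"
      by (rule integrable_real_indicator) (auto simp: emeasure_lborel_Icc_eq)
    then show "integrable lborel (\<lambda>r. c * indicator {0..Rj} r)" by simp
    show "integrable lborel (\<lambda>r. indicator {0..Rj} r * exp (- pi * assoc_sum K lam P M B alpha j r))"
      using assoc_sum_nonneg by (intro Bochner_Integration.integrable_bound[OF i]) (auto intro!: AE_I2 split: split_indicator)
    show "c * indicator {0..Rj} r \<le> indicator {0..Rj} r * exp (- pi * assoc_sum K lam P M B alpha j r)" for r
      using le by (auto split: split_indicator)
  qed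
  finally have "0 < set_lebesgue_integral lborel {0..Rj} (\<lambda>r. exp (- pi * assoc_sum K lam P M B alpha j r))"
    using Rj by (simp add: set_lebesgue_integral_def c_def) (smt (verit) exp_gt_zero mult_pos_pos)
  then show ?thesis
    using param[OF j] lam_u unfolding activ_def Rj_def by (simp add: mult_less_0_iff)
qed

lemma tier:
  assumes j: "j \<in> {1..K}" and x: "0 < x"
  shows "AE \<omega> in Pr. 0 \<le> Itier j x (\<lambda>n. Phi j n \<omega>) (\<lambda>n. V j n \<omega>)"
    and "0 \<le> s \<Longrightarrow> expectation (\<lambda>\<omega>. exp (- s * Itier j x (\<lambda>n. Phi j n \<omega>) (\<lambda>n. V j n \<omega>)))
       = exp (- mu j * (pi * (rho j x)\<^sup>2 * psi (dl j) 0 (s * P j * rho j x powr (- alpha j))))"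
proof -
  note p = param[OF j]
  have "0 < rho j x" unfolding rho_def using x p(7) by (intro mult_pos_pos) (auto simp del: divide_eq_0_iff)
  note t = tier_interference[OF Phi_PPP[rule_format, OF j] less_imp_le[OF mu_pos[OF j]] V_dist[rule_format, OF j]
      indep_V[OF j] indep_Phi_V[OF j] this p(2) p(5), of "dl j"]
  show "AE \<omega> in Pr. 0 \<le> Itier j x (\<lambda>n. Phi j n \<omega>) (\<lambda>n. V j n \<omega>)"
    unfolding Itier_def using t(1) by (simp add: delta_def)
  show "expectation (\<lambda>\<omega>. exp (- s * Itier j x (\<lambda>n. Phi j n \<omega>) (\<lambda>n. V j n \<omega>)))
       = exp (- mu j * (pi * (rho j x)\<^sup>2 * psi (dl j) 0 (s * P j * rho j x powr (- alpha j))))" if "0 \<le> s"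
    unfolding Itier_def using t(2)[OF _ that] by (simp add: delta_def)
qed

lemma J_measurable[measurable]: "J x \<in> borel_measurable Pr"
  unfolding J_def
  by (intro borel_measurable_add borel_measurable_sum borel_measurable_const Itier_measurable V_measurable Phi_measurable)

lemma J_nonneg:
  assumes x: "0 < x"
  shows "AE \<omega> in Pr. 0 \<le> J x \<omega>"
proof -
  have "AE \<omega> in Pr. \<forall>j\<in>{1..K}. 0 \<le> Itier j x (\<lambda>n. Phi j n \<omega>) (\<lambda>n. V j n \<omega>)"
    using tier(1)[OF _ x] by (intro AE_finite_allI) auto
  then show ?thesis
    unfolding J_def by eventually_elim (use W in \<open>auto intro!: add_nonneg_nonneg sum_nonneg\<close>)
qed

text \<open>The tiers depend on disjoint blocks \<open>KK j\<close> of independent groups, each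
  block holding the points and the marks of one tier; so the transform factors and the exponents
  add.\<close>

lemma J_laplace:
  assumes x: "0 < x" and s: "0 \<le> s"
  shows "expectation (\<lambda>\<omega>. exp (- s * J x \<omega>))
     = exp (- s * W - pi * (\<Sum>j = 1..K. mu j * (rho j x)\<^sup>2 * psi (dl j) 0 (s * P j * rho j x powr (- alpha j))))"
proof -
  define T where "T j \<omega> = exp (- s * Itier j x (\<lambda>n. Phi j n \<omega>) (\<lambda>n. V j n \<omega>))" for j \<omega>
  define KK where "KK j = insert (GPhi j) (range (GV j))" for j
  have "indep_vars (\<lambda>j. PiM (KK j) (\<lambda>_. seqM)) (\<lambda>j \<omega>. restrict (\<lambda>g. Z g \<omega>) (KK j)) {1..K}"
    by (intro indep_vars_restrict[OF indep_vars_Z]) (auto simp: KK_def groups_def disjoint_family_on_def)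
  then have "indep_vars (\<lambda>_. borel) (\<lambda>j \<omega>. exp (- s * Itier j x (restrict (\<lambda>g. Z g \<omega>) (KK j) (GPhi j)) (\<lambda>n. fst (restrict (\<lambda>g. Z g \<omega>) (KK j) (GV j n) 0)))) {1..K}"
  proof (rule indep_vars_compose2)
    fix j
    have [measurable]: "(\<lambda>r. Itier j x (r (GPhi j)) (\<lambda>n. fst (r (GV j n) 0))) \<in> borel_measurable (PiM (KK j) (\<lambda>_. seqM))"
      by (intro Itier_measurable borel_measurable_const measurable_component_seqM measurable_component_fst) (auto simp: KK_def)
    show "(\<lambda>r. exp (- s * Itier j x (r (GPhi j)) (\<lambda>n. fst (r (GV j n) 0)))) \<in> borel_measurable (PiM (KK j) (\<lambda>_. seqM))"
      by measurable
  qed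
  moreover have "(\<lambda>j \<omega>. exp (- s * Itier j x (restrict (\<lambda>g. Z g \<omega>) (KK j) (GPhi j)) (\<lambda>n. fst (restrict (\<lambda>g. Z g \<omega>) (KK j) (GV j n) 0)))) = T"
    by (simp add: fun_eq_iff T_def KK_def Z_def)
  ultimately have ind: "indep_vars (\<lambda>_. borel) T {1..K}"
    by simp
  have Tm: "T j \<in> borel_measurable Pr" if "j \<in> {1..K}" for j
    using ind that by (auto simp: indep_vars_def)
  have Tint: "integrable Pr (T j)" if "j \<in> {1..K}" for j
  proof (rule integrable_const_bound[where B=1])
    show "AE \<omega> in Pr. norm (T j \<omega>) \<le> 1"
      using tier(1)[OF that x] unfolding T_def by eventually_elim (use s in simp)
  qed (rule Tm[OF that])
  have "expectation (\<lambda>\<omega>. exp (- s * J x \<omega>)) = expectation (\<lambda>\<omega>. exp (- s * W) * (\<Prod>j = 1..K. T j \<omega>))"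
    by (simp add: J_def T_def exp_sum[symmetric] exp_add[symmetric] sum_distrib_left sum_negf algebra_simps)
  also have "\<dots> = exp (- s * W) * (\<Prod>j = 1..K. expectation (T j))"
    using indep_vars_lebesgue_integral[OF _ ind Tint] by simp
  also have "\<dots> = exp (- s * W) * (\<Prod>j = 1..K. exp (- mu j * (pi * (rho j x)\<^sup>2 * psi (dl j) 0 (s * P j * rho j x powr (- alpha j)))))"
    unfolding T_def using tier(2)[OF _ x s] by simp
  also have "\<dots> = exp (- s * W - pi * (\<Sum>j = 1..K. mu j * (rho j x)\<^sup>2 * psi (dl j) 0 (s * P j * rho j x powr (- alpha j))))"
    by (subst exp_sum[symmetric], simp)
       (simp add: exp_add[symmetric] sum_distrib_left sum_negf mult_ac)
  finally show ?thesis .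
qed

lemma indep_J_H: "indep_var borel (J x) borel H"
proof -
  define A where "A = GPhi ` {1..K} \<union> {GV j n | j n. j \<in> {1..K}}"
  have "indep_var (PiM A (\<lambda>_. seqM)) (\<lambda>\<omega>. restrict (\<lambda>g. Z g \<omega>) A)
      (PiM {GH} (\<lambda>_. seqM)) (\<lambda>\<omega>. restrict (\<lambda>g. Z g \<omega>) {GH})"
    by (intro indep_var_restrict[OF indep_vars_Z]) (auto simp: groups_def A_def)
  then have "indep_var borel ((\<lambda>r. (\<Sum>j = 1..K. Itier j x (r (GPhi j)) (\<lambda>n. fst (r (GV j n) 0))) + W) \<circ> (\<lambda>\<omega>. restrict (\<lambda>g. Z g \<omega>) A))
      borel ((\<lambda>r. fst (r GH 0)) \<circ> (\<lambda>\<omega>. restrict (\<lambda>g. Z g \<omega>) {GH}))"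
    by (rule indep_var_compose)
       (intro borel_measurable_add borel_measurable_sum borel_measurable_const Itier_measurable
         measurable_component_seqM measurable_component_fst, auto simp: A_def)+
  moreover have "(\<lambda>r. (\<Sum>j = 1..K. Itier j x (r (GPhi j)) (\<lambda>n. fst (r (GV j n) 0))) + W) \<circ> (\<lambda>\<omega>. restrict (\<lambda>g. Z g \<omega>) A) = J x"
    by (auto simp: fun_eq_iff J_def A_def Z_def intro!: sum.cong)
  moreover have "(\<lambda>r. fst (r GH 0)) \<circ> (\<lambda>\<omega>. restrict (\<lambda>g. Z g \<omega>) {GH}) = H"
    by (auto simp: fun_eq_iff Z_def)
  ultimately show ?thesis by simp
qed

end

section \<open>Coverage probability\<close>

lemma nn_integral_finite_if_integrable_on:
  fixes f :: "real \<Rightarrow> real"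
  assumes "f integrable_on S" and [measurable]: "S \<in> sets borel" "f \<in> borel_measurable borel" and nonneg: "\<And>x. x \<in> S \<Longrightarrow> 0 \<le> f x"
  shows "(\<integral>\<^sup>+x\<in>S. ennreal (f x) \<partial>lborel) < \<infinity>"
proof -
  have "f absolutely_integrable_on S"
    using assms by (intro nonnegative_absolutely_integrable_1) auto
  then have "integrable lborel (\<lambda>x. indicator S x *\<^sub>R f x)"
    unfolding set_integrable_def by (subst (asm) integrable_completion) auto
  then have "(\<integral>\<^sup>+x. ennreal (indicator S x *\<^sub>R f x) \<partial>lborel) < \<infinity>"
    using nonneg by (subst nn_integral_eq_integral) (auto split: split_indicator)
  also have "(\<integral>\<^sup>+x. ennreal (indicator S x *\<^sub>R f x) \<partial>lborel) = (\<integral>\<^sup>+x\<in>S. ennreal (f x) \<partial>lborel)"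
    by (intro nn_integral_cong) (auto split: split_indicator)
  finally show ?thesis .
qed

text \<open>A deliberately weak bound: with the power 1/2 the resulting integrals, of
  \<open>r powr (- (1 / 2))\<close> near 0 and of \<open>\<beta> powr (- (dl k / 2) - 1)\<close> at
  infinity, both converge.\<close>

lemma exp_minus_le_powr:
  fixes y :: real
  assumes "0 < y"
  shows "exp (- y) \<le> y powr (- (1 / 2))"
proof -
  have "y powr (1 / 2) \<le> 1 + y"
  proof (cases "1 \<le> y")
    case True
    then have "y powr (1 / 2) \<le> y powr 1" by (intro powr_mono) auto
    then show ?thesis using assms by simp
  next
    case False
    then have "y powr (1 / 2) \<le> 1 powr (1 / 2)" using assms by (intro powr_mono2) auto
    then show ?thesis using assms by simp
  qed
  also have "\<dots> \<le> exp y" by (rule exp_ge_add_one_self)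
  finally have "y powr (1 / 2) \<le> exp y" .
  then have "inverse (exp y) \<le> inverse (y powr (1 / 2))"
    using assms by (intro le_imp_inverse_le) auto
  then show ?thesis by (simp add: exp_minus powr_minus)
qed

context network
begin

text \<open>This is \<open>gfun\<close> with the hypergeometric \<open>phi\<close> replaced by its
  integral form \<open>psi\<close>, from which sign and measurability are visible; the two agree for
  positive \<open>\<beta>\<close>. The argument \<open>r\<close> is the squared serving
  distance.\<close>

definition gg :: "nat \<Rightarrow> real \<Rightarrow> real \<Rightarrow> real" where
  "gg n r \<beta> = (\<Sum>j = 1..K. mu j * Om j powr dl j * psi (dl j) n (tau M B j k \<beta>) * r powr (dl j / dl k))"

text \<open>The constant coefficient is set to 0; \<open>gg 0\<close> enters through the exponential
  prefactor instead.\<close>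

definition GF :: "real \<Rightarrow> real \<Rightarrow> real fps" where
  "GF r \<beta> = Abs_fps (\<lambda>n. if n = 0 then 0 else gg n r \<beta>)"

definition FF :: "nat \<times> nat \<times> nat \<Rightarrow> real \<Rightarrow> real \<Rightarrow> real" where
  "FF = (\<lambda>(i, m, n) r \<beta>. pi ^ (i + 1) * (\<beta> * W / P k) ^ (m - n) / (fact (m - n) * fact i)
              * r powr (alpha k / 2 * real (m - n)) / (1 + \<beta>)
              * exp (- (\<beta> * W / P k) * r powr (alpha k / 2) - pi * gg 0 r \<beta> - pi * assoc_sum K lam P M B alpha k r)
              * fps_nth (GF r \<beta> ^ i) n)"

text \<open>Collecting the triples in one finite set lets a single sum pass through the double
  integral.\<close>

definition idx :: "(nat \<times> nat \<times> nat) set" where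
  "idx = (SIGMA i:{..<M k}. SIGMA m:{..<M k}. {..m})"

lemma finite_idx[simp]: "finite idx"
  unfolding idx_def by simp

lemma sum_idx: "(\<Sum>p\<in>idx. f p) = (\<Sum>i<M k. \<Sum>m<M k. \<Sum>n\<le>m. f (i, m, n))"
proof -
  have "(\<Sum>i<M k. \<Sum>m<M k. \<Sum>n\<le>m. f (i, m, n)) = (\<Sum>i<M k. \<Sum>(m, n)\<in>(SIGMA m:{..<M k}. {..m}). f (i, m, n))"
    by (intro sum.cong refl sum.Sigma) auto
  also have "\<dots> = (\<Sum>(i, q)\<in>idx. case q of (m, n) \<Rightarrow> f (i, m, n))"
    unfolding idx_def by (intro sum.Sigma) auto
  also have "\<dots> = (\<Sum>p\<in>idx. f p)"
    by (intro sum.cong refl) auto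
  finally show ?thesis by simp
qed

lemma tau_nonneg: "j \<in> {1..K} \<Longrightarrow> 0 \<le> \<beta> \<Longrightarrow> 0 \<le> tau M B j k \<beta>"
  using param(3,4) k by (auto simp: tau_def intro!: divide_nonneg_nonneg mult_nonneg_nonneg less_imp_le[OF param(4)])

lemma gg_nonneg: "0 \<le> \<beta> \<Longrightarrow> 0 \<le> gg n r \<beta>"
  unfolding gg_def
  by (intro sum_nonneg mult_nonneg_nonneg psi_nonneg tau_nonneg less_imp_le[OF mu_pos] less_imp_le[OF param(8)]) auto

lemma GF_nth_nonneg: "0 \<le> \<beta> \<Longrightarrow> 0 \<le> fps_nth (GF r \<beta> ^ i) n"
  by (intro fps_power_nth_nonneg) (auto simp: GF_def gg_nonneg)

lemma FF_nonneg: "0 \<le> \<beta> \<Longrightarrow> 0 \<le> FF p r \<beta>"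
  using W param(2)[OF k] by (cases p) (auto simp: FF_def intro!: mult_nonneg_nonneg divide_nonneg_nonneg GF_nth_nonneg)

lemma FF_measurable: "(\<lambda>(r, \<beta>). FF p r \<beta>) \<in> borel_measurable (borel \<Otimes>\<^sub>M borel)"
proof -
  obtain i m n where p: "p = (i, m, n)" by (cases p)
  have [measurable]: "(\<lambda>x. gg n (fst x) (snd x)) \<in> borel_measurable (borel \<Otimes>\<^sub>M borel)" for n
    unfolding gg_def tau_def by measurable
  have [measurable]: "(\<lambda>x. fps_nth (GF (fst x) (snd x) ^ i) n) \<in> borel_measurable (borel \<Otimes>\<^sub>M borel)"
    by (rule borel_measurable_fps_power_nth) (simp add: GF_def)
  show ?thesis
    unfolding p FF_def split_beta by simp
qed

section \<open>Scaling identities at the edge of the exclusion disk\<close>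

lemma dl_ratio: "j \<in> {1..K} \<Longrightarrow> dl j / dl k = alpha k / alpha j"
  using param(5) k by (simp add: delta_def)

lemma rho_sq:
  assumes j: "j \<in> {1..K}" and x: "0 < x"
  shows "(rho j x)\<^sup>2 = Om j powr dl j * (x\<^sup>2) powr (dl j / dl k)"
proof -
  have "(x\<^sup>2) powr (dl j / dl k) = x powr (2 * (alpha k / alpha j))"
    using x dl_ratio[OF j] by (simp add: powr_powr flip: powr_numeral)
  moreover have "(a powr (1 / alpha j))\<^sup>2 = a powr dl j" if "0 < a" for a
    using that by (simp add: powr_power delta_def)
  from this[OF param(7)[OF j]]
  have "(Om j powr (1 / alpha j))\<^sup>2 = Om j powr dl j" .
  moreover have "(x powr (alpha k / alpha j))\<^sup>2 = x powr (2 * (alpha k / alpha j))"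
    using x by (simp add: powr_power mult.commute)
  ultimately show ?thesis
    by (simp only: rho_def power_mult_distrib)
qed

text \<open>At radius \<open>rho j x\<close> the biased powers of tiers \<open>j\<close> and
  \<open>k\<close> balance, so dividing the received power by the useful one leaves only the antenna
  and bias ratios: the distance cancels.\<close>

lemma theta_tau:
  assumes j: "j \<in> {1..K}" and x: "0 < x"
  shows "\<beta> * x powr alpha k / P k * P j * rho j x powr (- alpha j) = tau M B j k \<beta>"
proof -
  have "rho j x powr (- alpha j) = Om j powr (- 1) * x powr (- alpha k)"
    using x param(5,7)[OF j] by (simp add: rho_def powr_mult powr_powr)
  also have "\<dots> = 1 / (Om j * x powr alpha k)"
  proof -
    have "a powr (- 1) = 1 / a" if "0 < a" for a :: real
      using that by (simp add: powr_minus_divide)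
    from this[OF param(7)[OF j]] show ?thesis
      by (simp only: powr_minus_divide[of x]) simp
  qed
  finally have "\<beta> * x powr alpha k / P k * P j * rho j x powr (- alpha j) = \<beta> / P k * P j / Om j"
    using x by (simp add: field_simps)
  also have "\<dots> = tau M B j k \<beta>"
    using param[OF j] param[OF k] by (simp add: Omega_def tau_def field_simps)
  finally show ?thesis .
qed

text \<open>Uniqueness of expansions equates the Erlang terms with the Cauchy product of an
  interference and a noise factor: \<open>n\<close> is the degree taken from the interference and
  \<open>m - n\<close> the degree taken from the noise.\<close>

lemma coverage:
  assumes x: "0 < x" and \<beta>: "0 < \<beta>"
  shows "(\<Sum>p\<in>idx. FF p (x\<^sup>2) \<beta>) = pi * exp (- pi * assoc_sum K lam P M B alpha k (x\<^sup>2))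
     * (prob {\<omega> \<in> space Pr. \<beta> / (P k * x powr (- alpha k)) * J x \<omega> < H \<omega>} / (1 + \<beta>))"
proof -
  define r where "r = x\<^sup>2"
  define th where "th = \<beta> * x powr alpha k / P k"
  have th: "0 < th" using x \<beta> param[OF k] by (simp add: th_def)
  have th_eq: "\<beta> / (P k * x powr (- alpha k)) = th"
    by (simp add: th_def powr_minus field_simps)
  define C where "C = exp (- th * W - pi * gg 0 r \<beta>)"
  define E where "E m = expectation (\<lambda>\<omega>. (th * J x \<omega>) ^ m / fact m * exp (- th * J x \<omega>))" for m
  define D where "D n = (\<Sum>i\<le>n. pi ^ i / fact i * fps_nth (GF r \<beta> ^ i) n)" for n
  have thW: "th * W = \<beta> * W / P k * r powr (alpha k / 2)"
    using x by (simp add: th_def r_def powr_powr flip: powr_numeral)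
  define g where "g z = (\<Sum>j = 1..K. (mu j * (rho j x)\<^sup>2) * (psi (dl j) 0 (tau M B j k \<beta>) - psi (dl j) 0 (tau M B j k \<beta> * (1 - z))))" for z
  have g: "g has_fps_expansion GF r \<beta>"
  proof -
    have "g has_fps_expansion (\<Sum>j = 1..K. fps_const (mu j * (rho j x)\<^sup>2) * Abs_fps (\<lambda>n. if n = 0 then 0 else psi (dl j) n (tau M B j k \<beta>)))"
      unfolding g_def using \<beta>
      by (intro has_fps_expansion_sum has_fps_expansion_cmult_left psi_has_fps_expansion param tau_nonneg) auto
    also have "(\<Sum>j = 1..K. fps_const (mu j * (rho j x)\<^sup>2) * Abs_fps (\<lambda>n. if n = 0 then 0 else psi (dl j) n (tau M B j k \<beta>))) = GF r \<beta>"
    proof (rule fps_ext)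
      fix n
      have "(\<Sum>j = 1..K. mu j * (rho j x)\<^sup>2 * psi (dl j) n (tau M B j k \<beta>)) = gg n r \<beta>"
        unfolding gg_def by (intro sum.cong refl) (simp add: rho_sq[OF _ x] r_def mult_ac)
      then show "fps_nth (\<Sum>j = 1..K. fps_const (mu j * (rho j x)\<^sup>2) * Abs_fps (\<lambda>n. if n = 0 then 0 else psi (dl j) n (tau M B j k \<beta>))) n = fps_nth (GF r \<beta>) n"
        by (simp add: GF_def fps_sum_nth)
    qed
    finally show ?thesis .
  qed
  have e1: "(\<lambda>z. expectation (\<lambda>\<omega>. exp (- (th * (1 - z)) * J x \<omega>))) has_fps_expansion Abs_fps E"
    unfolding E_def using th J_nonneg[OF x] by (intro laplace_has_fps_expansion) auto
  have e2: "(\<lambda>z. C * (exp (pi * g z) * exp (th * W * z))) has_fps_expansion fps_const C * (Abs_fps D * fps_exp (th * W))"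
    unfolding D_def using \<beta> GF_nth_nonneg[of \<beta> r 1]
    by (intro has_fps_expansion_cmult_left has_fps_expansion_mult has_fps_expansion_exp has_fps_expansion_exp_compose g)
       (auto simp: GF_def)
  have ev: "eventually (\<lambda>z. expectation (\<lambda>\<omega>. exp (- (th * (1 - z)) * J x \<omega>)) = C * (exp (pi * g z) * exp (th * W * z))) (nhds 0)"
  proof -
    have "eventually (\<lambda>z. z \<in> ball 0 1) (nhds (0::real))"
      by (intro eventually_nhds_in_open) auto
    then show ?thesis
    proof eventually_elim
      fix z :: real assume "z \<in> ball 0 1"
      \<comment> \<open>For \<open>z < 1\<close> the argument \<open>th * (1 - z)\<close> is
        nonnegative, as \<open>J_laplace\<close> requires; replacing \<open>th\<close> by it
        multiplies every \<open>tau\<close> by \<open>1 - z\<close>.\<close>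
      then have z: "z < 1" by simp
      have tz: "th * (1 - z) * P j * rho j x powr (- alpha j) = tau M B j k \<beta> * (1 - z)" if "j \<in> {1..K}" for j
        unfolding theta_tau[OF that x, of \<beta>, symmetric] th_def by (simp only: mult_ac)
      have "expectation (\<lambda>\<omega>. exp (- (th * (1 - z)) * J x \<omega>))
        = exp (- (th * (1 - z)) * W - pi * (\<Sum>j = 1..K. mu j * (rho j x)\<^sup>2 * psi (dl j) 0 (tau M B j k \<beta> * (1 - z))))"
        using th z by (subst J_laplace[OF x]) (auto simp: tz)
      also have "(\<Sum>j = 1..K. mu j * (rho j x)\<^sup>2 * psi (dl j) 0 (tau M B j k \<beta> * (1 - z))) = gg 0 r \<beta> - g z"
        unfolding gg_def g_def sum_subtractf[symmetric]
        by (intro sum.cong refl) (simp add: rho_sq[OF _ x] r_def algebra_simps)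
      also have "exp (- (th * (1 - z)) * W - pi * (gg 0 r \<beta> - g z)) = C * (exp (pi * g z) * exp (th * W * z))"
        unfolding C_def exp_add[symmetric] by (simp add: algebra_simps)
      finally show "expectation (\<lambda>\<omega>. exp (- (th * (1 - z)) * J x \<omega>)) = C * (exp (pi * g z) * exp (th * W * z))" .
    qed
  qed
  from e1 have "(\<lambda>z. C * (exp (pi * g z) * exp (th * W * z))) has_fps_expansion Abs_fps E"
    by (rule has_fps_expansion_cong[OF ev refl, THEN iffD1])
  then have "Abs_fps E = fps_const C * (Abs_fps D * fps_exp (th * W))"
    using e2 by (rule has_fps_expansion_unique)
  from arg_cong[OF this, of fps_nth]
  have E: "E m = C * (\<Sum>n\<le>m. D n * ((th * W) ^ (m - n) / fact (m - n)))" for m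
    unfolding fun_eq_iff fps_mult_left_const_nth fps_mult_nth[of "Abs_fps D"] by (simp add: atLeast0AtMost)
  \<comment> \<open>The terms with \<open>i > n\<close> vanish, so the range of \<open>i\<close> can
    be enlarged to one that does not depend on \<open>n\<close>.\<close>
  have D: "D n = (\<Sum>i<M k. pi ^ i / fact i * fps_nth (GF r \<beta> ^ i) n)" if "n < M k" for n
    unfolding D_def using that
    by (intro sum.mono_neutral_left) (auto simp: fps_power_nth_eq_0 GF_def)
  have "prob {\<omega> \<in> space Pr. th * J x \<omega> < H \<omega>} = (\<Sum>m\<le>M k - 1. E m)"
    unfolding E_def using th by (intro erlang_tail_laplace[OF H_dist indep_J_H J_nonneg[OF x]]) auto
  \<comment> \<open>Erlang shape \<open>M k - 1\<close> is the Gamma law with parameter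
    \<open>M k\<close>; the change of range uses \<open>M k \<ge> 1\<close>.\<close>
  also have "{..M k - 1} = {..<M k}"
    using param(3)[OF k] by auto
  also have "(\<Sum>m<M k. E m) = (\<Sum>m<M k. \<Sum>n\<le>m. \<Sum>i<M k. C * (pi ^ i / fact i * fps_nth (GF r \<beta> ^ i) n * ((th * W) ^ (m - n) / fact (m - n))))"
    unfolding E by (intro sum.cong refl) (simp only: sum_distrib_left sum_distrib_right, intro sum.cong refl, simp only: D sum_distrib_left sum_distrib_right atMost_iff lessThan_iff le_less_trans)
  finally have "prob {\<omega> \<in> space Pr. th * J x \<omega> < H \<omega>}
      = (\<Sum>m<M k. \<Sum>n\<le>m. \<Sum>i<M k. C * (pi ^ i / fact i * fps_nth (GF r \<beta> ^ i) n * ((th * W) ^ (m - n) / fact (m - n))))"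
    .
  also have "\<dots> = (\<Sum>m<M k. \<Sum>i<M k. \<Sum>n\<le>m. C * (pi ^ i / fact i * fps_nth (GF r \<beta> ^ i) n * ((th * W) ^ (m - n) / fact (m - n))))"
    by (intro sum.cong refl sum.swap)
  also have "\<dots> = (\<Sum>i<M k. \<Sum>m<M k. \<Sum>n\<le>m. C * (pi ^ i / fact i * fps_nth (GF r \<beta> ^ i) n * ((th * W) ^ (m - n) / fact (m - n))))"
    by (rule sum.swap)
  finally have pr: "prob {\<omega> \<in> space Pr. th * J x \<omega> < H \<omega>}
      = (\<Sum>p\<in>idx. case p of (i, m, n) \<Rightarrow> C * (pi ^ i / fact i * fps_nth (GF r \<beta> ^ i) n * ((th * W) ^ (m - n) / fact (m - n))))"
    by (simp add: sum_idx)
  define q where "q = pi * exp (- pi * assoc_sum K lam P M B alpha k r) / (1 + \<beta>)"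
  have "FF p r \<beta> = q * (case p of (i, m, n) \<Rightarrow> C * (pi ^ i / fact i * fps_nth (GF r \<beta> ^ i) n * ((th * W) ^ (m - n) / fact (m - n))))" for p
  proof -
    obtain i m n where p: "p = (i, m, n)" by (cases p)
    have pw: "(th * W) ^ (m - n) = (\<beta> * W / P k) ^ (m - n) * r powr (alpha k / 2 * real (m - n))"
    proof -
      have "(r powr (alpha k / 2)) ^ (m - n) = r powr (alpha k / 2 * real (m - n))"
        using x by (simp add: powr_power r_def mult.commute)
      then show ?thesis by (simp only: thW power_mult_distrib)
    qed
    have "exp (- (\<beta> * W / P k) * r powr (alpha k / 2) - pi * gg 0 r \<beta> - pi * assoc_sum K lam P M B alpha k r)
      = exp ((- th * W - pi * gg 0 r \<beta>) + (- pi * assoc_sum K lam P M B alpha k r))"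
      using thW by (intro arg_cong[where f=exp]) simp
    then have ex: "exp (- (\<beta> * W / P k) * r powr (alpha k / 2) - pi * gg 0 r \<beta> - pi * assoc_sum K lam P M B alpha k r)
      = C * exp (- pi * assoc_sum K lam P M B alpha k r)"
      by (simp only: C_def exp_add)
    have alg: "pi ^ (i + 1) * a / (f1 * f2) * b / (1 + \<beta>) * (C * e) * c
      = pi * e / (1 + \<beta>) * (C * (pi ^ i / f2 * c * (a * b / f1)))" for a b c e f1 f2 :: real
      by (simp add: mult_ac)
    show ?thesis
      unfolding p FF_def split_conv pw ex q_def by (rule alg)
  qed
  then have "(\<Sum>p\<in>idx. FF p r \<beta>) = q * prob {\<omega> \<in> space Pr. th * J x \<omega> < H \<omega>}"
    unfolding pr by (simp add: sum_distrib_left)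
  then show ?thesis
    unfolding th_eq r_def q_def by simp
qed

text \<open>All terms of the exponent have one sign, so it suffices to keep tier \<open>k\<close>:
  there the exclusion radius is \<open>x\<close> and \<open>tau\<close> is \<open>t\<close> itself,
  and the lower bound for \<open>psi\<close> applies.\<close>

lemma laplace_bound:
  assumes x: "0 < x" and t: "1 \<le> t"
  shows "expectation (\<lambda>\<omega>. exp (- (t * x powr alpha k / P k) * J x \<omega>)) \<le> exp (- (pi * mu k * dl k / 2) * x\<^sup>2 * t powr dl k)"
proof -
  define s where "s = t * x powr alpha k / P k"
  have s: "0 \<le> s" using t x param[OF k] by (simp add: s_def)
  have pos: "0 \<le> mu j * (rho j x)\<^sup>2 * psi (dl j) 0 (tau M B j k t)" if "j \<in> {1..K}" for j
    using that t by (intro mult_nonneg_nonneg psi_nonneg tau_nonneg less_imp_le[OF mu_pos] less_imp_le[OF param(8)]) auto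
  have rk: "(rho k x)\<^sup>2 = x\<^sup>2"
    using x param(5,6)[OF k] by (simp add: rho_def)
  have tk: "tau M B k k t = t"
    using param(3,4)[OF k] by (simp add: tau_def)
  have "dl k * t powr dl k / 2 \<le> psi (dl k) 0 t"
    using t by (intro psi_0_lower_bound param k)
  then have "mu k * x\<^sup>2 * (dl k * t powr dl k / 2) \<le> mu k * (rho k x)\<^sup>2 * psi (dl k) 0 (tau M B k k t)"
    unfolding rk tk using mu_pos[OF k] by (intro mult_left_mono) auto
  also have "\<dots> \<le> (\<Sum>j = 1..K. mu j * (rho j x)\<^sup>2 * psi (dl j) 0 (tau M B j k t))"
    using k pos by (intro member_le_sum) auto
  also have "\<dots> = (\<Sum>j = 1..K. mu j * (rho j x)\<^sup>2 * psi (dl j) 0 (s * P j * rho j x powr (- alpha j)))"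
    unfolding s_def by (intro sum.cong refl) (simp only: theta_tau[OF _ x])
  finally have "pi * (mu k * x\<^sup>2 * (dl k * t powr dl k / 2)) \<le> pi * (\<Sum>j = 1..K. mu j * (rho j x)\<^sup>2 * psi (dl j) 0 (s * P j * rho j x powr (- alpha j)))"
    by (rule mult_left_mono) simp
  moreover have "0 \<le> s * W" using s W by simp
  moreover have "(pi * mu k * dl k / 2) * x\<^sup>2 * t powr dl k = pi * (mu k * x\<^sup>2 * (dl k * t powr dl k / 2))"
    by (simp only: times_divide_eq_left times_divide_eq_right mult_ac)
  ultimately show ?thesis
    unfolding s_def[symmetric] J_laplace[OF x s] exp_le_cancel_iff by linarith
qed

text \<open>With zero noise, positivity must come from the interference: the transform tends to 0 as
  its argument grows, and it dominates the probability that \<open>J x\<close> is at most 0. This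
  rules out a division by zero in the rate.\<close>

lemma J_pos:
  assumes x: "0 < x"
  shows "AE \<omega> in Pr. 0 < J x \<omega>"
proof -
  define A where "A = (pi * mu k * dl k / 2) * x\<^sup>2"
  have A: "0 < A" using x mu_pos[OF k] param(8)[OF k] by (simp add: A_def)
  have le: "prob {\<omega> \<in> space Pr. J x \<omega> \<le> 0} \<le> exp (- A) ^ n" if n: "1 \<le> n" for n
  proof -
    \<comment> \<open>Chosen so that \<open>t powr dl k\<close> is the integer \<open>n\<close>,
      which makes the bound a geometric sequence.\<close>
    define t where "t = real n powr (1 / dl k)"
    have t: "1 \<le> t" using n param(8)[OF k] by (auto simp: t_def intro!: ge_one_powr_ge_zero)
    have td: "t powr dl k = real n" using n param(8)[OF k] by (simp add: t_def powr_powr)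
    define s where "s = t * x powr alpha k / P k"
    have s: "0 \<le> s" using t x param[OF k] by (simp add: s_def)
    have "prob {\<omega> \<in> space Pr. J x \<omega> \<le> 0} = expectation (indicator {\<omega> \<in> space Pr. J x \<omega> \<le> 0})"
      by simp
    also have "\<dots> \<le> expectation (\<lambda>\<omega>. exp (- s * J x \<omega>))"
    proof (rule integral_mono_AE)
      have "AE \<omega> in Pr. norm (exp (- s * J x \<omega>)) \<le> 1"
        using J_nonneg[OF x] by eventually_elim (use s in simp)
      then show "integrable Pr (\<lambda>\<omega>. exp (- s * J x \<omega>))"
        by (intro integrable_const_bound[where B=1]) auto
      show "AE \<omega> in Pr. indicator {\<omega> \<in> space Pr. J x \<omega> \<le> 0} \<omega> \<le> exp (- s * J x \<omega>)"
        using J_nonneg[OF x] by eventually_elim (use s in \<open>auto split: split_indicator\<close>)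
    qed (auto simp: emeasure_eq_measure)
    also have "\<dots> \<le> exp (- A * real n)"
      using laplace_bound[OF x t] unfolding s_def A_def td by simp
    also have "\<dots> = exp (- A) ^ n" using exp_of_nat_mult[of n "- A"] by (simp add: mult.commute)
    finally show ?thesis .
  qed
  have "(\<lambda>n. exp (- A) ^ n) \<longlonglongrightarrow> 0"
    using A by (intro LIMSEQ_realpow_zero) auto
  then have "prob {\<omega> \<in> space Pr. J x \<omega> \<le> 0} \<le> 0"
    by (rule tendsto_lowerbound) (auto intro!: eventually_sequentiallyI[of 1] le)
  then have "prob {\<omega> \<in> space Pr. J x \<omega> \<le> 0} = 0"
    using measure_nonneg[of Pr] by (intro antisym) auto
  then have "AE \<omega> in Pr. \<not> (J x \<omega> \<le> 0)"
    by (subst (asm) prob_Collect_eq_0) auto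
  then show ?thesis by eventually_elim simp
qed

text \<open>The moment bound halves the argument of the transform, hence \<open>\<beta> / 2\<close>;
  \<open>laplace_bound\<close> needs this to be at least 1, which is the origin of the threshold
  2.\<close>

lemma coverage_bound:
  assumes x: "0 < x" and \<beta>: "2 \<le> \<beta>"
  shows "prob {\<omega> \<in> space Pr. \<beta> / (P k * x powr (- alpha k)) * J x \<omega> < H \<omega>}
     \<le> (\<Sum>m\<le>M k - 1. 2 ^ m) * exp (- (pi * mu k * dl k / 2) * x\<^sup>2 * (\<beta> / 2) powr dl k)"
proof -
  define th where "th = \<beta> / (P k * x powr (- alpha k))"
  have th: "0 \<le> th" using \<beta> param(2)[OF k] by (simp add: th_def)
  have th2: "th / 2 = (\<beta> / 2) * x powr alpha k / P k"
    by (simp add: th_def powr_minus field_simps)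
  have "prob {\<omega> \<in> space Pr. th * J x \<omega> < H \<omega>} = (\<Sum>m\<le>M k - 1. expectation (\<lambda>\<omega>. (th * J x \<omega>) ^ m / fact m * exp (- th * J x \<omega>)))"
    by (rule erlang_tail_laplace[OF H_dist indep_J_H J_nonneg[OF x] th])
  also have "\<dots> \<le> (\<Sum>m\<le>M k - 1. 2 ^ m * expectation (\<lambda>\<omega>. exp (- (th / 2) * J x \<omega>)))"
    by (intro sum_mono laplace_moment_le[OF H_dist indep_J_H J_nonneg[OF x] th])
  also have "\<dots> = (\<Sum>m\<le>M k - 1. 2 ^ m) * expectation (\<lambda>\<omega>. exp (- (th / 2) * J x \<omega>))"
    by (simp add: sum_distrib_right)
  also have "\<dots> \<le> (\<Sum>m\<le>M k - 1. 2 ^ m) * exp (- (pi * mu k * dl k / 2) * x\<^sup>2 * (\<beta> / 2) powr dl k)"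
    unfolding th2 using \<beta> by (intro mult_left_mono laplace_bound[OF x] sum_nonneg) auto
  finally show ?thesis unfolding th_def .
qed

end

section \<open>Average rate\<close>

context network
begin

text \<open>Conditioning on the serving distance: \<open>Xs\<close> uses the group \<open>GX\<close>
  and everything else the remaining groups, so the distance may be frozen while the rest is
  integrated. The random parameter inside \<open>J\<close> is handled by writing the integrand as
  one measurable function \<open>F\<close> of both blocks.\<close>

lemma nn_integral_serving_distance:
  fixes g :: "real \<Rightarrow> real \<Rightarrow> real \<Rightarrow> ennreal"
  assumes g: "(\<lambda>(x, h, y). g x h y) \<in> borel_measurable (borel \<Otimes>\<^sub>M borel \<Otimes>\<^sub>M borel)"
  shows "(\<integral>\<^sup>+\<omega>. g (Xs \<omega>) (H \<omega>) (J (Xs \<omega>) \<omega>) \<partial>Pr) = (\<integral>\<^sup>+\<omega>. (\<integral>\<^sup>+\<omega>'. g (Xs \<omega>) (H \<omega>') (J (Xs \<omega>) \<omega>') \<partial>Pr) \<partial>Pr)"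
proof -
  define A where "A = insert GH (GPhi ` {1..K} \<union> {GV j n | j n. j \<in> {1..K}})"
  let ?X = "\<lambda>\<omega>. restrict (\<lambda>g. Z g \<omega>) {GX}"
  let ?Y = "\<lambda>\<omega>. restrict (\<lambda>g. Z g \<omega>) A"
  let ?S = "PiM {GX} (\<lambda>_. seqM)" and ?T = "PiM A (\<lambda>_. seqM)"
  define F where "F p = g (fst (fst p GX 0)) (fst (snd p GH 0))
      ((\<Sum>j = 1..K. Itier j (fst (fst p GX 0)) (snd p (GPhi j)) (\<lambda>n. fst (snd p (GV j n) 0))) + W)"
    for p :: "(rvgroup \<Rightarrow> nat \<Rightarrow> real \<times> real) \<times> (rvgroup \<Rightarrow> nat \<Rightarrow> real \<times> real)"
  have ind: "indep_var ?S ?X ?T ?Y"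
    by (intro indep_var_restrict[OF indep_vars_Z]) (auto simp: groups_def A_def)
  have [measurable]: "(\<lambda>p. fst (fst p GX 0)) \<in> borel_measurable (?S \<Otimes>\<^sub>M ?T)"
    by (rule measurable_compose[OF measurable_fst measurable_component_fst]) simp
  have [measurable]: "(\<lambda>p. fst (snd p GH 0)) \<in> borel_measurable (?S \<Otimes>\<^sub>M ?T)"
    by (rule measurable_compose[OF measurable_snd measurable_component_fst]) (simp add: A_def)
  have [measurable]: "(\<lambda>p. Itier j (fst (fst p GX 0)) (snd p (GPhi j)) (\<lambda>n. fst (snd p (GV j n) 0))) \<in> borel_measurable (?S \<Otimes>\<^sub>M ?T)"
    if j: "j \<in> {1..K}" for j
  proof (rule Itier_measurable)
    show "(\<lambda>p. snd p (GPhi j) n) \<in> borel_measurable (?S \<Otimes>\<^sub>M ?T)" for n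
      by (rule measurable_compose[OF measurable_snd measurable_component_seqM]) (use j in \<open>auto simp: A_def\<close>)
    show "(\<lambda>p. fst (snd p (GV j n) 0)) \<in> borel_measurable (?S \<Otimes>\<^sub>M ?T)" for n
      by (rule measurable_compose[OF measurable_snd measurable_component_fst]) (use j in \<open>auto simp: A_def\<close>)
  qed measurable
  have "(\<lambda>p. (fst (fst p GX 0), fst (snd p GH 0),
      (\<Sum>j = 1..K. Itier j (fst (fst p GX 0)) (snd p (GPhi j)) (\<lambda>n. fst (snd p (GV j n) 0))) + W)) \<in> measurable (?S \<Otimes>\<^sub>M ?T) (borel \<Otimes>\<^sub>M borel \<Otimes>\<^sub>M borel)"
    by measurable
  from measurable_compose[OF this g] have Fm: "F \<in> borel_measurable (?S \<Otimes>\<^sub>M ?T)"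
    by (simp add: F_def[abs_def])
  have J_eq: "(\<Sum>j = 1..K. Itier j x (?Y \<omega> (GPhi j)) (\<lambda>n. fst (?Y \<omega> (GV j n) 0))) + W = J x \<omega>" for x \<omega>
    by (auto simp: J_def A_def Z_def intro!: sum.cong)
  have F_eq: "F (?X \<omega>, ?Y \<omega>') = g (Xs \<omega>) (H \<omega>') (J (Xs \<omega>) \<omega>')" for \<omega> \<omega>'
    unfolding F_def fst_conv snd_conv J_eq by (simp add: A_def Z_def)
  show ?thesis
    using nn_integral_indep_var[OF ind Fm] unfolding F_eq .
qed

lemma J_measurable_pair[measurable]: "(\<lambda>(x, \<omega>). J x \<omega>) \<in> borel_measurable (borel \<Otimes>\<^sub>M Pr)"
  unfolding J_def split_beta
  by (intro borel_measurable_add borel_measurable_sum borel_measurable_const Itier_measurable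
      measurable_compose[OF measurable_snd V_measurable] measurable_compose[OF measurable_snd Phi_measurable])
     measurable

lemma R_pos: "0 < R"
  using param(6)[OF k] eps by (simp add: Rad_def)

lemma assocT_pos: "0 < assocT K lam P M B alpha eps k"
proof -
  have "0 < activ K lam P M B alpha eps lam_u k"
    using mu_pos[OF k] param(1)[OF k] by (simp add: zero_less_mult_iff)
  then have "0 < lam_u * set_lebesgue_integral lborel {0..R\<^sup>2} (\<lambda>r. exp (- pi * assoc_sum K lam P M B alpha k r))"
    unfolding activ_def by (simp add: mult_less_0_iff zero_less_mult_iff)
  then have "0 < set_lebesgue_integral lborel {0..R\<^sup>2} (\<lambda>r. exp (- pi * assoc_sum K lam P M B alpha k r))"
    using lam_u by (simp add: zero_less_mult_iff)
  then show ?thesis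
    unfolding assocT_def using param(1)[OF k] by simp
qed

section \<open>From the coverage probability to the mean rate\<close>

lemma TT_measurable[measurable]: "(\<lambda>(r, \<beta>). \<Sum>p\<in>idx. FF p r \<beta>) \<in> borel_measurable (borel \<Otimes>\<^sub>M borel)"
  using FF_measurable unfolding split_beta by (intro borel_measurable_sum) auto

definition cst :: real where
  "cst = 1 / ln 2 * (lam k / assocT K lam P M B alpha eps k)"

lemma cst_pos: "0 < cst"
  using assocT_pos param(1)[OF k] by (simp add: cst_def)

definition rate :: "'a \<Rightarrow> real" where
  "rate \<omega> = log 2 (1 + P k * H \<omega> * Xs \<omega> powr (- alpha k) / J (Xs \<omega>) \<omega>)"

lemma rate_measurable: "rate \<in> borel_measurable Pr"
proof -
  have "(\<lambda>\<omega>. J (Xs \<omega>) \<omega>) \<in> borel_measurable Pr"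
    using measurable_compose[OF _ J_measurable_pair, of "\<lambda>\<omega>. (Xs \<omega>, \<omega>)" Pr] by simp
  then show ?thesis unfolding rate_def by measurable
qed

lemma X_pos: "AE \<omega> in Pr. 0 < Xs \<omega>"
proof -
  have "(AE \<omega> in Pr. 0 < Xs \<omega>) \<longleftrightarrow> (AE x in lborel. 0 < ennreal (if 0 < x \<and> x \<le> R
           then 2 * pi * lam k / assocT K lam P M B alpha eps k * x
                * exp (- pi * (\<Sum>j = 1..K. lam j * (Omega P M B j / Omega P M B k) powr delta alpha j
                                   * x powr (2 * (delta alpha j / delta alpha k))))
           else 0) \<longrightarrow> 0 < x)"
    by (rule distributed_AE2[OF X_dist]) measurable
  then show ?thesis
    by (auto intro!: AE_I2)
qed

lemma H_pos: "AE \<omega> in Pr. 0 < H \<omega>"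
  by (rule erlang_AE_pos[OF H_dist])

text \<open>Positivity of \<open>J x\<close> holds almost surely for each fixed \<open>x\<close>,
  with an exceptional set that depends on \<open>x\<close>. To insert the random distance, the
  negative part of the rate is integrated by conditioning and found to be 0.\<close>

lemma rate_nonneg: "AE \<omega> in Pr. 0 \<le> rate \<omega>"
proof -
  have "(\<integral>\<^sup>+\<omega>. ennreal (- rate \<omega>) \<partial>Pr) = (\<integral>\<^sup>+\<omega>. (\<integral>\<^sup>+\<omega>'. ennreal (- log 2 (1 + P k * H \<omega>' * Xs \<omega> powr (- alpha k) / J (Xs \<omega>) \<omega>')) \<partial>Pr) \<partial>Pr)"
    unfolding rate_def
    by (rule nn_integral_serving_distance[where g="\<lambda>x h y. ennreal (- log 2 (1 + P k * h * x powr (- alpha k) / y))"]) measurable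
  also have "\<dots> = (\<integral>\<^sup>+\<omega>. 0 \<partial>Pr)"
  proof (intro nn_integral_cong_AE)
    show "AE \<omega> in Pr. (\<integral>\<^sup>+\<omega>'. ennreal (- log 2 (1 + P k * H \<omega>' * Xs \<omega> powr (- alpha k) / J (Xs \<omega>) \<omega>')) \<partial>Pr) = 0"
      using X_pos
    proof eventually_elim
      fix \<omega> assume x: "0 < Xs \<omega>"
      have "AE \<omega>' in Pr. ennreal (- log 2 (1 + P k * H \<omega>' * Xs \<omega> powr (- alpha k) / J (Xs \<omega>) \<omega>')) = 0"
        using J_pos[OF x] H_pos
      proof eventually_elim
        fix \<omega>' assume "0 < J (Xs \<omega>) \<omega>'" "0 < H \<omega>'"
        then have "0 \<le> P k * H \<omega>' * Xs \<omega> powr (- alpha k) / J (Xs \<omega>) \<omega>'"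
          using param(2)[OF k] by simp
        then show "ennreal (- log 2 (1 + P k * H \<omega>' * Xs \<omega> powr (- alpha k) / J (Xs \<omega>) \<omega>')) = 0"
          by (simp add: ennreal_eq_0_iff)
      qed
      then show "(\<integral>\<^sup>+\<omega>'. ennreal (- log 2 (1 + P k * H \<omega>' * Xs \<omega> powr (- alpha k) / J (Xs \<omega>) \<omega>')) \<partial>Pr) = 0"
        by (subst nn_integral_0_iff_AE) auto
    qed
  qed
  finally have "(\<integral>\<^sup>+\<omega>. ennreal (- rate \<omega>) \<partial>Pr) = 0" by simp
  moreover have "(\<lambda>\<omega>. ennreal (- rate \<omega>)) \<in> borel_measurable Pr"
    using rate_measurable by measurable
  ultimately have "AE \<omega> in Pr. ennreal (- rate \<omega>) = 0"
    by (simp add: nn_integral_0_iff_AE)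
  then show ?thesis by eventually_elim (simp add: ennreal_eq_0_iff)
qed

text \<open>With the distance frozen, the layer-cake formula produces the coverage integrals; the
  substitution \<open>r = x\<^sup>2\<close> absorbs the factor \<open>2 * x\<close> of the density
  and maps \<open>{0..R}\<close> to \<open>{0..R\<^sup>2}\<close>.\<close>

lemma nn_integral_rate:
  "(\<integral>\<^sup>+\<omega>. ennreal (rate \<omega>) \<partial>Pr) = ennreal cst * (\<integral>\<^sup>+r\<in>{0..R\<^sup>2}. (\<integral>\<^sup>+\<beta>\<in>{0<..}. ennreal (\<Sum>p\<in>idx. FF p r \<beta>) \<partial>lborel) \<partial>lborel)"
proof -
  define G where "G x = (\<integral>\<^sup>+\<omega>. ennreal (log 2 (1 + P k * H \<omega> * x powr (- alpha k) / J x \<omega>)) \<partial>Pr)" for x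
  have G_meas: "G \<in> borel_measurable borel"
    unfolding G_def by measurable
  define TT where "TT r = (\<integral>\<^sup>+\<beta>\<in>{0<..}. ennreal (\<Sum>p\<in>idx. FF p r \<beta>) \<partial>lborel)" for r
  have TT_meas: "TT \<in> borel_measurable borel"
    unfolding TT_def by measurable
  define dens where "dens x = (if 0 < x \<and> x \<le> R
           then 2 * pi * lam k / assocT K lam P M B alpha eps k * x
                * exp (- pi * (\<Sum>j = 1..K. lam j * (Omega P M B j / Omega P M B k) powr delta alpha j
                                   * x powr (2 * (delta alpha j / delta alpha k))))
           else 0)" for x
  have "(\<integral>\<^sup>+\<omega>. ennreal (rate \<omega>) \<partial>Pr) = (\<integral>\<^sup>+\<omega>. G (Xs \<omega>) \<partial>Pr)"
    unfolding rate_def G_def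
    by (rule nn_integral_serving_distance[where g="\<lambda>x h y. ennreal (log 2 (1 + P k * h * x powr (- alpha k) / y))"]) measurable
  also have "\<dots> = (\<integral>\<^sup>+x. ennreal (dens x) * G x \<partial>lborel)"
    using distributed_nn_integral[OF X_dist, of G] G_meas unfolding dens_def by simp
  also have "\<dots> = (\<integral>\<^sup>+x. (ennreal cst * TT (x\<^sup>2)) * ennreal (2 * x) * indicator {0..R} x \<partial>lborel)"
  proof (rule nn_integral_cong_AE)
    show "AE x in lborel. ennreal (dens x) * G x = (ennreal cst * TT (x\<^sup>2)) * ennreal (2 * x) * indicator {0..R} x"
      using AE_lborel_singleton[of "0::real"]
    proof eventually_elim
      fix x :: real assume x0: "x \<noteq> 0"
      show "ennreal (dens x) * G x = (ennreal cst * TT (x\<^sup>2)) * ennreal (2 * x) * indicator {0..R} x"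
      proof (cases "0 < x \<and> x \<le> R")
        case True
        then have x: "0 < x" "x \<le> R" by auto
        define a where "a = P k * x powr (- alpha k)"
        have a: "0 < a" using x param(2)[OF k] by (simp add: a_def)
        define D where "D = pi * exp (- pi * assoc_sum K lam P M B alpha k (x\<^sup>2))"
        define pr where "pr \<beta> = prob {\<omega> \<in> space Pr. \<beta> / a * J x \<omega> < H \<omega>} / (1 + \<beta>)" for \<beta>
        have "(\<lambda>\<beta>. prob {\<omega> \<in> space Pr. \<beta> / a * J x \<omega> < H \<omega>}) \<in> borel_measurable borel"
          by measurable
        then have pr_meas[measurable]: "pr \<in> borel_measurable borel"
          unfolding pr_def by measurable
        have "G x = (\<integral>\<^sup>+\<omega>. ennreal (1 / ln 2) * ennreal (ln (1 + a * H \<omega> / J x \<omega>)) \<partial>Pr)"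
          unfolding G_def
        proof (intro nn_integral_cong)
          fix \<omega>
          have "log 2 (1 + P k * H \<omega> * x powr (- alpha k) / J x \<omega>) = 1 / ln 2 * ln (1 + a * H \<omega> / J x \<omega>)"
            by (simp add: log_def a_def mult_ac)
          then show "ennreal (log 2 (1 + P k * H \<omega> * x powr (- alpha k) / J x \<omega>)) = ennreal (1 / ln 2) * ennreal (ln (1 + a * H \<omega> / J x \<omega>))"
            by (simp only: ennreal_mult' ln_gt_zero_iff) (simp add: ennreal_mult'[symmetric])
        qed
        also have "\<dots> = ennreal (1 / ln 2) * (\<integral>\<^sup>+\<beta>\<in>{0<..}. ennreal (pr \<beta>) \<partial>lborel)"
          unfolding pr_def using nn_integral_ln_one_plus[OF H_meas J_measurable H_pos J_pos[OF x(1)] a]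
          by (subst nn_integral_cmult) auto
        finally have Gx: "G x = ennreal (1 / ln 2) * (\<integral>\<^sup>+\<beta>\<in>{0<..}. ennreal (pr \<beta>) \<partial>lborel)" .
        have "TT (x\<^sup>2) = (\<integral>\<^sup>+\<beta>. ennreal D * (ennreal (pr \<beta>) * indicator {0<..} \<beta>) \<partial>lborel)"
          unfolding TT_def
        proof (intro nn_integral_cong)
          fix \<beta> :: real
          show "ennreal (\<Sum>p\<in>idx. FF p (x\<^sup>2) \<beta>) * indicator {0<..} \<beta> = ennreal D * (ennreal (pr \<beta>) * indicator {0<..} \<beta>)"
          proof (cases "0 < \<beta>")
            case True
            have "(\<Sum>p\<in>idx. FF p (x\<^sup>2) \<beta>) = D * pr \<beta>"
              using coverage[OF x(1) True] by (simp only: D_def pr_def a_def)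
            moreover have "0 \<le> D" by (simp add: D_def)
            ultimately show ?thesis by (simp add: ennreal_mult' mult.assoc)
          qed simp
        qed
        also have "\<dots> = ennreal D * (\<integral>\<^sup>+\<beta>\<in>{0<..}. ennreal (pr \<beta>) \<partial>lborel)"
          by (rule nn_integral_cmult) measurable
        finally have TTx: "TT (x\<^sup>2) = ennreal D * (\<integral>\<^sup>+\<beta>\<in>{0<..}. ennreal (pr \<beta>) \<partial>lborel)" .
        have "(x\<^sup>2) powr (dl j / dl k) = x powr (2 * (dl j / dl k))" for j
          using x by (simp add: powr_powr flip: powr_numeral)
        \<comment> \<open>The factor \<open>pi\<close> and the exponential sit in \<open>D\<close>,
          \<open>2 * x\<close> is kept for the substitution, and what remains of the density is
          \<open>cst\<close>.\<close>
        then have "dens x * (1 / ln 2) = cst * D * (2 * x)"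
          using x by (simp add: dens_def D_def assoc_sum_def cst_def mult_ac)
        moreover have "0 \<le> dens x" "0 \<le> D" "0 \<le> 2 * x"
          using x param(1)[OF k] assocT_pos by (auto simp: dens_def D_def)
        ultimately have "ennreal (dens x) * ennreal (1 / ln 2) = ennreal cst * ennreal D * ennreal (2 * x)"
          using cst_pos by (simp add: ennreal_mult[symmetric] del: times_divide_eq_left times_divide_eq_right mult_1_right)
        moreover have "a1 * (a2 * I) = b1 * (b2 * I) * b3" if "a1 * a2 = b1 * b2 * b3" for a1 a2 b1 b2 b3 I :: ennreal
          using arg_cong[OF that, of "\<lambda>z. z * I"] by (simp only: mult_ac)
        ultimately have "ennreal (dens x) * G x = ennreal cst * TT (x\<^sup>2) * ennreal (2 * x)"
          unfolding Gx TTx by blast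
        then show ?thesis using x by simp
      next
        case False
        then show ?thesis using x0 by (auto simp: dens_def split: split_indicator)
      qed
    qed
  qed
  also have "\<dots> = (\<integral>\<^sup>+r. (ennreal cst * TT r) * indicator {0\<^sup>2..R\<^sup>2} r \<partial>lborel)"
    by (rule nn_integral_substitution_aux[symmetric])
       (use R_pos TT_meas in \<open>auto intro!: derivative_eq_intros continuous_intros\<close>)
  also have "\<dots> = ennreal cst * (\<integral>\<^sup>+r\<in>{0..R\<^sup>2}. TT r \<partial>lborel)"
    using TT_meas by (subst nn_integral_cmult[symmetric]) (auto simp: mult.assoc)
  finally show ?thesis unfolding TT_def .
qed

text \<open>Up to \<open>\<beta> = 2\<close> the coverage probability is bounded by 1. Beyond, its
  exponential decay in \<open>r * \<beta> powr dl k\<close> is weakened to the power -1/2, which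
  separates the variables and leaves two one-dimensional integrals.\<close>

lemma nn_integral_FF_finite:
  "(\<integral>\<^sup>+r\<in>{0..R\<^sup>2}. (\<integral>\<^sup>+\<beta>\<in>{0<..}. ennreal (\<Sum>p\<in>idx. FF p r \<beta>) \<partial>lborel) \<partial>lborel) < \<infinity>"
proof -
  define A where "A = pi * mu k * dl k / 2"
  have A: "0 < A" using mu_pos[OF k] param(8)[OF k] by (simp add: A_def)
  define N where "N = (\<Sum>m\<le>M k - 1. 2 ^ m :: real)"
  have N: "0 \<le> N" by (simp add: N_def sum_nonneg)
  \<comment> \<open>\<open>- (dl k / 2)\<close> comes from the weakened decay and \<open>- 1\<close>
    from bounding \<open>1 / (1 + \<beta>)\<close> by \<open>1 / \<beta>\<close>.\<close>
  define e where "e = - (dl k / 2) - 1"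
  have e: "e < -1" using param(8)[OF k] by (simp add: e_def)
  define c where "c = pi * N * (A * (1 / 2) powr dl k) powr (- (1 / 2))"
  have c: "0 \<le> c" using N by (simp add: c_def)
  have bound: "(\<Sum>p\<in>idx. FF p r \<beta>) \<le> (if \<beta> \<le> 2 then pi else c * (r powr (- (1 / 2)) * \<beta> powr e))"
    if r: "0 < r" and \<beta>: "0 < \<beta>" for r \<beta>
  proof -
    define x where "x = sqrt r"
    have x: "0 < x" "x\<^sup>2 = r" using r by (auto simp: x_def)
    define q where "q = prob {\<omega> \<in> space Pr. \<beta> / (P k * x powr (- alpha k)) * J x \<omega> < H \<omega>}"
    have q: "0 \<le> q" "q \<le> 1" by (auto simp: q_def)
    have ex: "exp (- pi * assoc_sum K lam P M B alpha k r) \<le> 1"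
      using assoc_sum_nonneg[of k r] by simp
    have FF: "(\<Sum>p\<in>idx. FF p r \<beta>) = pi * exp (- pi * assoc_sum K lam P M B alpha k r) * (q / (1 + \<beta>))"
      using coverage[OF x(1) \<beta>] unfolding x q_def .
    also have "\<dots> \<le> pi * 1 * (q / (1 + \<beta>))"
      using ex q \<beta> by (intro mult_right_mono mult_left_mono) auto
    finally have le: "(\<Sum>p\<in>idx. FF p r \<beta>) \<le> pi * (q / (1 + \<beta>))" by simp
    show ?thesis
    proof (cases "\<beta> \<le> 2")
      case True
      have "q / (1 + \<beta>) \<le> 1" using q \<beta> by simp
      then have "pi * (q / (1 + \<beta>)) \<le> pi * 1" by (intro mult_left_mono) auto
      with le True show ?thesis by simp
    next
      case False
      have y: "0 < A * r * (\<beta> / 2) powr dl k" using A r \<beta> by simp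
      have "q \<le> N * exp (- A * x\<^sup>2 * (\<beta> / 2) powr dl k)"
        using coverage_bound[OF x(1), of \<beta>] False unfolding q_def N_def A_def by simp
      also have "\<dots> \<le> N * (A * r * (\<beta> / 2) powr dl k) powr (- (1 / 2))"
        using exp_minus_le_powr[OF y] N unfolding x by (intro mult_left_mono) (auto simp: mult.assoc)
      also have "A * r * (\<beta> / 2) powr dl k = (A * (1 / 2) powr dl k) * (r * \<beta> powr dl k)"
        using \<beta> by (simp add: powr_divide)
      also have "((A * (1 / 2) powr dl k) * (r * \<beta> powr dl k)) powr (- (1 / 2))
         = (A * (1 / 2) powr dl k) powr (- (1 / 2)) * (r powr (- (1 / 2)) * \<beta> powr (- (dl k / 2)))"
        using A r \<beta> by (simp add: powr_mult powr_powr)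
      finally have q2: "pi * q \<le> c * (r powr (- (1 / 2)) * \<beta> powr (- (dl k / 2)))"
        using mult_left_mono[of q _ pi] unfolding c_def by (simp add: mult.assoc)
      have "pi * (q / (1 + \<beta>)) \<le> pi * q / \<beta>"
        using q \<beta> by (simp add: frac_le)
      also have "\<dots> \<le> c * (r powr (- (1 / 2)) * \<beta> powr (- (dl k / 2))) / \<beta>"
        using q2 \<beta> by (intro divide_right_mono) auto
      also have "\<dots> = c * (r powr (- (1 / 2)) * \<beta> powr e)"
        using \<beta> by (simp add: e_def powr_diff)
      finally show ?thesis using le False by simp
    qed
  qed
  define I2 where "I2 = (\<integral>\<^sup>+\<beta>\<in>{2..}. ennreal (\<beta> powr e) \<partial>lborel)"
  have I2: "I2 < \<infinity>"
    unfolding I2_def using has_integral_powr_to_inf[of e 2] e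
    by (intro nn_integral_finite_if_integrable_on) (auto simp: integrable_on_def)
  define I1 where "I1 = (\<integral>\<^sup>+r\<in>{0..R\<^sup>2}. ennreal (r powr (- (1 / 2))) \<partial>lborel)"
  have I1: "I1 < \<infinity>"
    unfolding I1_def by (intro nn_integral_finite_if_integrable_on integrable_on_powr_from_0) auto
  have inner: "(\<integral>\<^sup>+\<beta>\<in>{0<..}. ennreal (\<Sum>p\<in>idx. FF p r \<beta>) \<partial>lborel) \<le> ennreal (2 * pi) + ennreal c * ennreal (r powr (- (1 / 2))) * I2"
    if r: "0 < r" for r
  proof -
    have "(\<integral>\<^sup>+\<beta>\<in>{0<..}. ennreal (\<Sum>p\<in>idx. FF p r \<beta>) \<partial>lborel)
       \<le> (\<integral>\<^sup>+\<beta>. ennreal pi * indicator {0..2} \<beta> + ennreal c * ennreal (r powr (- (1 / 2))) * (ennreal (\<beta> powr e) * indicator {2..} \<beta>) \<partial>lborel)"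
    proof (intro nn_integral_mono)
      fix \<beta> :: real
      show "ennreal (\<Sum>p\<in>idx. FF p r \<beta>) * indicator {0<..} \<beta>
        \<le> ennreal pi * indicator {0..2} \<beta> + ennreal c * ennreal (r powr (- (1 / 2))) * (ennreal (\<beta> powr e) * indicator {2..} \<beta>)"
      proof (cases "0 < \<beta>")
        case True
        note b = ennreal_leI[OF bound[OF r True]]
        show ?thesis
        proof (cases "\<beta> \<le> 2")
          case le2: True
          with b True show ?thesis by (auto intro!: add_increasing2)
        next
          case False
          with b True c show ?thesis by (auto simp: ennreal_mult mult.assoc)
        qed
      qed simp
    qed
    also have "\<dots> = ennreal (2 * pi) + ennreal c * ennreal (r powr (- (1 / 2))) * I2"
    proof -
      have "(\<integral>\<^sup>+\<beta>. ennreal pi * indicator {0..2::real} \<beta> \<partial>lborel) = ennreal (2 * pi)"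
        by (subst nn_integral_cmult_indicator) (auto simp: ennreal_mult mult.commute)
      moreover have "(\<integral>\<^sup>+\<beta>. ennreal c * ennreal (r powr (- (1 / 2))) * (ennreal (\<beta> powr e) * indicator {2..} \<beta>) \<partial>lborel)
          = ennreal c * ennreal (r powr (- (1 / 2))) * I2"
        unfolding I2_def by (rule nn_integral_cmult) measurable
      ultimately show ?thesis by (subst nn_integral_add) auto
    qed
    finally show ?thesis .
  qed
  have "(\<integral>\<^sup>+r\<in>{0..R\<^sup>2}. (\<integral>\<^sup>+\<beta>\<in>{0<..}. ennreal (\<Sum>p\<in>idx. FF p r \<beta>) \<partial>lborel) \<partial>lborel)
    \<le> (\<integral>\<^sup>+r. ennreal (2 * pi) * indicator {0..R\<^sup>2} r + ennreal c * I2 * (ennreal (r powr (- (1 / 2))) * indicator {0..R\<^sup>2} r) \<partial>lborel)"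
  proof (rule nn_integral_mono_AE)
    show "AE r in lborel. (\<integral>\<^sup>+\<beta>\<in>{0<..}. ennreal (\<Sum>p\<in>idx. FF p r \<beta>) \<partial>lborel) * indicator {0..R\<^sup>2} r
      \<le> ennreal (2 * pi) * indicator {0..R\<^sup>2} r + ennreal c * I2 * (ennreal (r powr (- (1 / 2))) * indicator {0..R\<^sup>2} r)"
      using AE_lborel_singleton[of "0::real"]
    proof eventually_elim
      fix r :: real assume "r \<noteq> 0"
      then show "(\<integral>\<^sup>+\<beta>\<in>{0<..}. ennreal (\<Sum>p\<in>idx. FF p r \<beta>) \<partial>lborel) * indicator {0..R\<^sup>2} r
        \<le> ennreal (2 * pi) * indicator {0..R\<^sup>2} r + ennreal c * I2 * (ennreal (r powr (- (1 / 2))) * indicator {0..R\<^sup>2} r)"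
        using inner[of r] by (auto simp: mult_ac split: split_indicator)
    qed
  qed
  also have "\<dots> = ennreal (2 * pi) * ennreal (R\<^sup>2) + ennreal c * I2 * I1"
    unfolding I1_def by (simp add: nn_integral_add nn_integral_cmult)
  also have "\<dots> < \<infinity>"
    using I1 I2 by (simp add: ennreal_mult_less_top)
  finally show ?thesis .
qed

text \<open>All terms are nonnegative with finite total, so each is finite on its own, and the sum
  can be split before returning from extended to Lebesgue integrals.\<close>

lemma expectation_rate:
  "expectation rate = cst * (\<Sum>p\<in>idx. set_lebesgue_integral lborel {0..R\<^sup>2} (\<lambda>r. set_lebesgue_integral lborel {0<..} (FF p r)))"
proof -
  have [measurable]: "(\<lambda>(r, \<beta>). FF p r \<beta>) \<in> borel_measurable (borel \<Otimes>\<^sub>M borel)" for p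
    by (rule FF_measurable)
  define L where "L p = (\<integral>\<^sup>+r\<in>{0..R\<^sup>2}. (\<integral>\<^sup>+\<beta>\<in>{0<..}. ennreal (FF p r \<beta>) \<partial>lborel) \<partial>lborel)" for p
  have "(\<integral>\<^sup>+\<beta>\<in>{0<..}. ennreal (\<Sum>p\<in>idx. FF p r \<beta>) \<partial>lborel) = (\<Sum>p\<in>idx. \<integral>\<^sup>+\<beta>\<in>{0<..}. ennreal (FF p r \<beta>) \<partial>lborel)" for r
  proof -
    have "(\<integral>\<^sup>+\<beta>\<in>{0<..}. ennreal (\<Sum>p\<in>idx. FF p r \<beta>) \<partial>lborel) = (\<integral>\<^sup>+\<beta>. (\<Sum>p\<in>idx. ennreal (FF p r \<beta>) * indicator {0<..} \<beta>) \<partial>lborel)"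
      by (intro nn_integral_cong) (auto simp: sum_ennreal FF_nonneg less_imp_le split: split_indicator)
    also have "\<dots> = (\<Sum>p\<in>idx. \<integral>\<^sup>+\<beta>\<in>{0<..}. ennreal (FF p r \<beta>) \<partial>lborel)"
      by (rule nn_integral_sum) measurable
    finally show ?thesis .
  qed
  then have sumL: "(\<integral>\<^sup>+r\<in>{0..R\<^sup>2}. (\<integral>\<^sup>+\<beta>\<in>{0<..}. ennreal (\<Sum>p\<in>idx. FF p r \<beta>) \<partial>lborel) \<partial>lborel) = (\<Sum>p\<in>idx. L p)"
    unfolding L_def by (simp only: sum_distrib_right) (rule nn_integral_sum, measurable)
  have finL: "L p < \<infinity>" if "p \<in> idx" for p
  proof -
    have "L p \<le> (\<Sum>p\<in>idx. L p)" using that by (intro member_le_sum) auto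
    also have "\<dots> < \<infinity>" using nn_integral_FF_finite unfolding sumL .
    finally show ?thesis .
  qed
  define v where "v p = set_lebesgue_integral lborel {0..R\<^sup>2} (\<lambda>r. set_lebesgue_integral lborel {0<..} (FF p r))" for p
  have v: "ennreal (v p) = L p" if "p \<in> idx" for p
    unfolding v_def L_def
    by (rule nn_integral_set_set_lebesgue) (use finL[OF that] in \<open>auto simp: L_def FF_nonneg less_imp_le\<close>)
  have v0: "0 \<le> v p" for p
    unfolding v_def set_lebesgue_integral_def
    by (intro Bochner_Integration.integral_nonneg) (auto simp: FF_nonneg less_imp_le intro!: Bochner_Integration.integral_nonneg split: split_indicator)
  have "(\<integral>\<^sup>+\<omega>. ennreal (rate \<omega>) \<partial>Pr) = ennreal cst * (\<Sum>p\<in>idx. ennreal (v p))"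
    unfolding nn_integral_rate sumL using v by simp
  also have "\<dots> = ennreal (cst * (\<Sum>p\<in>idx. v p))"
    using v0 cst_pos by (simp add: sum_ennreal ennreal_mult sum_nonneg del: times_divide_eq_left times_divide_eq_right)
  finally have "(\<integral>\<^sup>+\<omega>. ennreal (rate \<omega>) \<partial>Pr) = ennreal (cst * (\<Sum>p\<in>idx. v p))" .
  moreover have "expectation rate = enn2real (\<integral>\<^sup>+\<omega>. ennreal (rate \<omega>) \<partial>Pr)"
    by (rule integral_eq_nn_integral[OF rate_measurable rate_nonneg])
  moreover have "0 \<le> cst * (\<Sum>p\<in>idx. v p)"
    using v0 cst_pos by (intro mult_nonneg_nonneg sum_nonneg) auto
  ultimately show ?thesis
    by (simp only: enn2real_ennreal v_def)
qed

section \<open>Return to hypergeometric functions and matrix powers\<close>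

lemma gfun_eq_gg:
  assumes "0 < \<beta>"
  shows "gfun K lam P M B alpha eps lam_u k n x \<beta> = gg n x \<beta>"
  unfolding gfun_def gg_def
  by (intro sum.cong refl) (simp add: phi_eq_psi param tau_nonneg assms less_imp_le)

text \<open>\<open>Qmat\<close> is the Toeplitz matrix of \<open>GF\<close>, and column 0 of such a
  matrix lists the coefficients. Row \<open>n\<close> of column 0 is the entry
  \<open>(n+1,1)\<close> in one-based numbering.\<close>

lemma Qmat_power_entry:
  assumes "0 < \<beta>" "n < M k"
  shows "(Qmat K lam P M B alpha eps lam_u k x \<beta> ^\<^sub>m i) $$ (n, 0) = fps_nth (GF x \<beta> ^ i) n"
proof -
  have "Qmat K lam P M B alpha eps lam_u k x \<beta> = toeplitz (M k) (GF x \<beta>)"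
    by (rule eq_matI) (auto simp: Qmat_def toeplitz_def GF_def gfun_eq_gg[OF assms(1)])
  then show ?thesis
    using assms(2) by (simp add: toeplitz_power) (simp add: toeplitz_def)
qed

theorem average_rate:
  "(\<integral>\<omega>. log 2 (1 + P k * H \<omega> * Xs \<omega> powr (- alpha k) /
          ((\<Sum>j = 1..K. \<Sum>n. (if norm (Phi j n \<omega>) >
                  (Omega P M B j / Omega P M B k) powr (1 / alpha j) * Xs \<omega> powr (alpha k / alpha j)
                then P j * V j n \<omega> * norm (Phi j n \<omega>) powr (- alpha j) else 0)) + W)) \<partial>Pr)
     = 1 / ln 2 * (lam k / assocT K lam P M B alpha eps k) *
       (\<Sum>i<M k. \<Sum>m<M k. \<Sum>n\<le>m.
          set_lebesgue_integral lborel {0..(Rad P M B alpha eps k)\<^sup>2} (\<lambda>x.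
            set_lebesgue_integral lborel {0<..} (\<lambda>\<beta>.
              pi ^ (i + 1) * (\<beta> * W / P k) ^ (m - n) / (fact (m - n) * fact i)
              * x powr (alpha k / 2 * real (m - n)) / (1 + \<beta>)
              * exp (- (\<beta> * W / P k) * x powr (alpha k / 2)
                     - pi * gfun K lam P M B alpha eps lam_u k 0 x \<beta>
                     - pi * assoc_sum K lam P M B alpha k x)
              * (Qmat K lam P M B alpha eps lam_u k x \<beta> ^\<^sub>m i) $$ (n, 0))))"
proof -
  \<comment> \<open>The identifications hold for positive \<open>\<beta>\<close> and
    \<open>n < M k\<close>; the ranges of integration and summation guarantee both.\<close>
  have eq: "set_lebesgue_integral lborel {0<..} (\<lambda>\<beta>.
              pi ^ (i + 1) * (\<beta> * W / P k) ^ (m - n) / (fact (m - n) * fact i)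
              * x powr (alpha k / 2 * real (m - n)) / (1 + \<beta>)
              * exp (- (\<beta> * W / P k) * x powr (alpha k / 2)
                     - pi * gfun K lam P M B alpha eps lam_u k 0 x \<beta>
                     - pi * assoc_sum K lam P M B alpha k x)
              * (Qmat K lam P M B alpha eps lam_u k x \<beta> ^\<^sub>m i) $$ (n, 0))
        = set_lebesgue_integral lborel {0<..} (FF (i, m, n) x)" if "n < M k" for i m n x
    by (rule set_lebesgue_integral_cong) (auto simp: FF_def gfun_eq_gg Qmat_power_entry that)
  have "(\<integral>\<omega>. log 2 (1 + P k * H \<omega> * Xs \<omega> powr (- alpha k) /
          ((\<Sum>j = 1..K. \<Sum>n. (if norm (Phi j n \<omega>) >
                  (Omega P M B j / Omega P M B k) powr (1 / alpha j) * Xs \<omega> powr (alpha k / alpha j)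
                then P j * V j n \<omega> * norm (Phi j n \<omega>) powr (- alpha j) else 0)) + W)) \<partial>Pr) = expectation rate"
    unfolding rate_def J_def Itier_def rho_def ..
  also have "\<dots> = cst * (\<Sum>i<M k. \<Sum>m<M k. \<Sum>n\<le>m. set_lebesgue_integral lborel {0..R\<^sup>2} (\<lambda>r. set_lebesgue_integral lborel {0<..} (FF (i, m, n) r)))"
    unfolding expectation_rate sum_idx by (rule refl)
  also have "(\<Sum>i<M k. \<Sum>m<M k. \<Sum>n\<le>m. set_lebesgue_integral lborel {0..R\<^sup>2} (\<lambda>r. set_lebesgue_integral lborel {0<..} (FF (i, m, n) r)))
    = (\<Sum>i<M k. \<Sum>m<M k. \<Sum>n\<le>m.
          set_lebesgue_integral lborel {0..(Rad P M B alpha eps k)\<^sup>2} (\<lambda>x.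
            set_lebesgue_integral lborel {0<..} (\<lambda>\<beta>.
              pi ^ (i + 1) * (\<beta> * W / P k) ^ (m - n) / (fact (m - n) * fact i)
              * x powr (alpha k / 2 * real (m - n)) / (1 + \<beta>)
              * exp (- (\<beta> * W / P k) * x powr (alpha k / 2)
                     - pi * gfun K lam P M B alpha eps lam_u k 0 x \<beta>
                     - pi * assoc_sum K lam P M B alpha k x)
              * (Qmat K lam P M B alpha eps lam_u k x \<beta> ^\<^sub>m i) $$ (n, 0))))"
    by (intro sum.cong refl) (subst eq, auto)
  finally show ?thesis unfolding cst_def .
qed

end

theorem theorem4:
  fixes K :: nat and k :: nat
    and lam P B alpha :: "nat \<Rightarrow> real" and M :: "nat \<Rightarrow> nat"
    and lam_u eps W :: real
    and Pr :: "'a measure"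
    and Xs H :: "'a \<Rightarrow> real"
    and Phi :: "nat \<Rightarrow> nat \<Rightarrow> 'a \<Rightarrow> real \<times> real"
    and V :: "nat \<Rightarrow> nat \<Rightarrow> 'a \<Rightarrow> real"
  assumes k: "k \<in> {1..K}"
    and params: "\<forall>j\<in>{1..K}. lam j > 0 \<and> P j > 0 \<and> M j \<ge> 1 \<and> B j > 0 \<and> alpha j > 2"
    and lam_u: "lam_u > 0" and eps: "eps > 0" and W: "W \<ge> 0"
    and prob: "prob_space Pr"
    (* serving distance X_k, conditional on association with tier k *)
    and X_meas: "Xs \<in> borel_measurable Pr"
    and X_dist: "distributed Pr lborel Xs (\<lambda>x. ennreal
          (if 0 < x \<and> x \<le> Rad P M B alpha eps k
           then 2 * pi * lam k / assocT K lam P M B alpha eps k * x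
                * exp (- pi * (\<Sum>j = 1..K. lam j * (Omega P M B j / Omega P M B k) powr delta alpha j
                                   * x powr (2 * (delta alpha j / delta alpha k))))
           else 0))"
    (* signal gain ||h||^2 ~ Gamma(M_k, 1) *)
    and H_meas: "H \<in> borel_measurable Pr"
    and H_dist: "distributed Pr lborel H (\<lambda>x. ennreal (erlang_density (M k - 1) 1 x))"
    (* tier-j active BSs: homogeneous PPP of intensity A_j lambda_j *)
    and Phi_PPP: "\<forall>j\<in>{1..K}. is_PPP Pr (Phi j) (activ K lam P M B alpha eps lam_u j * lam j)"
    (* interferer fading V ~ Exp(1) *)
    and V_meas: "\<forall>j\<in>{1..K}. \<forall>n. V j n \<in> borel_measurable Pr"
    and V_dist: "\<forall>j\<in>{1..K}. \<forall>n. distributed Pr lborel (V j n) (\<lambda>v. ennreal (exponential_density 1 v))"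
    (* mutual independence of all these *)
    and indep: "prob_space.indep_sets Pr
        (\<lambda>g. case g of GX \<Rightarrow> gen_sigma Pr Xs | GH \<Rightarrow> gen_sigma Pr H
                     | GPhi j \<Rightarrow> gen_sigma_seq Pr (Phi j) | GV j n \<Rightarrow> gen_sigma Pr (V j n))
        ({GX, GH} \<union> GPhi ` {1..K} \<union> {GV j n | j n. j \<in> {1..K}})"
  shows
    "(\<integral>\<omega>. log 2 (1 + P k * H \<omega> * Xs \<omega> powr (- alpha k) /
          ((\<Sum>j = 1..K. \<Sum>n. (if norm (Phi j n \<omega>) >
                  (Omega P M B j / Omega P M B k) powr (1 / alpha j) * Xs \<omega> powr (alpha k / alpha j)
                then P j * V j n \<omega> * norm (Phi j n \<omega>) powr (- alpha j) else 0)) + W)) \<partial>Pr)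
     = 1 / ln 2 * (lam k / assocT K lam P M B alpha eps k) *
       (\<Sum>i<M k. \<Sum>m<M k. \<Sum>n\<le>m.
          set_lebesgue_integral lborel {0..(Rad P M B alpha eps k)\<^sup>2} (\<lambda>x.
            set_lebesgue_integral lborel {0<..} (\<lambda>\<beta>.
              pi ^ (i + 1) * (\<beta> * W / P k) ^ (m - n) / (fact (m - n) * fact i)
              * x powr (alpha k / 2 * real (m - n)) / (1 + \<beta>)
              * exp (- (\<beta> * W / P k) * x powr (alpha k / 2)
                     - pi * gfun K lam P M B alpha eps lam_u k 0 x \<beta>
                     - pi * assoc_sum K lam P M B alpha k x)
              * (Qmat K lam P M B alpha eps lam_u k x \<beta> ^\<^sub>m i) $$ (n, 0))))"
proof -
  interpret network Pr K k lam P B alpha M lam_u eps W Xs H Phi V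
    using assms by (intro network.intro network_axioms.intro)
  show ?thesis by (rule average_rate)
qed

end
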